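(* Let $K\subseteq\mathbb{R}^n$ be a centrally symmetric convex body in John's position and let $(c_j,v_j)_{j=1}^m\subseteq(0,1]\times(\partial K\cap S^{n-1})$ be its associated decomposition of the identity. Let $H$ be a $k$-dimensional linear subspace of $\mathbb{R}^n$, let $J=\{1\le j\le m:P_Hv_j\neq0\}$ and let $m_0$ be the cardinality of $J$. Assume that $\tilde c_j=c_j\|P_Hv_j\|_2^2\ge\frac12$ for every $j\in J$. Then $$\mathrm{vol}_k(K\cap H)\le2^{\frac{m_0-k}{2}}\,\mathrm{vol}_k(B_\infty^k)\prod_{j\in J}c_j^{\frac{c_j\|P_Hv_j\|_2^2}{2}}\le\prod_{j\in J}\left(\frac{1}{\|P_Hv_j\|_2}\right)^{c_j\|P_Hv_j\|_2^2}\mathrm{vol}_k(B_\infty^k)\le\left(\frac nk\right)^{\frac k2}\mathrm{vol}_k(B_\infty^k).$$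
   Context: A convex body $K\subseteq\mathbb{R}^n$ is in John's position if the maximal volume ellipsoid contained in $K$ is the Euclidean unit ball $B_2^n$. A centrally symmetric convex body $K$ is in John's position if and only if $B_2^n\subseteq K$ and there exist contact points $v_1,\dots,v_m\in\partial K\cap S^{n-1}$ and $c_1,\dots,c_m\in(0,1]$ with $\mathrm{Id}_n=\sum_{j=1}^mc_j\,v_j\otimes v_j$; such a family $(c_j,v_j)_{j=1}^m$ is called an associated decomposition of the identity. $P_H$ is the orthogonal projection onto $H$, and $B_\infty^k=[-1,1]^k$. *)

theory Defs
  imports "HOL-Analysis.Analysis"
begin

definition convex_body :: "(real^'n) set \<Rightarrow> bool" where
  "convex_body K \<longleftrightarrow> convex K \<and> compact K \<and> interior K \<noteq> {}"

definition centrally_symmetric :: "(real^'n) set \<Rightarrow> bool" where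
  "centrally_symmetric K \<longleftrightarrow> uminus ` K = K"

definition ellipsoid :: "(real^'n) set \<Rightarrow> bool" where
  "ellipsoid E \<longleftrightarrow>
     (\<exists>a (f :: real^'n \<Rightarrow> real^'n). linear f \<and> bij f \<and> E = (\<lambda>x. a + f x) ` cball 0 1)"

definition max_volume_ellipsoid :: "(real^'n) set \<Rightarrow> (real^'n) set \<Rightarrow> bool" where
  "max_volume_ellipsoid K E \<longleftrightarrow> ellipsoid E \<and> E \<subseteq> K \<and>
     (\<forall>E'. ellipsoid E' \<and> E' \<subseteq> K \<longrightarrow> measure lebesgue E' \<le> measure lebesgue E)"

(* The maximal volume ellipsoid of a convex body is unique, so being a maximiser is the same as
   being the maximiser. *)
definition john_position :: "(real^'n) set \<Rightarrow> bool" where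
  "john_position K \<longleftrightarrow> max_volume_ellipsoid K (cball 0 1)"

definition tensor :: "real^'n \<Rightarrow> real^'n \<Rightarrow> real^'n^'n" where
  "tensor u v = (\<chi> i j. u $ i * v $ j)"

definition decomposition_of_identity ::
    "(real^'n) set \<Rightarrow> nat \<Rightarrow> (nat \<Rightarrow> real) \<Rightarrow> (nat \<Rightarrow> real^'n) \<Rightarrow> bool" where
  "decomposition_of_identity K m c v \<longleftrightarrow>
     (\<forall>j\<in>{1..m}. c j \<in> {0<..1} \<and> v j \<in> frontier K \<inter> sphere 0 1) \<and>
     mat 1 = (\<Sum>j=1..m. c j *\<^sub>R tensor (v j) (v j))"

definition orth_proj :: "'a::euclidean_space set \<Rightarrow> 'a \<Rightarrow> 'a" where
  "orth_proj H x = (THE p. p \<in> H \<and> (\<forall>h\<in>H. orthogonal (x - p) h))"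

lemma orth_proj_eqI:
  fixes H :: "'a::euclidean_space set"
  assumes "subspace H" "p \<in> H" "\<And>h. h \<in> H \<Longrightarrow> orthogonal (x - p) h"
  shows "orth_proj H x = p"
  unfolding orth_proj_def
proof (rule the_equality)
  fix q assume q: "q \<in> H \<and> (\<forall>h\<in>H. orthogonal (x - q) h)"
  have "p - q \<in> H" using assms q by (simp add: subspace_diff)
  then have "orthogonal (x - q) (p - q)" "orthogonal (x - p) (p - q)"
    using assms q by auto
  then have "(p - q) \<bullet> (p - q) = 0"
    by (simp add: orthogonal_def inner_diff_left)
  then show "q = p" by simp
qed (use assms in auto)

lemma orth_proj_props:
  fixes H :: "'a::euclidean_space set"
  assumes "subspace H"
  shows "orth_proj H x \<in> H" and "h \<in> H \<Longrightarrow> orthogonal (x - orth_proj H x) h"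
proof -
  obtain y z where yz: "y \<in> span H" "\<And>w. w \<in> span H \<Longrightarrow> orthogonal z w" "x = y + z"
    using orthogonal_subspace_decomp_exists[of H x] by metis
  have sH: "span H = H" using assms by (simp add: span_eq_iff)
  have "orth_proj H x = y" using yz sH by (intro orth_proj_eqI[OF assms]) simp_all
  then show "orth_proj H x \<in> H" "h \<in> H \<Longrightarrow> orthogonal (x - orth_proj H x) h"
    using yz sH by auto
qed

definition isometry_onto :: "(real^'k \<Rightarrow> real^'n) \<Rightarrow> (real^'n) set \<Rightarrow> bool" where
  "isometry_onto f H \<longleftrightarrow> linear f \<and> (\<forall>x. norm (f x) = norm x) \<and> range f = H"

(* k-dimensional volume inside a linear subspace H of dimension k = CARD('k): Lebesgue measure on
   real^'k transported by a linear isometry onto H. By isometry_onto_exists there is such an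
   isometry, and by subspace_volume_eq its choice is irrelevant for Borel sets. *)
definition subspace_volume :: "'k::finite itself \<Rightarrow> (real^'n) set \<Rightarrow> (real^'n) set \<Rightarrow> real" where
  "subspace_volume _ H A =
     measure lebesgue ((SOME f :: real^'k \<Rightarrow> real^'n. isometry_onto f H) -` A)"

lemma isometry_onto_exists:
  fixes H :: "(real^'n) set"
  assumes "subspace H" "dim H = CARD('k::finite)"
  shows "\<exists>f :: real^'k \<Rightarrow> real^'n. isometry_onto f H"
proof -
  obtain f :: "real^'k \<Rightarrow> real^'n" and g
    where "linear f" "f ` UNIV = H" "\<And>x. x \<in> UNIV \<Longrightarrow> norm (f x) = norm x"
    using isometries_subspaces[of "UNIV :: (real^'k) set" H] assms
    by (metis DIM_cart DIM_real dim_UNIV mult.right_neutral subspace_UNIV)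
  then show ?thesis unfolding isometry_onto_def by blast
qed

lemma isometry_onto_inj:
  assumes "isometry_onto f H" shows "inj f"
proof -
  have "linear f" "\<And>x. norm (f x) = norm x" using assms by (auto simp: isometry_onto_def)
  then show ?thesis by (metis linear_injective_0 norm_eq_zero)
qed

lemma emeasure_open_le_orthogonal_image:
  fixes T :: "'a::euclidean_space \<Rightarrow> 'a"
  assumes T: "orthogonal_transformation T" and U: "open U"
  shows "emeasure lborel U \<le> emeasure lborel (T ` U)"
proof -
  define I where "I = {(x :: 'a, r :: real). 0 < r \<and> ball x r \<subseteq> U}"
  have cov: "\<exists>i. i \<in> I \<and> x \<in> ball (fst i) (snd i) \<and> snd i < d" if "x \<in> U" "0 < d" for x d
  proof -
    obtain e where "e > 0" "ball x e \<subseteq> U" using U \<open>x \<in> U\<close> by (meson openE)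
    then have "(x, min e (d / 2)) \<in> I" using \<open>0 < d\<close> by (auto simp: I_def)
    then show ?thesis using \<open>e > 0\<close> \<open>0 < d\<close>
      by (intro exI[of _ "(x, min e (d / 2))"]) auto
  qed
  obtain C where C: "countable C" "C \<subseteq> I"
      "pairwise (\<lambda>i j. disjnt (ball (fst i) (snd i)) (ball (fst j) (snd j))) C"
    and neg: "negligible (U - (\<Union>i\<in>C. ball (fst i) (snd i)))"
    using Vitali_covering_theorem_balls[of U I fst snd, OF cov] by blast
  let ?B = "\<lambda>i. ball (fst i) (snd i)"
  have inj: "inj T" using T by (rule orthogonal_transformation_inj)
  have TB: "T ` ?B i = ball (T (fst i)) (snd i)" for i
    using T by (rule image_orthogonal_transformation_ball)
  have disj: "disjoint_family_on ?B C"
    using C(3) by (auto simp: disjoint_family_on_def pairwise_def disjnt_def)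
  have disjT: "disjoint_family_on (\<lambda>i. T ` ?B i) C"
    using disj inj unfolding disjoint_family_on_def
    by (metis image_Int image_empty)
  have BU: "(\<Union>i\<in>C. ?B i) \<subseteq> U" using C(2) by (fastforce simp: I_def)
  have oB: "open (\<Union>i\<in>C. ?B i)" by auto
  have oTU: "open (T ` U)"
    using T U orthogonal_transformation_surj open_surjective_linear_image
      orthogonal_transformation_linear by blast
  have null: "U - (\<Union>i\<in>C. ?B i) \<in> null_sets lborel"
  proof -
    have "U - (\<Union>i\<in>C. ?B i) \<in> sets borel" using U oB by auto
    then show ?thesis using neg
      by (auto simp: negligible_iff_null_sets null_sets_completion_iff)
  qed
  have "emeasure lborel U = emeasure lborel ((\<Union>i\<in>C. ?B i) \<union> (U - (\<Union>i\<in>C. ?B i)))"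
    using BU by (simp add: Un_absorb1)
  also have "\<dots> = emeasure lborel (\<Union>i\<in>C. ?B i)"
    using null oB by (intro emeasure_Un_null_set) auto
  also have "\<dots> = (\<integral>\<^sup>+i. emeasure lborel (?B i) \<partial>count_space C)"
    using C(1) disj by (intro emeasure_UN_countable) auto
  also have "\<dots> = (\<integral>\<^sup>+i. emeasure lborel (T ` ?B i) \<partial>count_space C)"
  proof (intro nn_integral_cong)
    fix i assume "i \<in> space (count_space C)"
    then have "0 \<le> snd i" using C(2) by (auto simp: I_def)
    then show "emeasure lborel (?B i) = emeasure lborel (T ` ?B i)"
      unfolding TB by (simp add: emeasure_ball)
  qed
  also have "\<dots> = emeasure lborel (\<Union>i\<in>C. T ` ?B i)"
    using C(1) disjT by (intro emeasure_UN_countable[symmetric]) (auto simp: TB)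
  also have "\<dots> \<le> emeasure lborel (T ` U)"
    using BU oTU by (intro emeasure_mono) auto
  finally show ?thesis .
qed

lemma lborel_distr_orthogonal:
  fixes T :: "'a::euclidean_space \<Rightarrow> 'a"
  assumes T: "orthogonal_transformation T"
  shows "distr lborel borel T = lborel"
proof (rule lborel_eqI[symmetric])
  fix l u :: 'a assume lu: "\<And>b. b \<in> Basis \<Longrightarrow> l \<bullet> b \<le> u \<bullet> b"
  have cont: "continuous_on UNIV T"
    using orthogonal_transformation_linear[OF T]
    by (simp add: linear_continuous_on linear_conv_bounded_linear)
  have "T \<in> borel_measurable lborel"
    using cont by (simp add: borel_measurable_continuous_onI)
  then have "emeasure (distr lborel borel T) (box l u) = emeasure lborel (T -` box l u)"
    by (simp add: emeasure_distr)
  also have "\<dots> = emeasure lborel (box l u)"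
  proof (rule antisym)
    have "open (T -` box l u)" using open_vimage[OF open_box cont] .
    moreover have "T ` (T -` box l u) = box l u"
      using orthogonal_transformation_surj[OF T] by (simp add: surj_image_vimage_eq)
    ultimately show "emeasure lborel (T -` box l u) \<le> emeasure lborel (box l u)"
      using emeasure_open_le_orthogonal_image[OF T] by metis
    have "inv T ` box l u = T -` box l u"
      using orthogonal_transformation_bij[OF T] by (simp add: bij_vimage_eq_inv_image)
    then show "emeasure lborel (box l u) \<le> emeasure lborel (T -` box l u)"
      using emeasure_open_le_orthogonal_image[OF orthogonal_transformation_inv[OF T] open_box]
      by metis
  qed
  also have "\<dots> = (\<Prod>b\<in>Basis. (u - l) \<bullet> b)" using lu by simp
  finally show "emeasure (distr lborel borel T) (box l u) = (\<Prod>b\<in>Basis. (u - l) \<bullet> b)" .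
qed simp

lemma subspace_volume_eq:
  fixes f :: "real^'k \<Rightarrow> real^'n"
  assumes f: "isometry_onto f H" and A: "A \<in> sets borel"
  shows "subspace_volume TYPE('k) H A = measure lebesgue (f -` A)"
proof -
  define g :: "real^'k \<Rightarrow> real^'n" where "g = (SOME f. isometry_onto f H)"
  have g: "isometry_onto g H" unfolding g_def by (rule someI[of "\<lambda>f. isometry_onto f H", OF f])
  note lf = f[unfolded isometry_onto_def] and lg = g[unfolded isometry_onto_def]
  define T where "T = inv g \<circ> f"
  have gT: "g (T x) = f x" for x
    using lf lg unfolding T_def by (metis comp_apply f_inv_into_f rangeI)
  have linT: "linear T"
  proof (rule linearI)
    fix x y :: "real^'k" and r :: real
    have "g (T (x + y)) = g (T x + T y)"
      using lf lg by (simp add: gT linear_add)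
    then show "T (x + y) = T x + T y" using isometry_onto_inj[OF g] by (simp add: inj_eq)
    have "g (T (r *\<^sub>R x)) = g (r *\<^sub>R T x)"
      using lf lg by (simp add: gT linear_scale)
    then show "T (r *\<^sub>R x) = r *\<^sub>R T x" using isometry_onto_inj[OF g] by (simp add: inj_eq)
  qed
  have ortT: "orthogonal_transformation T"
    unfolding orthogonal_transformation using linT lf lg gT by metis
  have lin_meas: "h \<in> borel_measurable lborel" if "linear h" for h :: "real^'k \<Rightarrow> 'b::real_normed_vector"
    using that by (simp add: borel_measurable_continuous_onI linear_continuous_on linear_conv_bounded_linear)
  have gA: "g -` A \<in> sets borel" and fA: "f -` A \<in> sets borel"
    using lin_meas[of g] lin_meas[of f] lf lg A by (auto dest!: measurable_sets[OF _ A])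
  have "T -` (g -` A) = f -` A" by (auto simp: gT)
  then have "emeasure lborel (f -` A) = emeasure (distr lborel borel T) (g -` A)"
    using gA lin_meas[OF linT] by (simp add: emeasure_distr)
  then have "emeasure lborel (f -` A) = emeasure lborel (g -` A)"
    by (simp add: lborel_distr_orthogonal[OF ortT])
  then show ?thesis
    unfolding subspace_volume_def g_def[symmetric] using gA fA by (simp add: measure_def)
qed

end

theory Submission
  imports Defs "HOL-Probability.Probability"
begin

text \<open>
  If \<open>v\<close> is a contact point of \<open>K\<close> with the unit ball, the only hyperplane supporting \<open>K\<close> at \<open>v\<close> is
  the tangent hyperplane of the ball, so the symmetric body \<open>K\<close> lies in all the slabs
  \<open>\<bar>x \<bullet> v j\<bar> \<le> 1\<close>. Pull the contact vectors back along an isometry from \<open>\<real>\<^sup>k\<close> onto \<open>H\<close> and scale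
  them by \<open>sqrt (c j)\<close>: the resulting vectors \<open>r j\<close>, \<open>j \<in> J\<close>, form a Parseval frame, \<open>(\<Sum>j\<in>J. (r j \<bullet> x)\<^sup>2) = x \<bullet> x\<close>, and \<open>K \<inter> H\<close> is
  contained in a copy of \<open>{x. \<forall>j\<in>J. \<bar>r j \<bullet> x\<bar> \<le> sqrt (c j)}\<close>. Equivalently, \<open>x \<mapsto> (r j \<bullet> x)\<^sub>j\<close> embeds
  \<open>\<real>\<^sup>k\<close> isometrically onto a subspace \<open>E\<close> of \<open>\<real>\<^sup>J\<close>, and the polytope is the section by \<open>E\<close> of the box
  with half sides \<open>sqrt (c j)\<close>. The hypothesis of the theorem is \<open>r j \<bullet> r j \<ge> 1/2\<close>: the projection of the
  \<open>j\<close>-th coordinate vector onto the orthogonal complement of \<open>E\<close> has squared length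
  \<open>1 - r j \<bullet> r j \<le> 1/2\<close>.

  The first inequality is therefore an instance of Ball's estimate for sections of a box
  (\<open>slab_section_volume\<close>), which rests on three facts.

  \<^item> By Fourier inversion, the volume of the section is an integral, over the orthogonal complement of
  \<open>E\<close>, of the product of the Fourier transforms of the intervals, which are dilated sinc functions
  (\<open>fourier_section_inequality\<close>).

  \<^item> The coordinate vectors projected onto that complement again form a Parseval frame, so the rank-one
  Brascamp-Lieb inequality (\<open>Brascamp_Lieb\<close>) bounds this integral by a product of one-dimensional
  integrals of \<open>\<bar>sinc\<bar>\<^sup>p\<close> with \<open>p = 1 / (1 - r j \<bullet> r j)\<close>; if \<open>r j \<bullet> r j = 1\<close>, the supremum of
  \<open>\<bar>sinc\<bar>\<close> takes the place of the integral.

  \<^item> Here \<open>p \<ge> 2\<close>, and for such \<open>p\<close> the integral of \<open>\<bar>sinc\<bar>\<^sup>p\<close> is at most \<open>pi * sqrt (2 / p)\<close>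
  (\<open>Ball_integral_inequality\<close>), with equality at \<open>p = 2\<close>.

  Two devices keep the analysis elementary. The indicator functions of the intervals are convolved with a
  narrow Gaussian, which makes their Fourier transforms integrable, and the section carries a wide
  Gaussian weight; only upper bounds that are uniform in these parameters are passed to the limit, so the
  integrand on the dual side need not be studied near the complement of \<open>E\<close>. Moreover,
  \<open>r j \<bullet> r j \<ge> 1/2\<close> and \<open>(\<Sum>j\<in>J. r j \<bullet> r j) = k\<close> force \<open>card J \<le> 2 * k\<close>; after padding the frame with
  zero vectors there are exactly \<open>2 * k\<close> coordinates, and \<open>E\<close> and its complement both have dimension
  \<open>k\<close>. Hence everything takes place in the product of two copies of \<open>\<real>\<^sup>k\<close>, although the number of vectors
  is not determined by \<open>k\<close>.

  Put \<open>d j = r j \<bullet> r j\<close>, which lies between \<open>1/2\<close> and \<open>1\<close>. The second inequality holds factor by factor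
  and reduces to \<open>2 powr (1 - d) * d powr d \<le> 1\<close>. The third is the arithmetic-geometric mean inequality
  with weights \<open>d j / k\<close>, since \<open>d j\<close> divided by the square of the norm of the projected vector is \<open>c j\<close>
  and the \<open>c j\<close> sum up to at most \<open>n\<close>.
\<close>

section \<open>Ball's integral inequality\<close>

lemma nn_integral_even_function:
  fixes f :: "real \<Rightarrow> ennreal"
  assumes [measurable]: "f \<in> borel_measurable borel" and even: "\<And>x. f (- x) = f x"
  shows "(\<integral>\<^sup>+x. f x \<partial>lborel) = 2 * (\<integral>\<^sup>+x. f x * indicator {0..} x \<partial>lborel)"
proof -
  let ?g = "\<lambda>x. f x * indicator {0..} x"
  have "(\<integral>\<^sup>+x. f x \<partial>lborel) = (\<integral>\<^sup>+x. ?g x + ?g (- x) \<partial>lborel)"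
    using AE_lborel_singleton[of 0]
    by (intro nn_integral_cong_AE) (auto simp: even split: split_indicator)
  also have "\<dots> = (\<integral>\<^sup>+x. ?g x \<partial>lborel) + (\<integral>\<^sup>+x. ?g (- x) \<partial>lborel)"
    by (intro nn_integral_add) auto
  also have "(\<integral>\<^sup>+x. ?g (- x) \<partial>lborel) = (\<integral>\<^sup>+x. ?g x \<partial>lborel)"
    using nn_integral_real_affine[of ?g "- 1" 0] by simp
  finally show ?thesis by (simp add: mult_2)
qed

text \<open>
  Integration by parts moves the square to \<open>Si (2 * t)\<close>: the function \<open>Si (2 * t) - (sin t)\<^sup>2 / t\<close>
  has derivative \<open>(sinc t)\<^sup>2\<close> and tends to \<open>pi / 2\<close>.
\<close>

lemma nn_integral_sinc_square: "(\<integral>\<^sup>+t. ennreal (sinc t ^ 2) \<partial>lborel) \<le> ennreal pi"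
proof -
  \<comment> \<open>\<open>t * (sinc t)\<^sup>2\<close> is \<open>(sin t)\<^sup>2 / t\<close>, written so that it is differentiable at \<open>0\<close> as well.\<close>
  define F where "F = (\<lambda>t. Si (2 * t) - t * (sinc t)\<^sup>2)"
  have deriv: "DERIV F t :> (sinc t)\<^sup>2" for t
  proof (cases "t = 0")
    case True
    have "(\<lambda>h. (h * (sinc h)\<^sup>2) / h) \<midarrow>0\<rightarrow> 1"
    proof (rule Lim_transform_eventually)
      show "(\<lambda>h. (sinc h)\<^sup>2) \<midarrow>0\<rightarrow> 1"
        using tendsto_power[OF isCont_sinc[of 0, unfolded isCont_def], of 2] by simp
    qed (simp add: eventually_at_filter)
    then have "DERIV (\<lambda>t. t * (sinc t)\<^sup>2) 0 :> 1"
      unfolding DERIV_def by (simp only: add_0_left mult_zero_left diff_0_right)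
    moreover have "DERIV (\<lambda>t. Si (2 * t)) 0 :> 1 * 2"
      by (rule DERIV_chain2[of Si]) (use DERIV_Si[of 0] in \<open>auto intro!: derivative_eq_intros\<close>)
    ultimately show ?thesis unfolding F_def True using DERIV_diff by fastforce
  next
    case False
    have "DERIV (\<lambda>t. Si (2 * t) - (sin t)\<^sup>2 / t) t :> (sinc t)\<^sup>2"
    proof -
      have "DERIV (\<lambda>t. Si (2 * t)) t :> sinc (2 * t) * 2"
        by (rule DERIV_chain2[of Si, OF DERIV_Si]) (auto intro!: derivative_eq_intros)
      then have "DERIV (\<lambda>t. Si (2 * t)) t :> sin (2 * t) / t" using False by simp
      moreover have "DERIV (\<lambda>t. (sin t)\<^sup>2 / t) t :> sin (2 * t) / t - (sin t)\<^sup>2 / t\<^sup>2"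
        using False by (auto intro!: derivative_eq_intros simp: sin_double divide_simps power2_eq_square)
      ultimately have "DERIV (\<lambda>t. Si (2 * t) - (sin t)\<^sup>2 / t) t :> sin (2 * t) / t - (sin (2 * t) / t - (sin t)\<^sup>2 / t\<^sup>2)"
        by (rule DERIV_diff)
      then show ?thesis using False by (simp add: power_divide)
    qed
    then show ?thesis
    proof (rule has_field_derivative_transform_within_open[of _ _ _ "- {0}"])
      fix x :: real assume "x \<in> - {0}"
      then show "Si (2 * x) - (sin x)\<^sup>2 / x = F x" by (simp add: F_def power2_eq_square)
    qed (use False in auto)
  qed
  have "((\<lambda>t. t * (sinc t)\<^sup>2) \<longlongrightarrow> 0) at_top"
  proof (rule tendsto_sandwich[of "\<lambda>_. 0" _ _ "\<lambda>t. 1 / t"])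
    show "\<forall>\<^sub>F t in at_top. t * (sinc t)\<^sup>2 \<le> 1 / t"
      using eventually_gt_at_top[of 0]
    proof eventually_elim
      case (elim t)
      then show ?case using power_le_one_iff[of "\<bar>sin t\<bar>" 2] by (simp add: field_simps power2_eq_square)
    qed
    show "\<forall>\<^sub>F t in at_top. 0 \<le> t * (sinc t)\<^sup>2"
      using eventually_gt_at_top[of 0] by eventually_elim simp
  qed real_asymp+
  moreover have "((\<lambda>t. Si (2 * t)) \<longlongrightarrow> pi / 2) at_top"
    by (rule filterlim_compose[OF Si_at_top]) real_asymp
  ultimately have "(F \<longlongrightarrow> pi / 2) at_top" unfolding F_def using tendsto_diff by fastforce
  then have "(\<integral>\<^sup>+t. ennreal ((sinc t)\<^sup>2) * indicator {0..} t \<partial>lborel) = ennreal (pi / 2 - F 0)"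
    using deriv by (intro nn_integral_FTC_atLeast) auto
  moreover have "F 0 = 0" using Si_neg[of 0] by (simp add: F_def)
  moreover have "2 * ennreal (pi / 2) = ennreal pi"
    by (subst ennreal_mult'[symmetric, of 2, simplified]) auto
  ultimately show ?thesis
    using nn_integral_even_function[of "\<lambda>t. ennreal ((sinc t)\<^sup>2)"] by simp
qed

text \<open>
  Two integrations by parts of \<open>cos (2 * t) / t ^ 3\<close> suggest the primitive \<open>G\<close>. Its last two terms are
  arranged so that the remaining part of the derivative is a multiple of \<open>1 - cos (2 * t)\<close>, hence
  nonnegative, and that they cancel at \<open>pi\<close>.
\<close>

lemma nn_integral_sin_square_div_cube_tail:
  "(\<integral>\<^sup>+t. ennreal ((sin t)\<^sup>2 / t ^ 3) * indicator {pi..} t \<partial>lborel) \<le> ennreal (1 / (4 * pi\<^sup>2))"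
proof -
  define G :: "real \<Rightarrow> real"
    where "G t = - 1 / (4 * t^2) - sin (2 * t) / (4 * t^3) + 3 * cos (2 * t) / (8 * t^4) - 3 / (8 * t^4)" for t
  define g :: "real \<Rightarrow> real" where "g t = (sin t)\<^sup>2 / t ^ 3 + 3 / 2 * (1 - cos (2 * t)) / t ^ 5" for t
  have deriv: "DERIV G t :> g t" if "t \<ge> pi" for t
  proof -
    have t: "t > 0" using that pi_gt_zero by linarith
    have "DERIV G t :> 1 / (2 * t^3) - cos (2 * t) / (2 * t^3) + 3 * sin (2 * t) / (4 * t^4)
        - 3 * sin (2 * t) / (4 * t^4) - 3 * cos (2 * t) / (2 * t^5) + 3 / (2 * t^5)"
      unfolding G_def
      by (rule derivative_eq_intros refl | use t in force)+
        (use t in \<open>simp add: divide_simps\<close>, simp add: algebra_simps eval_nat_numeral)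
    moreover have "1 / (2 * t^3) - cos (2 * t) / (2 * t^3) + 3 * sin (2 * t) / (4 * t^4)
        - 3 * sin (2 * t) / (4 * t^4) - 3 * cos (2 * t) / (2 * t^5) + 3 / (2 * t^5) = g t"
      using t unfolding g_def cos_double_sin by (simp add: field_simps)
    ultimately show ?thesis by simp
  qed
  have nonneg: "0 \<le> g t" if "t \<ge> pi" for t
    using that order_trans[OF pi_ge_zero that] by (auto simp: g_def intro!: add_nonneg_nonneg divide_nonneg_nonneg)
  have lim: "(G \<longlongrightarrow> 0) at_top" unfolding G_def by real_asymp
  have [measurable]: "g \<in> borel_measurable borel" unfolding g_def by measurable
  have "(\<integral>\<^sup>+t. ennreal ((sin t)\<^sup>2 / t ^ 3) * indicator {pi..} t \<partial>lborel)
      \<le> (\<integral>\<^sup>+t. ennreal (g t) * indicator {pi..} t \<partial>lborel)"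
  proof (intro nn_integral_mono)
    fix t :: real
    have "(sin t)\<^sup>2 / t ^ 3 \<le> g t" if "t \<ge> pi"
      using order_trans[OF pi_ge_zero that] by (auto simp: g_def)
    then show "ennreal ((sin t)\<^sup>2 / t ^ 3) * indicator {pi..} t \<le> ennreal (g t) * indicator {pi..} t"
      by (auto split: split_indicator intro!: ennreal_leI)
  qed
  also have "\<dots> = ennreal (0 - G pi)"
    by (intro nn_integral_FTC_atLeast deriv nonneg lim) auto
  also have "0 - G pi = 1 / (4 * pi\<^sup>2)" by (simp add: G_def)
  finally show ?thesis by simp
qed

text \<open>
  Repeated differentiation brings the claim down to \<open>t * cos t \<le> sin t\<close>; each step below shows that a
  function vanishing at \<open>0\<close> has nonpositive derivative, given the previous step.
\<close>

lemma sin_le_gaussian: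
  assumes "0 \<le> t" "t \<le> pi"
  shows "sin t * exp (t\<^sup>2 / 6) \<le> t"
proof -
  have h0: "s * cos s - sin s \<le> 0" if "0 \<le> s" "s \<le> pi" for s
  proof -
    have "s * cos s - sin s \<le> 0 * cos 0 - sin 0"
    proof (rule DERIV_nonpos_imp_nonincreasing[of 0 s "\<lambda>s. s * cos s - sin s"])
      fix x assume x: "0 \<le> x" "x \<le> s"
      have "DERIV (\<lambda>s. s * cos s - sin s) x :> - (x * sin x)"
        by (auto intro!: derivative_eq_intros)
      moreover have "0 \<le> x * sin x" using x that by (intro mult_nonneg_nonneg sin_ge_zero) auto
      ultimately show "\<exists>y. DERIV (\<lambda>s. s * cos s - sin s) x :> y \<and> y \<le> 0" by force
    qed (use that in auto)
    then show ?thesis by simp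
  qed
  have h1: "s * cos s - sin s + s\<^sup>2 * sin s / 3 \<le> 0" if "0 \<le> s" "s \<le> pi" for s
  proof -
    have "s * cos s - sin s + s\<^sup>2 * sin s / 3 \<le> 0 * cos 0 - sin 0 + 0\<^sup>2 * sin 0 / 3"
    proof (rule DERIV_nonpos_imp_nonincreasing[of 0 s "\<lambda>s. s * cos s - sin s + s\<^sup>2 * sin s / 3"])
      fix x assume x: "0 \<le> x" "x \<le> s"
      have "DERIV (\<lambda>s. s * cos s - sin s + s\<^sup>2 * sin s / 3) x :> x / 3 * (x * cos x - sin x)"
        by (auto intro!: derivative_eq_intros simp: field_simps power2_eq_square)
      moreover have "x / 3 * (x * cos x - sin x) \<le> 0"
        using x that h0[of x] by (intro mult_nonneg_nonpos) auto
      ultimately show "\<exists>y. DERIV (\<lambda>s. s * cos s - sin s + s\<^sup>2 * sin s / 3) x :> y \<and> y \<le> 0" by blast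
    qed (use that in auto)
    then show ?thesis by simp
  qed
  have h2: "(cos s + s * sin s / 3) * exp (s\<^sup>2 / 6) - 1 \<le> 0" if "0 \<le> s" "s \<le> pi" for s
  proof -
    have "(cos s + s * sin s / 3) * exp (s\<^sup>2 / 6) - 1 \<le> (cos 0 + 0 * sin 0 / 3) * exp (0\<^sup>2 / 6) - 1"
    proof (rule DERIV_nonpos_imp_nonincreasing[of 0 s "\<lambda>s. (cos s + s * sin s / 3) * exp (s\<^sup>2 / 6) - 1"])
      fix x assume x: "0 \<le> x" "x \<le> s"
      define d where "d = (6 * (x * cos x - sin x + x\<^sup>2 * sin x / 3) - x\<^sup>2 * sin x) / 9 * exp (x\<^sup>2 / 6)"
      have "DERIV (\<lambda>s. (cos s + s * sin s / 3) * exp (s\<^sup>2 / 6) - 1) x :> d"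
        unfolding d_def by (auto intro!: derivative_eq_intros simp: field_simps power2_eq_square)
      moreover have "0 \<le> x\<^sup>2 * sin x" using x that by (intro mult_nonneg_nonneg sin_ge_zero) auto
      then have "6 * (x * cos x - sin x + x\<^sup>2 * sin x / 3) - x\<^sup>2 * sin x \<le> 0"
      proof -
        have "6 * (a + b / 3) - b \<le> 0" if "a + b / 3 \<le> 0" "0 \<le> b" for a b :: real
          using that by simp
        from this[OF h1 \<open>0 \<le> x\<^sup>2 * sin x\<close>] show ?thesis using x that by simp
      qed
      then have "d \<le> 0" unfolding d_def by (intro mult_nonpos_nonneg divide_nonpos_pos) auto
      ultimately show "\<exists>y. DERIV (\<lambda>s. (cos s + s * sin s / 3) * exp (s\<^sup>2 / 6) - 1) x :> y \<and> y \<le> 0" by blast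
    qed (use that in auto)
    then show ?thesis by simp
  qed
  have "sin t * exp (t\<^sup>2 / 6) - t \<le> sin 0 * exp (0\<^sup>2 / 6) - 0"
  proof (rule DERIV_nonpos_imp_nonincreasing[of 0 t "\<lambda>s. sin s * exp (s\<^sup>2 / 6) - s"])
    fix x assume x: "0 \<le> x" "x \<le> t"
    have "DERIV (\<lambda>s. sin s * exp (s\<^sup>2 / 6) - s) x :> (cos x + x * sin x / 3) * exp (x\<^sup>2 / 6) - 1"
      by (auto intro!: derivative_eq_intros simp: field_simps power2_eq_square)
    then show "\<exists>y. DERIV (\<lambda>s. sin s * exp (s\<^sup>2 / 6) - s) x :> y \<and> y \<le> 0"
      using h2[of x] x assms by force
  qed (use assms in auto)
  then show ?thesis by simp
qed

lemma sinc_nonneg_lobe: "0 \<le> t \<Longrightarrow> t \<le> pi \<Longrightarrow> 0 \<le> sinc t"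
  by (simp add: sin_ge_zero)

text \<open>
  Nine terms, so that the remainder of the Taylor expansion of \<open>sin\<close> is \<open>t ^ 9 / 9!\<close> times a value of \<open>cos\<close>.
\<close>

lemma sinc_taylor_le:
  assumes "0 \<le> t"
  shows "sinc t \<le> 1 - t^2/6 + t^4/120 - t^6/5040 + t^8/362880"
proof (cases "t = 0")
  case False
  with assms have t: "t > 0" by simp
  obtain x where x: "sin t = (\<Sum>m<9. sin_coeff m * t ^ m) + (sin (x + 1/2 * real 9 * pi) / fact 9) * t ^ 9"
    using Maclaurin_sin_expansion3[of 9 t] t by auto
  have "(\<Sum>m<9. sin_coeff m * t ^ m) = t - t^3/6 + t^5/120 - t^7/5040"
  proof -
    have "{..<9} = {0, 1, 2, 3, 4, 5, 6, 7, 8::nat}" by auto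
    then show ?thesis by (simp add: sin_coeff_def fact_numeral)
  qed
  moreover have "(sin (x + 1/2 * real 9 * pi) / fact 9) * t ^ 9 \<le> t^9 / 362880"
  proof -
    have "sin (x + 1/2 * real 9 * pi) * t ^ 9 \<le> 1 * t ^ 9" using t by (intro mult_right_mono) auto
    then show ?thesis by (simp add: fact_numeral field_simps)
  qed
  ultimately have "sin t \<le> t * (1 - t^2/6 + t^4/120 - t^6/5040 + t^8/362880)"
    using x by (simp add: algebra_simps eval_nat_numeral)
  then show ?thesis using t by (simp add: field_simps)
qed simp

lemma sinc_taylor_cube:
  fixes u :: real
  shows "(1 - u/6 + u^2/120 - u^3/5040 + u^4/362880)^3 =
   1 - u/2 + 13/120 * u^2 - 41/3024 * u^3 + 671/604800 * u^4 - 29/453600 * u^5 + 2071/762048000 * u^6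
   - 19/217728000 * u^7 + 467/219469824000 * u^8 - 359/9217732608000 * u^9 + 19/36870930432000 * u^10
   - 1/221225582592000 * u^11 + 1/47784725839872000 * u^12"
proof -
  \<comment> \<open>Clearing the denominator \<open>9!\<close> keeps the expansion over the integers.\<close>
  have int: "(362880 - 60480 * u + 3024 * u^2 - 72 * u^3 + u^4)^3 =
    47784725839872000 - 23892362919936000 * u + 5176678632652800 * u^2 - 647874920448000 * u^3 + 53015130685440 * u^4 - 3055019950080 * u^5 + 129863430144 * u^6 - 4169926656 * u^7 + 101678976 * u^8 - 1861056 * u^9 + 24624 * u^10 - 216 * u^11 + u^12" by (simp add: eval_nat_numeral algebra_simps)
  have eq: "1 - u/6 + u^2/120 - u^3/5040 + u^4/362880
      = (362880 - 60480 * u + 3024 * u^2 - 72 * u^3 + u^4) / 362880" by simp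
  then show ?thesis unfolding eq power_divide int by (simp add: add_divide_distrib diff_divide_distrib)
qed

text \<open>
  On the main lobe, \<open>sinc\<close> is nonnegative and below its Taylor polynomial of degree \<open>8\<close>. The cube of that
  polynomial is integrated exactly; the integral of \<open>(sinc t) ^ 3\<close> itself is about
  \<open>1.1896\<close>, so almost nothing is lost.
\<close>

lemma nn_integral_sinc_cube_lobe:
  "(\<integral>\<^sup>+t. ennreal (sinc t ^ 3) * indicator {0..pi} t \<partial>lborel) \<le> ennreal (1191 / 1000)"
proof -
  define p :: "real \<Rightarrow> real" where "p t = 1 - t^2/6 + t^4/120 - t^6/5040 + t^8/362880" for t
  define Q :: "real \<Rightarrow> real" where "Q t = t - t^3/6 + 13/600 * t^5 - 41/21168 * t^7 + 671/5443200 * t^9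
     - 29/4989600 * t^11 + 2071/9906624000 * t^13 - 19/3265920000 * t^15 + 467/3730987008000 * t^17
     - 359/175136919552000 * t^19 + 19/774289539072000 * t^21 - 1/5088188399616000 * t^23 + 1/1194618145996800000 * t^25" for t
  have p3: "p t ^ 3 = 1 - t^2/2 + 13/120 * t^4 - 41/3024 * t^6 + 671/604800 * t^8 - 29/453600 * t^10
   + 2071/762048000 * t^12 - 19/217728000 * t^14 + 467/219469824000 * t^16 - 359/9217732608000 * t^18
   + 19/36870930432000 * t^20 - 1/221225582592000 * t^22 + 1/47784725839872000 * t^24" for t
    using sinc_taylor_cube[of "t^2"] unfolding p_def by (simp flip: power_mult)
  have deriv: "DERIV Q t :> p t ^ 3" for t
    unfolding p3 Q_def by (auto intro!: derivative_eq_intros)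
  have sp: "sinc t \<le> p t" if "0 \<le> t" for t unfolding p_def using sinc_taylor_le[OF that] .
  have "(\<integral>\<^sup>+t. ennreal (sinc t ^ 3) * indicator {0..pi} t \<partial>lborel)
      \<le> (\<integral>\<^sup>+t. ennreal (p t ^ 3) * indicator {0..pi} t \<partial>lborel)"
  proof (intro nn_integral_mono)
    fix t :: real
    have "sinc t ^ 3 \<le> p t ^ 3" if "0 \<le> t" "t \<le> pi"
      using sp[OF that(1)] sinc_nonneg_lobe[OF that] by (intro power_mono)
    then show "ennreal (sinc t ^ 3) * indicator {0..pi} t \<le> ennreal (p t ^ 3) * indicator {0..pi} t"
      by (cases "t \<in> {0..pi}") (auto intro!: ennreal_leI)
  qed
  also have "\<dots> = ennreal (Q pi - Q 0)"
  proof (intro nn_integral_FTC_Icc)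
    show "(\<lambda>t. p t ^ 3) \<in> borel_measurable borel" unfolding p_def by measurable
    show "0 \<le> p t ^ 3" if "t \<in> {0..pi}" for t
      using sp[of t] sinc_nonneg_lobe[of t] that by (intro zero_le_power) auto
  qed (use deriv in \<open>auto intro: has_field_derivative_at_within\<close>)
  also have "Q pi - Q 0 \<le> 1191 / 1000"
  proof -
    \<comment> \<open>The terms of \<open>Q pi\<close> alternate in sign, so seven digits of \<open>pi\<close> are used from either side.\<close>
    have lo: "(31415926/10000000) ^ n \<le> pi ^ n" and hi: "pi ^ n \<le> (31415927/10000000) ^ n" for n
      using pi_approx by (auto intro!: power_mono)
    show ?thesis unfolding Q_def
      using hi[of 1] lo[of 3] hi[of 5] lo[of 7] hi[of 9] lo[of 11] hi[of 13] lo[of 15] hi[of 17] lo[of 19]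
        hi[of 21] lo[of 23] hi[of 25]
      by (simp add: power_divide)
  qed
  finally show ?thesis by (simp add: ennreal_leI)
qed


text \<open>
  The value \<open>exp (- 1/4)\<close> is dictated by the interpolation below: the logarithm of \<open>sqrt (2 / p)\<close> is
  convex in \<open>p\<close> with slope \<open>- 1/4\<close> at \<open>p = 2\<close>, so the chord from \<open>p = 2\<close> to \<open>p = 3\<close> must not be less steep.
  There is little room: the left-hand side is about \<open>0.769 * pi\<close>, and \<open>exp (- 1/4)\<close> is about \<open>0.779\<close>.
\<close>

lemma nn_integral_sinc_cube:
  "(\<integral>\<^sup>+t. ennreal (\<bar>sinc t\<bar> ^ 3) \<partial>lborel) \<le> ennreal (pi * exp (- 1 / 4))"
proof -
  let ?lobe = "\<lambda>t. ennreal (sinc t ^ 3) * indicator {0..pi} t"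
  let ?tail = "\<lambda>t. ennreal ((sin t)\<^sup>2 / t ^ 3) * indicator {pi..} t"
  have pt: "ennreal (\<bar>sinc t\<bar> ^ 3) * indicator {0..} t \<le> ?lobe t + ?tail t" for t
  proof (cases "t \<le> pi")
    case True
    show ?thesis
    proof (cases "0 \<le> t")
      case t: True
      then show ?thesis using True abs_of_nonneg[OF sinc_nonneg_lobe[OF t True]] by simp
    qed simp
  next
    case False
    then have t: "pi < t" "0 < t" using pi_gt_zero by linarith+
    have "\<bar>sinc t\<bar> ^ 3 = \<bar>sin t\<bar> * ((sin t)\<^sup>2 / t ^ 3)"
      using t by (simp add: power_divide power3_eq_cube power2_eq_square abs_mult)
    also have "\<dots> \<le> 1 * ((sin t)\<^sup>2 / t ^ 3)" using t by (intro mult_right_mono) auto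
    finally show ?thesis using t by (simp add: ennreal_leI)
  qed
  have "(\<integral>\<^sup>+t. ennreal (\<bar>sinc t\<bar> ^ 3) \<partial>lborel) = 2 * (\<integral>\<^sup>+t. ennreal (\<bar>sinc t\<bar> ^ 3) * indicator {0..} t \<partial>lborel)"
    by (rule nn_integral_even_function) auto
  also have "\<dots> \<le> 2 * (\<integral>\<^sup>+t. ?lobe t + ?tail t \<partial>lborel)"
    by (intro mult_left_mono nn_integral_mono pt) auto
  also have "(\<integral>\<^sup>+t. ?lobe t + ?tail t \<partial>lborel) = (\<integral>\<^sup>+t. ?lobe t \<partial>lborel) + (\<integral>\<^sup>+t. ?tail t \<partial>lborel)"
    by (intro nn_integral_add) auto
  also have "2 * \<dots> \<le> 2 * (ennreal (1191 / 1000) + ennreal (1 / (4 * pi\<^sup>2)))"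
    by (intro mult_left_mono add_mono nn_integral_sinc_cube_lobe nn_integral_sin_square_div_cube_tail) auto
  also have "\<dots> = ennreal (2 * (1191 / 1000 + 1 / (4 * pi\<^sup>2)))"
  proof -
    have "2 * (ennreal a + ennreal b) = ennreal (2 * (a + b))" if "0 \<le> a" "0 \<le> b" for a b
      using that unfolding mult_2 by (simp add: ennreal_plus[symmetric] del: ennreal_plus)
    then show ?thesis by simp
  qed
  also have "2 * (1191 / 1000 + 1 / (4 * pi\<^sup>2)) \<le> pi * exp (- 1 / 4)"
  proof -
    have "314/100 \<le> pi" using pi_approx by simp
    then have "(314/100)\<^sup>2 \<le> pi\<^sup>2" by (intro power_mono) auto
    then have 1: "1 / (4 * pi\<^sup>2) \<le> 1 / (4 * (314/100)\<^sup>2)"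
      by (intro divide_left_mono mult_left_mono mult_pos_pos) auto
    have "(7784/10000 :: real) ^ 4 * exp 1 \<le> (7784/10000) ^ 4 * (272/100)"
      using e_less_272 by (intro mult_left_mono) auto
    also have "\<dots> \<le> 1" by (simp add: power_divide)
    finally have "(7784/10000 :: real) ^ 4 \<le> exp (- 1)"
      by (simp add: exp_minus field_simps)
    also have "exp (- 1 :: real) = exp (- 1 / 4) ^ 4" using exp_of_nat_mult[of 4 "- 1 / 4 :: real"] by simp
    finally have "7784/10000 \<le> exp (- 1 / 4 :: real)" using power_le_imp_le_base[of "7784/10000" 3 "exp (- 1 / 4 :: real)"] by simp
    then have "31415/10000 * (7784/10000) \<le> pi * exp (- 1 / 4)"
      using pi_approx by (intro mult_mono) auto
    moreover have "2 * (1191 / 1000 + 1 / (4 * (314/100)\<^sup>2)) \<le> (31415/10000 * (7784/10000) :: real)"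
      by (simp add: power2_eq_square)
    moreover have "2 * (1191 / 1000 + 1 / (4 * pi\<^sup>2)) \<le> 2 * (1191 / 1000 + 1 / (4 * (314/100)\<^sup>2))"
      by (intro mult_left_mono add_left_mono 1) auto
    ultimately show ?thesis by linarith
  qed
  finally show ?thesis by (simp add: ennreal_leI)
qed

text \<open>
  The logarithm of the integral of \<open>\<bar>sinc\<bar>\<^sup>p\<close> is convex in \<open>p\<close>, so the values at \<open>2\<close> and \<open>3\<close> control
  everything in between. Young's inequality with the scale \<open>\<kappa>\<close>, the ratio of the bounds at \<open>3\<close> and at
  \<open>2\<close>, yields the interpolated bound \<open>pi * exp (- (p - 2) / 4)\<close>, and \<open>exp x \<ge> 1 + x\<close> finishes.
\<close>

lemma nn_integral_sinc_powr_le_small: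
  assumes p: "2 \<le> p" "p \<le> 3"
  shows "(\<integral>\<^sup>+t. ennreal (\<bar>sinc t\<bar> powr p) \<partial>lborel) \<le> ennreal (pi * sqrt (2 / p))"
proof -
  define \<theta> where "\<theta> = p - 2"
  define \<kappa> :: real where "\<kappa> = exp (- 1 / 4)"
  have \<theta>: "0 \<le> \<theta>" "\<theta> \<le> 1" and \<kappa>: "\<kappa> > 0" using p by (auto simp: \<theta>_def \<kappa>_def)
  have pt: "\<bar>x\<bar> powr p \<le> \<kappa> powr \<theta> * ((1 - \<theta>) * x\<^sup>2 + \<theta> / \<kappa> * \<bar>x\<bar> ^ 3)" for x
  proof (cases "x = 0")
    case False
    have "1 powr (1 - \<theta>) * (\<bar>x\<bar> / \<kappa>) powr \<theta> \<le> (1 - \<theta>) * 1 + \<theta> * (\<bar>x\<bar> / \<kappa>)"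
      using \<theta> \<kappa> False by (intro Youngs_inequality_0) auto
    then have "\<bar>x\<bar> powr \<theta> \<le> \<kappa> powr \<theta> * ((1 - \<theta>) + \<theta> * (\<bar>x\<bar> / \<kappa>))"
      using \<kappa> False by (simp add: powr_divide field_simps)
    then have "x\<^sup>2 * \<bar>x\<bar> powr \<theta> \<le> x\<^sup>2 * (\<kappa> powr \<theta> * ((1 - \<theta>) + \<theta> * (\<bar>x\<bar> / \<kappa>)))"
      by (intro mult_left_mono) auto
    moreover have "\<bar>x\<bar> powr p = x\<^sup>2 * \<bar>x\<bar> powr \<theta>"
      using False by (simp add: \<theta>_def powr_diff)
    moreover have "x\<^sup>2 * (\<kappa> powr \<theta> * ((1 - \<theta>) + \<theta> * (\<bar>x\<bar> / \<kappa>))) = \<kappa> powr \<theta> * ((1 - \<theta>) * x\<^sup>2 + \<theta> / \<kappa> * \<bar>x\<bar> ^ 3)"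
      by (simp add: algebra_simps power3_eq_cube power2_eq_square abs_mult_self_eq flip: abs_mult)
    ultimately show ?thesis by metis
  qed (use p in simp)
  have ennreal_expand: "ennreal (k * (x * a + y * b)) = ennreal k * (ennreal x * ennreal a + ennreal y * ennreal b)"
    if "0 \<le> k" "0 \<le> x" "0 \<le> y" "0 \<le> a" "0 \<le> b" for k x y a b
    using that by (simp add: ennreal_mult ennreal_plus)
  have "(\<integral>\<^sup>+t. ennreal (\<bar>sinc t\<bar> powr p) \<partial>lborel)
      \<le> (\<integral>\<^sup>+t. ennreal (\<kappa> powr \<theta>) * (ennreal (1 - \<theta>) * ennreal ((sinc t)\<^sup>2) + ennreal (\<theta> / \<kappa>) * ennreal (\<bar>sinc t\<bar> ^ 3)) \<partial>lborel)"
  proof (intro nn_integral_mono)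
    fix t
    have "ennreal (\<bar>sinc t\<bar> powr p) \<le> ennreal (\<kappa> powr \<theta> * ((1 - \<theta>) * (sinc t)\<^sup>2 + \<theta> / \<kappa> * \<bar>sinc t\<bar> ^ 3))"
      by (intro ennreal_leI pt)
    also have "\<dots> = ennreal (\<kappa> powr \<theta>) * (ennreal (1 - \<theta>) * ennreal ((sinc t)\<^sup>2) + ennreal (\<theta> / \<kappa>) * ennreal (\<bar>sinc t\<bar> ^ 3))"
      using \<theta> \<kappa> by (intro ennreal_expand) auto
    finally show "ennreal (\<bar>sinc t\<bar> powr p) \<le> \<dots>" .
  qed
  also have "\<dots> = ennreal (\<kappa> powr \<theta>) * (ennreal (1 - \<theta>) * (\<integral>\<^sup>+t. ennreal ((sinc t)\<^sup>2) \<partial>lborel)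
       + ennreal (\<theta> / \<kappa>) * (\<integral>\<^sup>+t. ennreal (\<bar>sinc t\<bar> ^ 3) \<partial>lborel))"
    by (subst nn_integral_cmult, measurable, subst nn_integral_add, measurable) (simp add: nn_integral_cmult)
  also have "\<dots> \<le> ennreal (\<kappa> powr \<theta>) * (ennreal (1 - \<theta>) * ennreal pi + ennreal (\<theta> / \<kappa>) * ennreal (pi * \<kappa>))"
    using nn_integral_sinc_square nn_integral_sinc_cube unfolding \<kappa>_def
    by (intro mult_left_mono add_mono) auto
  also have "\<dots> = ennreal (\<kappa> powr \<theta> * ((1 - \<theta>) * pi + \<theta> / \<kappa> * (pi * \<kappa>)))"
    using \<theta> \<kappa> by (intro ennreal_expand[symmetric]) auto
  also have "\<kappa> powr \<theta> * ((1 - \<theta>) * pi + \<theta> / \<kappa> * (pi * \<kappa>)) = pi * exp (- \<theta> / 4)"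
    using \<kappa> by (simp add: field_simps \<kappa>_def powr_def)
  also have "\<dots> \<le> pi * sqrt (2 / p)"
  proof (intro mult_left_mono real_le_rsqrt)
    have "1 + \<theta> / 2 \<le> exp (\<theta> / 2)" by (rule exp_ge_add_one_self)
    then have "p / 2 \<le> exp (\<theta> / 2)" by (simp add: \<theta>_def field_simps)
    then have "1 / exp (\<theta> / 2) \<le> 1 / (p / 2)" using p by (intro divide_left_mono) auto
    moreover have "(exp (- \<theta> / 4))\<^sup>2 = 1 / exp (\<theta> / 2)"
      by (simp add: power2_eq_square exp_minus field_simps flip: exp_add)
    ultimately show "(exp (- \<theta> / 4))\<^sup>2 \<le> 2 / p" by simp
  qed auto
  finally show ?thesis by (simp add: ennreal_leI)
qed

text \<open>
  Away from \<open>p = 2\<close> a comparison with a Gaussian on the main lobe is accurate enough: it costs a factor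
  \<open>sqrt (3 / pi)\<close>, about \<open>0.977\<close>, relative to the claim, and the tail fits into the rest.
\<close>

lemma nn_integral_sinc_powr_le_large:
  assumes p: "3 \<le> p"
  shows "(\<integral>\<^sup>+t. ennreal (\<bar>sinc t\<bar> powr p) \<partial>lborel) \<le> ennreal (pi * sqrt (2 / p))"
proof -
  define s where "s = sqrt (3 / p)"
  define c where "c = sqrt (6 * pi / p)"
  have s: "s > 0" "s\<^sup>2 = 3 / p" using p by (auto simp: s_def)
  \<comment> \<open>The majorant of \<open>\<bar>sinc t\<bar>\<^sup>p\<close> on the main lobe is a multiple of a normal density.\<close>
  have gauss: "exp (- p * t\<^sup>2 / 6) = c * normal_density 0 s t" for t
    using s p by (simp add: normal_density_def c_def)
  let ?tail = "\<lambda>t. ennreal (pi powr (3 - p)) * (ennreal ((sin t)\<^sup>2 / t ^ 3) * indicator {pi..} t)"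
  have lobe: "\<bar>sinc t\<bar> powr p \<le> exp (- p * t\<^sup>2 / 6)" if "0 \<le> t" "t \<le> pi" for t
  proof -
    have "sinc t \<le> exp (- (t\<^sup>2) / 6)"
      using sin_le_gaussian[OF that] that by (simp add: exp_minus field_simps)
    then have "\<bar>sinc t\<bar> \<le> exp (- (t\<^sup>2) / 6)" using sinc_nonneg_lobe[OF that] by linarith
    then have "\<bar>sinc t\<bar> powr p \<le> exp (- (t\<^sup>2) / 6) powr p" using p by (intro powr_mono2) auto
    then show ?thesis by (simp add: powr_def mult_ac)
  qed
  have tail: "\<bar>sinc t\<bar> powr p \<le> pi powr (3 - p) * ((sin t)\<^sup>2 / t ^ 3)" if "pi \<le> t" for t
  proof -
    have t: "t > 0" using that pi_gt_zero by linarith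
    have "\<bar>sinc t\<bar> powr p = \<bar>sin t\<bar> powr p * t powr (3 - p) / t ^ 3"
      using t by (simp add: powr_divide powr_diff)
    also have "\<dots> \<le> \<bar>sin t\<bar> powr 2 * pi powr (3 - p) / t ^ 3"
      using t that p by (intro divide_right_mono mult_mono powr_mono' powr_mono2') auto
    finally show ?thesis by (simp add: mult_ac)
  qed
  have "(\<integral>\<^sup>+t. ennreal (\<bar>sinc t\<bar> powr p) \<partial>lborel) = 2 * (\<integral>\<^sup>+t. ennreal (\<bar>sinc t\<bar> powr p) * indicator {0..} t \<partial>lborel)"
    by (rule nn_integral_even_function) auto
  also have "\<dots> \<le> 2 * (\<integral>\<^sup>+t. ennreal c * (ennreal (normal_density 0 s t) * indicator {0..} t) + ?tail t \<partial>lborel)"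
  proof (intro mult_left_mono nn_integral_mono)
    fix t
    have "ennreal (\<bar>sinc t\<bar> powr p) \<le> ennreal c * ennreal (normal_density 0 s t) + ?tail t" if "0 \<le> t"
    proof (cases "t \<le> pi")
      case True
      have "ennreal (\<bar>sinc t\<bar> powr p) \<le> ennreal (c * normal_density 0 s t)"
        using lobe[OF that True] unfolding gauss by (intro ennreal_leI)
      then show ?thesis using p by (simp add: ennreal_mult c_def add_increasing2)
    next
      case False
      then have "ennreal (\<bar>sinc t\<bar> powr p) \<le> ennreal (pi powr (3 - p) * ((sin t)\<^sup>2 / t ^ 3))"
        using tail[of t] by (intro ennreal_leI) auto
      also have "\<dots> = ?tail t"
        using False that by (subst ennreal_mult) auto
      finally show ?thesis by (rule add_increasing[rotated]) simp
    qed
    then show "ennreal (\<bar>sinc t\<bar> powr p) * indicator {0..} t \<le> ennreal c * (ennreal (normal_density 0 s t) * indicator {0..} t) + ?tail t"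
      by (auto split: split_indicator)
  qed auto
  also have "\<dots> = ennreal c * (2 * (\<integral>\<^sup>+t. ennreal (normal_density 0 s t) * indicator {0..} t \<partial>lborel))
      + 2 * (ennreal (pi powr (3 - p)) * (\<integral>\<^sup>+t. ennreal ((sin t)\<^sup>2 / t ^ 3) * indicator {pi..} t \<partial>lborel))"
  proof -
    have "(\<integral>\<^sup>+t. ennreal c * (ennreal (normal_density 0 s t) * indicator {0..} t) + ?tail t \<partial>lborel)
      = ennreal c * (\<integral>\<^sup>+t. ennreal (normal_density 0 s t) * indicator {0..} t \<partial>lborel)
      + ennreal (pi powr (3 - p)) * (\<integral>\<^sup>+t. ennreal ((sin t)\<^sup>2 / t ^ 3) * indicator {pi..} t \<partial>lborel)"
      by (subst nn_integral_add, measurable) (simp add: nn_integral_cmult)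
    then show ?thesis by (simp only: distrib_left mult.left_commute[of 2 "ennreal c"])
  qed
  also have "2 * (\<integral>\<^sup>+t. ennreal (normal_density 0 s t) * indicator {0..} t \<partial>lborel) = 1"
  proof -
    have "(\<integral>\<^sup>+t. ennreal (normal_density 0 s t) \<partial>lborel) = 1"
      using s(1) by (subst nn_integral_eq_integral) auto
    moreover have "normal_density 0 s (- t) = normal_density 0 s t" for t by (simp add: normal_density_def)
    ultimately show ?thesis
      using nn_integral_even_function[of "\<lambda>t. ennreal (normal_density 0 s t)"] by simp
  qed
  also have "(\<integral>\<^sup>+t. ennreal ((sin t)\<^sup>2 / t ^ 3) * indicator {pi..} t \<partial>lborel) \<le> ennreal (1 / (4 * pi\<^sup>2))"
    by (rule nn_integral_sin_square_div_cube_tail)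
  also have "ennreal c * 1 + 2 * (ennreal (pi powr (3 - p)) * ennreal (1 / (4 * pi\<^sup>2)))
     = ennreal (c + 2 * (pi powr (3 - p) * (1 / (4 * pi\<^sup>2))))"
  proof -
    have expand: "ennreal a * 1 + 2 * (ennreal b * ennreal d) = ennreal (a + 2 * (b * d))"
      if "0 \<le> a" "0 \<le> b" "0 \<le> d" for a b d
    proof -
      have "ennreal (2 * (b * d)) = ennreal 2 * (ennreal b * ennreal d)"
        using that by (simp only: ennreal_mult mult_nonneg_nonneg zero_le_numeral)
      then show ?thesis using that by (subst ennreal_plus) auto
    qed
    show ?thesis by (rule expand) (use p in \<open>auto simp: c_def\<close>)
  qed
  also have "c + 2 * (pi powr (3 - p) * (1 / (4 * pi\<^sup>2))) \<le> pi * sqrt (2 / p)"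
  proof -
    have "exp 1 \<le> pi" using e_less_272 pi_approx by simp
    then have "exp 1 powr (p - 3) \<le> pi powr (p - 3)" using p by (intro powr_mono2) auto
    then have "exp (p - 3) \<le> pi powr (p - 3)" by (simp add: powr_def)
    moreover have "1 + (p - 3) \<le> exp (p - 3)" by (rule exp_ge_add_one_self)
    moreover have "sqrt (p / 3) \<le> p / 3" using p by (intro real_le_lsqrt) (auto simp: power2_eq_square)
    ultimately have "sqrt (p / 3) \<le> pi powr (p - 3)" using p by linarith
    then have 1: "sqrt p * pi powr (3 - p) \<le> sqrt 3"
      using p by (simp add: real_sqrt_divide powr_diff field_simps)
    have "sqrt 3 \<le> 1733/1000" by (rule real_le_lsqrt) (auto simp: power2_eq_square)
    moreover have "sqrt (6 * pi) \<le> 43418/10000"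
      using pi_approx by (intro real_le_lsqrt) (auto simp: power2_eq_square)
    moreover have "14142/10000 \<le> sqrt 2" by (rule real_le_rsqrt) (simp add: power2_eq_square)
    then have "31415/10000 * (14142/10000) \<le> pi * sqrt 2" using pi_approx by (intro mult_mono) auto
    moreover have "(3141/1000)\<^sup>2 \<le> pi\<^sup>2" using pi_approx by (intro power_mono) auto
    then have "(sqrt p * pi powr (3 - p)) / (2 * pi\<^sup>2) \<le> (1733/1000) / (2 * (3141/1000)\<^sup>2)"
      using 1 \<open>sqrt 3 \<le> _\<close> by (intro frac_le) auto
    moreover have "(1733/1000) / (2 * (3141/1000)\<^sup>2) \<le> (9/100 :: real)" by (simp add: power2_eq_square)
    ultimately have "sqrt (6 * pi) + (sqrt p * pi powr (3 - p)) / (2 * pi\<^sup>2) \<le> pi * sqrt 2" by linarith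
    then have "(sqrt (6 * pi) + (sqrt p * pi powr (3 - p)) / (2 * pi\<^sup>2)) / sqrt p \<le> pi * sqrt 2 / sqrt p"
      using p by (intro divide_right_mono) auto
    then show ?thesis using p by (simp add: c_def real_sqrt_divide add_divide_distrib)
  qed
  finally show ?thesis by (simp add: ennreal_leI add_mono mult_left_mono)
qed

theorem Ball_integral_inequality:
  assumes "2 \<le> p"
  shows "(\<integral>\<^sup>+t. ennreal (\<bar>sinc t\<bar> powr p) \<partial>lborel) \<le> ennreal (pi * sqrt (2 / p))"
  using nn_integral_sinc_powr_le_small[of p] nn_integral_sinc_powr_le_large[of p] assms by linarith

section \<open>Determinants of weighted Parseval frames\<close>

text \<open>
  Rayleigh's principle: a maximiser \<open>b\<close> of \<open>x \<bullet> f x\<close> on the unit sphere of an invariant subspace is an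
  eigenvector, because a nonzero component \<open>w\<close> of \<open>f b\<close> orthogonal to \<open>b\<close> would allow an increase to first
  order in the direction of \<open>w\<close>.
\<close>

lemma symmetric_eigenvector:
  fixes f :: "'a::euclidean_space \<Rightarrow> 'a"
  assumes f: "linear f" and sym: "\<And>x y. f x \<bullet> y = x \<bullet> f y"
    and S: "subspace S" "f ` S \<subseteq> S" and x0: "x0 \<in> S" "x0 \<noteq> 0"
  obtains b l where "b \<in> S" "norm b = 1" "f b = l *\<^sub>R b"
proof -
  define C where "C = sphere 0 1 \<inter> S"
  have "compact C" unfolding C_def using closed_subspace[OF S(1)] by (simp add: compact_Int_closed)
  moreover have "(1 / norm x0) *\<^sub>R x0 \<in> C" using x0 S by (simp add: C_def subspace_scale)
  moreover have "continuous_on C (\<lambda>x. x \<bullet> f x)"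
    by (intro continuous_intros linear_continuous_on f linear_conv_bounded_linear[THEN iffD1])
  ultimately obtain b where b: "b \<in> C" "\<And>y. y \<in> C \<Longrightarrow> y \<bullet> f y \<le> b \<bullet> f b"
    using continuous_attains_sup[of C "\<lambda>x. x \<bullet> f x"] by blast
  define l where "l = b \<bullet> f b"
  have bS: "b \<in> S" "norm b = 1" using b(1) by (auto simp: C_def)
  have ub: "y \<bullet> f y \<le> l * (y \<bullet> y)" if "y \<in> S" for y
  proof (cases "y = 0")
    case True then show ?thesis using f by (simp add: linear_0)
  next
    case False
    have "(1 / norm y) *\<^sub>R y \<in> C" using False that S by (simp add: C_def subspace_scale)
    from b(2)[OF this] have "(y \<bullet> f y) / (norm y)\<^sup>2 \<le> l"
      using f by (simp add: l_def linear_scale power2_eq_square)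
    then show ?thesis using False by (simp add: field_simps power2_norm_eq_inner)
  qed
  define w where "w = f b - l *\<^sub>R b"
  have wS: "w \<in> S" unfolding w_def using S bS by (intro subspace_diff subspace_scale) auto
  \<comment> \<open>Maximality of \<open>b\<close>, tested at \<open>b + t *\<^sub>R w\<close>: for small \<open>t > 0\<close> the linear term cannot be dominated.\<close>
  have key: "2 * t * (w \<bullet> w) \<le> t\<^sup>2 * (l * (w \<bullet> w) - w \<bullet> f w)" for t
  proof -
    have 1: "(b + t *\<^sub>R w) \<bullet> f (b + t *\<^sub>R w) \<le> l * ((b + t *\<^sub>R w) \<bullet> (b + t *\<^sub>R w))"
      using S bS wS by (intro ub subspace_add subspace_scale) auto
    have 2: "b \<bullet> f w = w \<bullet> f b" using sym[of b w] by (simp add: inner_commute)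
    have 3: "w \<bullet> f b = w \<bullet> w + l * (b \<bullet> w)" by (simp add: w_def algebra_simps inner_commute)
    have 4: "b \<bullet> b = 1" using bS by (simp add: norm_eq_1)
    show ?thesis using 1 f
      by (simp add: linear_add linear_scale inner_add_left inner_add_right 2 3 4 l_def[symmetric]
          algebra_simps power2_eq_square inner_commute)
  qed
  have "w \<bullet> w = 0"
  proof (rule ccontr)
    assume "w \<bullet> w \<noteq> 0"
    then have p: "w \<bullet> w > 0" using inner_ge_zero[of w] by linarith
    define D where "D = \<bar>l * (w \<bullet> w) - w \<bullet> f w\<bar> + 1"
    have D: "D > 0" "l * (w \<bullet> w) - w \<bullet> f w < D" by (auto simp: D_def)
    define t where "t = (w \<bullet> w) / D"
    have t: "t > 0" "t * D = w \<bullet> w" using p D by (auto simp: t_def)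
    have "2 * t * (w \<bullet> w) \<le> t\<^sup>2 * D"
      by (rule order_trans[OF key]) (intro mult_left_mono, use D in auto)
    also have "\<dots> = t * (w \<bullet> w)" using t by (simp add: power2_eq_square)
    finally show False using t p by simp
  qed
  then have "f b = l *\<^sub>R b" by (simp add: w_def)
  then show ?thesis using that bS by blast
qed

lemma spectral_theorem_subspace:
  fixes f :: "'a::euclidean_space \<Rightarrow> 'a"
  assumes f: "linear f" and sym: "\<And>x y. f x \<bullet> y = x \<bullet> f y"
    and S: "subspace S" "f ` S \<subseteq> S"
  shows "\<exists>B. finite B \<and> pairwise orthogonal B \<and> span B = S \<and> (\<forall>b\<in>B. norm b = 1 \<and> (\<exists>l. f b = l *\<^sub>R b))"
  using S
proof (induction "dim S" arbitrary: S rule: less_induct)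
  case less
  show ?case
  proof (cases "S \<subseteq> {0}")
    case True
    then show ?thesis using less.prems by (intro exI[of _ "{}"]) (auto simp: subspace_0)
  next
    case False
    then obtain x0 where "x0 \<in> S" "x0 \<noteq> 0" by auto
    then obtain b l where b: "b \<in> S" "norm b = 1" "f b = l *\<^sub>R b"
      using symmetric_eigenvector[OF f sym less.prems] by metis
    define S' where "S' = {x \<in> S. b \<bullet> x = 0}"
    have sub: "subspace S'"
      unfolding S'_def using less.prems(1)
      by (auto simp: subspace_def inner_add_right)
    have bb: "b \<bullet> b = 1" using b by (simp add: norm_eq_1)
    have inv: "f ` S' \<subseteq> S'"
      using less.prems(2) b(3) by (auto simp: S'_def sym[symmetric])
    have "b \<notin> S'" using bb by (simp add: S'_def)
    moreover have "S' \<subseteq> S" by (auto simp: S'_def)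
    ultimately have "S' \<subset> S" using b by blast
    then have "dim S' < dim S" using sub less.prems(1) by (metis dim_psubset span_eq_iff)
    then obtain B where B: "finite B" "pairwise orthogonal B" "span B = S'"
        "\<forall>b\<in>B. norm b = 1 \<and> (\<exists>l. f b = l *\<^sub>R b)"
      using less.hyps sub inv by metis
    have "pairwise orthogonal (insert b B)"
      using B span_base[of _ B]
      by (auto simp: pairwise_insert orthogonal_def S'_def inner_commute)
    moreover have "span (insert b B) = S"
    proof
      have "B \<subseteq> S" using B span_superset[of B] by (auto simp: S'_def)
      then show "span (insert b B) \<subseteq> S" using b less.prems(1) by (simp add: span_minimal)
      show "S \<subseteq> span (insert b B)"
      proof
        fix x assume "x \<in> S"
        then have "x - (b \<bullet> x) *\<^sub>R b \<in> span B"
          using b less.prems(1) bb unfolding B by (auto simp: S'_def inner_diff_right intro!: subspace_diff subspace_scale)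
        then show "x \<in> span (insert b B)" using span_breakdown_eq by blast
      qed
    qed
    ultimately show ?thesis using B b by (intro exI[of _ "insert b B"]) auto
  qed
qed

lemma spectral_theorem:
  fixes f :: "real^'n \<Rightarrow> real^'n"
  assumes f: "linear f" and sym: "\<And>x y. f x \<bullet> y = x \<bullet> f y"
  obtains q :: "'n \<Rightarrow> real^'n" and l where "\<And>i j. q i \<bullet> q j = (if i = j then 1 else 0)" "\<And>i. f (q i) = l i *\<^sub>R q i"
proof -
  obtain B where B: "finite B" "pairwise orthogonal B" "span B = UNIV"
      "\<forall>b\<in>B. norm b = 1 \<and> (\<exists>l. f b = l *\<^sub>R b)"
    using spectral_theorem_subspace[OF f sym, of UNIV] by auto
  have "0 \<notin> B" using B(4) by force
  then have "independent B" using B(2) by (simp add: pairwise_orthogonal_independent)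
  then have "card B = dim (span B)" by (simp add: dim_eq_card_independent)
  then have "card B = CARD('n)" using B(3) by simp
  then obtain q where q: "bij_betw q (UNIV::'n set) B"
    using finite_same_card_bij[OF finite_class.finite_UNIV B(1)] by metis
  have qB: "q i \<in> B" for i using q by (auto simp: bij_betw_def)
  have inj: "q i = q j \<longleftrightarrow> i = j" for i j using q by (auto simp: bij_betw_def inj_eq)
  have "q i \<bullet> q j = (if i = j then 1 else 0)" for i j
    using B qB inj by (auto simp: norm_eq_1 pairwise_def orthogonal_def)
  moreover have "\<forall>i. \<exists>l. f (q i) = l *\<^sub>R q i" using B qB by blast
  then obtain l where "\<And>i. f (q i) = l i *\<^sub>R q i" by metis
  ultimately show ?thesis using that[of q l] by blast
qed

lemma det_eq_prod_eigenvalues: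
  fixes f :: "real^'n \<Rightarrow> real^'n" and q :: "'n \<Rightarrow> real^'n"
  assumes f: "linear f" and q: "\<And>i j. q i \<bullet> q j = (if i = j then 1 else 0)" "\<And>i. f (q i) = l i *\<^sub>R q i"
  shows "det (matrix f) = (\<Prod>i\<in>UNIV. l i)"
proof -
  define Q :: "real^'n^'n" where "Q = (\<chi> i. q i)"
  have "Q ** transpose Q = mat 1"
    using q(1) by (simp add: Q_def vec_eq_iff matrix_matrix_mult_def transpose_def mat_def inner_vec_def)
  then have dQ: "det Q * det Q = 1" using det_mul[of Q "transpose Q"] by simp
  have D: "Q ** matrix f ** transpose Q = (\<chi> i j. if i = j then l i else 0)"
  proof -
    have "(matrix f ** transpose Q) $ r $ j = (f (q j)) $ r" for r j
      using fun_cong[OF matrix_vector_mul(2)[OF f], of "q j"]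
      by (simp add: matrix_matrix_mult_def matrix_vector_mult_def transpose_def Q_def vec_eq_iff)
    then have "(Q ** (matrix f ** transpose Q)) $ i $ j = q i \<bullet> f (q j)" for i j
      by (subst matrix_matrix_mult_def) (simp add: Q_def inner_vec_def)
    then show ?thesis by (simp add: vec_eq_iff q matrix_mul_assoc)
  qed
  have "det Q * det (matrix f) * det Q = det (Q ** matrix f ** transpose Q)"
    by (simp add: det_mul)
  also have "\<dots> = (\<Prod>i\<in>UNIV. l i)" unfolding D by (subst det_diagonal) auto
  finally have "det Q * det (matrix f) * det Q = (\<Prod>i\<in>UNIV. l i)" .
  moreover have "det Q * det (matrix f) * det Q = (det Q * det Q) * det (matrix f)" by simp
  ultimately show ?thesis using dQ by simp
qed

lemma weighted_arith_geom_mean: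
  fixes w x :: "'b \<Rightarrow> real"
  assumes "finite B" "\<And>b. b \<in> B \<Longrightarrow> 0 \<le> w b" "sum w B = 1" "\<And>b. b \<in> B \<Longrightarrow> 0 < x b"
  shows "(\<Prod>b\<in>B. x b powr w b) \<le> (\<Sum>b\<in>B. w b * x b)"
proof -
  have "(\<Prod>b\<in>B. x b powr w b) = exp (\<Sum>b\<in>B. w b *\<^sub>R ln (x b))"
    unfolding exp_sum[OF assms(1)] using assms(4) by (intro prod.cong) (force simp: powr_def)+
  also have "\<dots> \<le> (\<Sum>b\<in>B. w b * exp (ln (x b)))"
    using assms by (intro convex_on_sum[OF _ _ exp_convex]) auto
  finally show ?thesis using assms(4) by simp
qed

text \<open>
  In an orthonormal eigenbasis \<open>q i\<close> of the operator, the \<open>i\<close>-th eigenvalue is the mean of the \<open>\<sigma> b\<close> with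
  weights \<open>(s b \<bullet> q i)\<^sup>2\<close>, which sum up to \<open>1\<close> over \<open>b\<close>. The arithmetic-geometric mean inequality bounds it
  from below; in the product over \<open>i\<close>, the exponents of \<open>\<sigma> b\<close> add up to \<open>s b \<bullet> s b\<close>.
\<close>

lemma det_weighted_rank_one_sum_ge:
  fixes s :: "'b \<Rightarrow> real^'n"
  assumes B: "finite B" and id: "\<And>y. (\<Sum>b\<in>B. (s b \<bullet> y)\<^sup>2) = y \<bullet> y" and \<sigma>: "\<And>b. b \<in> B \<Longrightarrow> \<sigma> b > 0"
  shows "(\<Prod>b\<in>B. \<sigma> b powr (s b \<bullet> s b)) \<le> det (matrix (\<lambda>y. \<Sum>b\<in>B. (\<sigma> b * (s b \<bullet> y)) *\<^sub>R s b))"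
proof -
  define f where "f = (\<lambda>y. \<Sum>b\<in>B. (\<sigma> b * (s b \<bullet> y)) *\<^sub>R s b)"
  have lin: "linear f" unfolding f_def
    by (intro linearI) (simp_all add: inner_add_right algebra_simps sum.distrib scaleR_sum_right)
  have sym: "f x \<bullet> y = x \<bullet> f y" for x y
    by (simp add: f_def inner_sum_left inner_sum_right inner_commute mult_ac)
  obtain q :: "'n \<Rightarrow> real^'n" and l where q: "\<And>i j. q i \<bullet> q j = (if i = j then 1 else 0)" "\<And>i. f (q i) = l i *\<^sub>R q i"
    using spectral_theorem[OF lin sym] by blast
  have l: "l i = (\<Sum>b\<in>B. (s b \<bullet> q i)\<^sup>2 * \<sigma> b)" for i
  proof -
    have "l i = f (q i) \<bullet> q i" by (simp add: q)
    then show ?thesis by (simp add: f_def inner_sum_left power2_eq_square mult_ac)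
  qed
  define Q :: "real^'n^'n" where "Q = (\<chi> i. q i)"
  have QT: "Q ** transpose Q = mat 1"
    using q(1) by (simp add: Q_def vec_eq_iff matrix_matrix_mult_def transpose_def mat_def inner_vec_def)
  have parseval: "(\<Sum>i\<in>UNIV. (x \<bullet> q i)\<^sup>2) = x \<bullet> x" for x
  proof -
    have "orthogonal_matrix Q" using QT by (simp add: orthogonal_matrix_def matrix_left_right_inverse)
    then have "orthogonal_transformation ((*v) Q)" by (simp add: orthogonal_transformation_matrix)
    then have "(Q *v x) \<bullet> (Q *v x) = x \<bullet> x" by (simp add: orthogonal_transformation_def)
    moreover have "(Q *v x) $ i = x \<bullet> q i" for i
      by (simp add: Q_def matrix_vector_mult_def inner_vec_def mult.commute)
    ultimately show ?thesis by (simp add: inner_vec_def[of "Q *v x"] power2_eq_square)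
  qed
  have "(\<Prod>b\<in>B. \<sigma> b powr (s b \<bullet> s b)) = (\<Prod>b\<in>B. \<Prod>i\<in>UNIV. \<sigma> b powr ((s b \<bullet> q i)\<^sup>2))"
  proof (intro prod.cong refl)
    fix b assume "b \<in> B"
    then show "\<sigma> b powr (s b \<bullet> s b) = (\<Prod>i\<in>UNIV. \<sigma> b powr ((s b \<bullet> q i)\<^sup>2))"
      using \<sigma>[of b] by (simp add: parseval[symmetric] powr_sum)
  qed
  also have "\<dots> = (\<Prod>i\<in>UNIV. \<Prod>b\<in>B. \<sigma> b powr ((s b \<bullet> q i)\<^sup>2))" by (rule prod.swap)
  also have "\<dots> \<le> (\<Prod>i\<in>UNIV. l i)"
  proof (rule prod_mono, rule conjI)
    fix i
    show "0 \<le> (\<Prod>b\<in>B. \<sigma> b powr ((s b \<bullet> q i)\<^sup>2))" by (simp add: prod_nonneg)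
    show "(\<Prod>b\<in>B. \<sigma> b powr ((s b \<bullet> q i)\<^sup>2)) \<le> l i"
      unfolding l using id[of "q i"] \<sigma> q(1)[of i i] by (intro weighted_arith_geom_mean B) auto
  qed
  also have "\<dots> = det (matrix f)" using det_eq_prod_eigenvalues[OF lin q] by simp
  finally show ?thesis by (simp add: f_def)
qed

section \<open>The rank-one Brascamp-Lieb inequality\<close>

lemma distribution_function_positive_density:
  fixes f :: "real \<Rightarrow> real"
  assumes cont: "continuous_on UNIV f" and pos: "\<And>t. 0 < f t"
    and int: "integrable lborel f" and I: "(\<integral>t. f t \<partial>lborel) = 1"
  defines "F \<equiv> cdf (density lborel f)"
  shows "\<And>t. DERIV F t :> f t" "(F \<longlongrightarrow> 1) at_top" "(F \<longlongrightarrow> 0) at_bot" "strict_mono F" "\<And>t. 0 < F t \<and> F t < 1"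
proof -
  have [measurable]: "f \<in> borel_measurable borel" using cont by (rule borel_measurable_continuous_onI)
  have "(\<integral>\<^sup>+t. f t \<partial>lborel) = 1"
    using pos int I by (subst nn_integral_eq_integral) (auto intro: less_imp_le)
  then interpret prob_space "density lborel f"
    by (intro prob_spaceI) (simp add: emeasure_density)
  interpret real_distribution "density lborel f" by standard auto
  show lims: "(F \<longlongrightarrow> 1) at_top" "(F \<longlongrightarrow> 0) at_bot"
    unfolding F_def by (rule cdf_lim_at_top_prob cdf_lim_at_bot)+
  have F: "F t = (\<integral>x. f x * indicator {..t} x \<partial>lborel)" for t
  proof -
    have "(\<integral>\<^sup>+x. ennreal (f x) * indicator {..t} x \<partial>lborel) = (\<integral>\<^sup>+x. ennreal (f x * indicator {..t} x) \<partial>lborel)"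
      by (intro nn_integral_cong) (auto split: split_indicator)
    then show ?thesis
      unfolding F_def cdf_def measure_def using pos
      by (subst integral_eq_nn_integral) (auto simp: emeasure_density less_imp_le)
  qed
  show deriv: "DERIV F t :> f t" for t
  proof -
    have si: "set_integrable lborel A f" if "A \<in> sets borel" for A
      using int that unfolding set_integrable_def by (intro integrable_mult_indicator) auto
    have "F x = F (t - 1) + integral {t - 1..x} f" if "x \<in> {t - 1<..<t + 1}" for x
    proof -
      have disj: "{..t - 1} \<inter> {t - 1<..x} = {}" by auto
      have "{..x} = {..t - 1} \<union> {t - 1<..x}" using that by auto
      then have "F x = F (t - 1) + (LINT y:{t - 1<..x}|lborel. f y)"
        unfolding F using set_integral_Un[OF disj si si]
        by (simp add: set_lebesgue_integral_def mult.commute)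
      also have "(LINT y:{t - 1<..x}|lborel. f y) = (LINT y:{t - 1..x}|lborel. f y)"
        unfolding set_lebesgue_integral_def
      proof (rule integral_cong_AE)
        show "AE y in lborel. indicator {t - 1<..x} y *\<^sub>R f y = indicator {t - 1..x} y *\<^sub>R f y"
          using AE_lborel_singleton[of "t - 1"] by eventually_elim (simp add: indicator_def less_le)
      qed (simp_all)
      also have "\<dots> = integral {t - 1..x} f" by (intro set_borel_integral_eq_integral si) auto
      finally show ?thesis .
    qed
    note eq = this
    have "((\<lambda>x. integral {t - 1..x} f) has_real_derivative f t) (at t within {t - 1..t + 1})"
      by (intro integral_has_real_derivative continuous_on_subset[OF cont]) auto
    moreover have "at t within {t - 1..t + 1} = at t" by (intro at_within_interior) (auto simp: interior_atLeastAtMost_real)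
    ultimately have "((\<lambda>x. F (t - 1) + integral {t - 1..x} f) has_real_derivative f t) (at t)"
      by (auto intro!: derivative_eq_intros)
    then show ?thesis
      by (rule has_field_derivative_transform_within_open[of _ _ _ "{t - 1<..<t + 1}"]) (auto simp: eq)
  qed
  show mono: "strict_mono F"
    by (rule strict_monoI) (metis DERIV_pos_imp_increasing deriv pos)
  show "0 < F t \<and> F t < 1" for t
  proof
    have "F (t + 1) \<le> 1" "F (t - 1) \<ge> 0" using mono unfolding F_def by (auto simp: cdf_def)
    moreover have "F t < F (t + 1)" "F (t - 1) < F t" using mono by (auto simp: strict_mono_less)
    ultimately show "0 < F t" "F t < 1" by linarith+
  qed
qed

lemma gaussian_kernel_density: "exp (- (pi * t\<^sup>2)) = normal_density 0 (1 / sqrt (2 * pi)) t"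
  by (simp add: normal_density_def field_simps)

lemma integrable_gaussian_kernel: "integrable lborel (\<lambda>t. exp (- (pi * t\<^sup>2)))"
  and integral_gaussian_kernel: "(\<integral>t. exp (- (pi * t\<^sup>2)) \<partial>lborel) = 1"
  unfolding gaussian_kernel_density by auto

text \<open>
  \<open>T\<close> is the increasing map that pushes the measure with density \<open>f\<close>, normalised to mass \<open>1\<close>, to the
  Gaussian measure with density \<open>exp (- pi * t\<^sup>2)\<close>: the distribution function of the first followed by the
  inverse of that of the second. The last equation is the change of density, solved for \<open>f\<close>.
\<close>

lemma gaussian_transport:
  fixes f :: "real \<Rightarrow> real"
  assumes cont: "continuous_on UNIV f" and pos: "\<And>t. 0 < f t" and int: "integrable lborel f"
  obtains T T' where "\<And>t. DERIV T t :> T' t" "\<And>t. 0 < T' t" "continuous_on UNIV T'"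
    "\<And>t. f t = (\<integral>t. f t \<partial>lborel) * exp (- (pi * (T t)\<^sup>2)) * T' t"
proof -
  define I where "I = (\<integral>t. f t \<partial>lborel)"
  have "I \<noteq> 0"
  proof
    assume "I = 0"
    then have "AE t in lborel. f t = 0"
      using integral_nonneg_eq_0_iff_AE[OF int] pos unfolding I_def by (auto intro: less_imp_le)
    then have "AE t in (lborel :: real measure). False" by eventually_elim (metis pos less_irrefl)
    then show False by (simp add: eventually_False ae_filter_eq_bot_iff)
  qed
  moreover have "I \<ge> 0" unfolding I_def using pos by (intro integral_nonneg_AE) (auto intro!: AE_I2 less_imp_le)
  ultimately have Ipos: "I > 0" by simp
  define g where "g t = exp (- (pi * t\<^sup>2))" for t :: real
  define F where "F = cdf (density lborel (\<lambda>t. f t / I))"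
  define G where "G = cdf (density lborel g)"
  have F: "\<And>t. DERIV F t :> f t / I" "\<And>t. 0 < F t \<and> F t < 1"
    unfolding F_def using Ipos pos int cont
    by (intro distribution_function_positive_density; auto simp: I_def intro!: continuous_intros)+
  have gc: "continuous_on UNIV g" unfolding g_def by (intro continuous_intros)
  have G: "\<And>t. DERIV G t :> g t" "(G \<longlongrightarrow> 1) at_top" "(G \<longlongrightarrow> 0) at_bot" "strict_mono G"
  proof -
    have gp: "0 < g t" for t by (simp add: g_def)
    have gi: "integrable lborel g" and g1: "(\<integral>t. g t \<partial>lborel) = 1"
      unfolding g_def by (rule integrable_gaussian_kernel integral_gaussian_kernel)+
    note D = distribution_function_positive_density[OF gc gp gi g1]
    show "\<And>t. DERIV G t :> g t" "(G \<longlongrightarrow> 1) at_top" "(G \<longlongrightarrow> 0) at_bot" "strict_mono G"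
      unfolding G_def by (rule D)+
  qed
  have contG: "continuous_on UNIV G" using G(1) DERIV_continuous_on by (metis has_field_derivative_at_within)
  have "\<exists>x. G x = y" if y: "0 < y" "y < 1" for y
  proof -
    obtain a where a: "G a < y"
      using order_tendstoD(2)[OF G(3) y(1)] eventually_happens'[OF trivial_limit_at_bot_linorder] by auto
    obtain b where b: "y < G b"
      using order_tendstoD(1)[OF G(2) y(2)] eventually_happens'[OF trivial_limit_at_top_linorder] by auto
    have "a \<le> b" using a b G(4) by (meson le_less_trans less_imp_le less_trans not_le strict_mono_less)
    then show ?thesis using IVT'[of G a y b] a b continuous_on_subset[OF contG] by auto
  qed
  then have "\<exists>x. G x = F t" for t using F(2) by blast
  then obtain T where T: "\<And>t. G (T t) = F t" by metis
  define H where "H = inv G"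
  have HG: "H (G x) = x" for x unfolding H_def using G(4) strict_mono_imp_inj_on by (simp add: strict_mono_eq inj_def)
  have derH: "DERIV H (G x) :> inverse (g x)" for x
  proof -
    have gx: "g x \<noteq> 0" by (simp add: g_def)
    have "(H has_derivative (\<lambda>h. h / g x)) (at (G x))"
    proof (rule has_derivative_inverse_strong[of UNIV x G H "\<lambda>h. g x * h"])
      show "(G has_derivative (*) (g x)) (at x)" using G(1) by (simp add: has_field_derivative_def)
    qed (use contG HG gx in auto)
    moreover have "(\<lambda>h. h / g x) = (*) (inverse (g x))" by (simp add: fun_eq_iff divide_inverse mult.commute)
    ultimately show ?thesis by (simp add: has_field_derivative_def)
  qed
  have TH: "T = (\<lambda>t. H (F t))" using T HG by (metis)
  define T' where "T' t = inverse (g (T t)) * (f t / I)" for t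
  have derT: "DERIV T t :> T' t" for t
    unfolding TH T'_def
  proof (rule DERIV_chain2[of H _ F t])
    show "DERIV H (F t) :> inverse (g (H (F t)))" using derH[of "T t"] T TH by metis
  qed (rule F)
  have contT: "continuous_on UNIV T" using derT DERIV_continuous_on by (metis has_field_derivative_at_within)
  show ?thesis
  proof (rule that[of T T'])
    show "continuous_on UNIV T'"
      unfolding T'_def g_def by (intro continuous_intros contT cont) (use Ipos in auto)
    show "f t = (\<integral>t. f t \<partial>lborel) * exp (- (pi * (T t)\<^sup>2)) * T' t" for t
      using Ipos unfolding I_def[symmetric] T'_def g_def by simp
  qed (use derT pos Ipos in \<open>auto simp: T'_def g_def\<close>)
qed

lemma integral_gaussian_euclidean:
  "(\<integral>\<^sup>+z. ennreal (exp (- (pi * (z \<bullet> z)))) \<partial>(lborel :: 'a::euclidean_space measure)) = 1"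
proof -
  have "(\<integral>\<^sup>+z. ennreal (exp (- (pi * (z \<bullet> z)))) \<partial>(lborel :: 'a measure))
    = (\<integral>\<^sup>+z. (\<Prod>b\<in>Basis. ennreal (exp (- (pi * (z \<bullet> b)\<^sup>2)))) \<partial>(lborel :: 'a measure))"
  proof (intro nn_integral_cong)
    fix z :: 'a
    have "z \<bullet> z = (\<Sum>b\<in>Basis. (z \<bullet> b)\<^sup>2)" by (subst euclidean_inner) (simp add: power2_eq_square)
    then show "ennreal (exp (- (pi * (z \<bullet> z)))) = (\<Prod>b\<in>Basis. ennreal (exp (- (pi * (z \<bullet> b)\<^sup>2))))"
      by (simp add: prod_ennreal sum_distrib_left exp_sum sum_negf[symmetric])
  qed
  also have "\<dots> = (\<Prod>b\<in>(Basis :: 'a set). (\<integral>\<^sup>+t. ennreal (exp (- (pi * t\<^sup>2))) \<partial>lborel))"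
    by (intro nn_integral_lborel_prod) auto
  also have "(\<integral>\<^sup>+t. ennreal (exp (- (pi * t\<^sup>2))) \<partial>lborel) = 1"
    using integrable_gaussian_kernel integral_gaussian_kernel by (subst nn_integral_eq_integral) auto
  finally show ?thesis by simp
qed

text \<open>
  Change of variables along a map that need not be onto. A minorant \<open>p\<close> of the transformed integrand is
  enough, and it spares a proof that the Jacobian determinant is Borel measurable.
\<close>

lemma nn_integral_jacobian_le:
  fixes \<Phi> :: "real^'k::{finite,wellorder} \<Rightarrow> real^'k::_" and f :: "real^'k::_ \<Rightarrow> real"
  assumes der: "\<And>y. (\<Phi> has_derivative D y) (at y)" and inj: "inj \<Phi>"
    and f: "\<And>z. 0 \<le> f z" "integrable lborel f"
    and p: "p \<in> borel_measurable borel" "\<And>y. p y \<le> \<bar>det (matrix (D y))\<bar> * f (\<Phi> y)"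
  shows "(\<integral>\<^sup>+y. ennreal (p y) \<partial>lborel) \<le> (\<integral>\<^sup>+z. ennreal (f z) \<partial>lborel)"
proof -
  \<comment> \<open>The change of variables formula is about vector-valued functions.\<close>
  define f1 :: "real^'k::_ \<Rightarrow> real^1" where "f1 z = vec (f z)" for z
  define h where "h y = \<bar>det (matrix (D y))\<bar> * f (\<Phi> y)" for y
  have [measurable]: "f \<in> borel_measurable borel" using f(2) by auto
  have af: "f absolutely_integrable_on UNIV"
    using f(2) by (simp add: set_integrable_def integrable_completion)
  have "continuous_on UNIV \<Phi>"
    using der by (meson continuous_at_imp_continuous_on has_derivative_continuous)
  then have "open (range \<Phi>)" using inj by (intro invariance_of_domain) auto
  then have ar: "f absolutely_integrable_on range \<Phi>"
    by (intro set_integrable_subset[OF af]) auto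
  then have "f1 absolutely_integrable_on range \<Phi>"
    by (subst absolutely_integrable_componentwise_iff) (auto simp: f1_def Basis_vec_def inner_axis)
  then have cv: "(\<lambda>y. \<bar>det (matrix (D y))\<bar> *\<^sub>R f1 (\<Phi> y)) absolutely_integrable_on UNIV \<and>
     integral UNIV (\<lambda>y. \<bar>det (matrix (D y))\<bar> *\<^sub>R f1 (\<Phi> y)) = integral (range \<Phi>) f1"
    using has_absolute_integral_change_of_variables[of UNIV \<Phi> D f1 "integral (range \<Phi>) f1"] der inj
    by (auto intro: has_derivative_at_withinI)
  have h1: "(\<lambda>y. \<bar>det (matrix (D y))\<bar> *\<^sub>R f1 (\<Phi> y)) = (\<lambda>y. vec (h y))"
    by (simp add: f1_def h_def vec_eq_iff fun_eq_iff)
  have ah: "h absolutely_integrable_on UNIV"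
    using cv unfolding h1 by (subst (asm) absolutely_integrable_componentwise_iff) (auto simp: Basis_vec_def inner_axis)
  have "integral UNIV h = integral UNIV (\<lambda>y. (vec (h y) :: real^1)) $ 1"
    using cv unfolding h1 by (subst integral_component_eq_cart[symmetric]) (auto dest: set_lebesgue_integral_eq_integral(1))
  also have "\<dots> = integral (range \<Phi>) f1 $ 1" using cv unfolding h1 by simp
  also have "\<dots> = integral (range \<Phi>) f"
    using \<open>f1 absolutely_integrable_on range \<Phi>\<close>
    by (subst integral_component_eq_cart[symmetric]) (auto simp: f1_def dest: set_lebesgue_integral_eq_integral(1))
  also have "\<dots> \<le> integral UNIV f"
    using ar af f by (intro integral_subset_le) (auto dest: set_lebesgue_integral_eq_integral(1))
  finally have le: "integral UNIV h \<le> integral UNIV f" .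
  have nn: "(\<integral>\<^sup>+y. ennreal (u y) \<partial>lebesgue) = ennreal (integral UNIV u)"
    if "u absolutely_integrable_on UNIV" "\<And>y. 0 \<le> u y" for u :: "real^'k::_ \<Rightarrow> real"
    using that set_lebesgue_integral_eq_integral(2)[OF that(1)]
    by (subst nn_integral_eq_integral) (auto simp: set_integrable_def set_lebesgue_integral_def)
  have "(\<integral>\<^sup>+y. ennreal (p y) \<partial>lborel) = (\<integral>\<^sup>+y. ennreal (p y) \<partial>lebesgue)"
    using p(1) by (subst nn_integral_completion) auto
  also have "\<dots> \<le> (\<integral>\<^sup>+y. ennreal (h y) \<partial>lebesgue)"
    by (intro nn_integral_mono ennreal_leI) (simp add: h_def p)
  also have "\<dots> = ennreal (integral UNIV h)" by (rule nn[OF ah]) (simp add: h_def f)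
  also have "\<dots> \<le> ennreal (integral UNIV f)" using le by (rule ennreal_leI)
  also have "\<dots> = (\<integral>\<^sup>+y. ennreal (f y) \<partial>lebesgue)" using af f by (intro nn[symmetric]) auto
  also have "\<dots> = (\<integral>\<^sup>+y. ennreal (f y) \<partial>lborel)" by (subst nn_integral_completion) auto
  finally show ?thesis .
qed

text \<open>
  The synthesis map \<open>a \<mapsto> (\<Sum>b\<in>B. a b *\<^sub>R s b)\<close> is the adjoint of the isometry \<open>y \<mapsto> (s b \<bullet> y)\<^sub>b\<close>, hence a
  contraction; expanding the squared distance from \<open>a\<close> to the image of \<open>z\<close> shows this directly.
\<close>

lemma frame_combination_norm_le:
  fixes s :: "'b \<Rightarrow> 'a::real_inner"
  assumes id: "\<And>y. (\<Sum>b\<in>B. (s b \<bullet> y)\<^sup>2) = y \<bullet> y"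
  shows "(\<Sum>b\<in>B. a b *\<^sub>R s b) \<bullet> (\<Sum>b\<in>B. a b *\<^sub>R s b) \<le> (\<Sum>b\<in>B. (a b)\<^sup>2)"
proof -
  define z where "z = (\<Sum>b\<in>B. a b *\<^sub>R s b)"
  have "0 \<le> (\<Sum>b\<in>B. (a b - s b \<bullet> z)\<^sup>2)" by (intro sum_nonneg) auto
  also have "\<dots> = (\<Sum>b\<in>B. (a b)\<^sup>2) - 2 * (\<Sum>b\<in>B. a b * (s b \<bullet> z)) + (\<Sum>b\<in>B. (s b \<bullet> z)\<^sup>2)"
    by (simp add: power2_diff sum.distrib sum_subtractf sum_distrib_left mult_ac)
  also have "(\<Sum>b\<in>B. a b * (s b \<bullet> z)) = z \<bullet> z"
    by (subst (2) z_def) (simp add: inner_sum_left)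
  finally show ?thesis unfolding id z_def[symmetric] by simp
qed

text \<open>
  Barthe's transport argument. Let \<open>T b\<close> transport \<open>f b\<close> to the Gaussian and
  \<open>\<Phi> y = (\<Sum>b\<in>B. (norm (s b) * T b (s b \<bullet> y)) *\<^sub>R s b)\<close>. The integrand is the constant on the
  right-hand side times a product of Gaussians in the \<open>T b\<close> and of powers of the derivatives of the \<open>T b\<close>.
  The former is at most the Gaussian at \<open>\<Phi> y\<close> because synthesis is a contraction, the latter is at most
  the Jacobian of \<open>\<Phi>\<close> by the determinant inequality. As \<open>\<Phi>\<close> is injective, the integral is at most the
  total mass of the Gaussian, which is \<open>1\<close>.
\<close>

lemma Brascamp_Lieb_positive:
  fixes s :: "'b \<Rightarrow> real^'k::{finite,wellorder}" and f :: "'b \<Rightarrow> real \<Rightarrow> real"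
  assumes B: "finite B" and id: "\<And>y. (\<Sum>b\<in>B. (s b \<bullet> y)\<^sup>2) = y \<bullet> y" and s: "\<And>b. b \<in> B \<Longrightarrow> s b \<noteq> 0"
    and f: "\<And>b. b \<in> B \<Longrightarrow> continuous_on UNIV (f b)" "\<And>b t. b \<in> B \<Longrightarrow> 0 < f b t"
      "\<And>b. b \<in> B \<Longrightarrow> integrable lborel (f b)"
  shows "(\<integral>\<^sup>+y. ennreal (\<Prod>b\<in>B. f b (s b \<bullet> y) powr (s b \<bullet> s b)) \<partial>lborel)
    \<le> ennreal (\<Prod>b\<in>B. ((\<integral>t. f b t \<partial>lborel) / norm (s b)) powr (s b \<bullet> s b))"
proof -
  have "\<exists>T T'. (\<forall>t. DERIV T t :> T' t) \<and> (\<forall>t. 0 < T' t) \<and> continuous_on UNIV T' \<and>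
    (\<forall>t. f b t = (\<integral>t. f b t \<partial>lborel) * exp (- (pi * (T t)\<^sup>2)) * T' t)" if "b \<in> B" for b
    using gaussian_transport[of "f b"] f that by metis
  then obtain T T' where TT: "\<And>b. b \<in> B \<Longrightarrow> (\<forall>t. DERIV (T b) t :> T' b t) \<and> (\<forall>t. 0 < T' b t) \<and> continuous_on UNIV (T' b) \<and>
    (\<forall>t. f b t = (\<integral>t. f b t \<partial>lborel) * exp (- (pi * (T b t)\<^sup>2)) * T' b t)"
    by metis
  have derT: "DERIV (T b) t :> T' b t" and T'pos: "0 < T' b t" if "b \<in> B" for b t
    using TT[OF that] by blast+
  define \<beta> where "\<beta> b = norm (s b)" for b
  have \<beta>: "\<beta> b > 0" if "b \<in> B" for b using s[OF that] by (simp add: \<beta>_def)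
  have ss: "s b \<bullet> s b = (\<beta> b)\<^sup>2" for b by (simp add: \<beta>_def power2_norm_eq_inner)
  define I where "I b = (\<integral>t. f b t \<partial>lborel)" for b
  have I: "I b \<ge> 0" if "b \<in> B" for b
    unfolding I_def using f(2)[OF that] by (intro integral_nonneg_AE) (auto intro!: AE_I2 less_imp_le)
  define C where "C = (\<Prod>b\<in>B. (I b / \<beta> b) powr (s b \<bullet> s b))"
  define \<sigma> where "\<sigma> b y = \<beta> b * T' b (s b \<bullet> y)" for b y
  have \<sigma>: "\<sigma> b y > 0" if "b \<in> B" for b y using T'pos[OF that] \<beta>[OF that] by (simp add: \<sigma>_def)
  define \<Phi> where "\<Phi> y = (\<Sum>b\<in>B. (\<beta> b * T b (s b \<bullet> y)) *\<^sub>R s b)" for y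
  define D where "D y = (\<lambda>h. \<Sum>b\<in>B. (\<sigma> b y * (s b \<bullet> h)) *\<^sub>R s b)" for y
  have der: "(\<Phi> has_derivative D y) (at y)" for y
    unfolding \<Phi>_def D_def
  proof (intro has_derivative_sum)
    fix b assume b: "b \<in> B"
    have 1: "((\<lambda>y. s b \<bullet> y) has_derivative (\<lambda>h. s b \<bullet> h)) (at y)" by (auto intro!: derivative_eq_intros)
    have 2: "(T b has_derivative (*) (T' b (s b \<bullet> y))) (at (s b \<bullet> y))"
      using derT[OF b] by (simp add: has_field_derivative_def)
    have "((\<lambda>y. T b (s b \<bullet> y)) has_derivative (\<lambda>h. T' b (s b \<bullet> y) * (s b \<bullet> h))) (at y)"
      by (rule has_derivative_compose[OF 1 2])
    then show "((\<lambda>y. (\<beta> b * T b (s b \<bullet> y)) *\<^sub>R s b) has_derivative (\<lambda>h. (\<sigma> b y * (s b \<bullet> h)) *\<^sub>R s b)) (at y)"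
      by (auto intro!: derivative_eq_intros simp: \<sigma>_def mult_ac)
  qed
  have Tmono: "strict_mono (T b)" if "b \<in> B" for b
    using derT[OF that] T'pos[OF that] by (intro strict_monoI) (metis DERIV_pos_imp_increasing)
  have inj: "inj \<Phi>"
  proof (rule injI, rule ccontr)
    fix x y assume eq: "\<Phi> x = \<Phi> y" and "x \<noteq> y"
    \<comment> \<open>\<open>\<Phi>\<close> is strictly monotone: \<open>(\<Phi> x - \<Phi> y) \<bullet> (x - y)\<close> is a sum of nonnegative terms.\<close>
    have nn: "0 \<le> (T b (s b \<bullet> x) - T b (s b \<bullet> y)) * (s b \<bullet> x - s b \<bullet> y)"
      and z: "(T b (s b \<bullet> x) - T b (s b \<bullet> y)) * (s b \<bullet> x - s b \<bullet> y) = 0 \<Longrightarrow> s b \<bullet> x = s b \<bullet> y" if "b \<in> B" for b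
      using strict_mono_less[OF Tmono[OF that], of "s b \<bullet> x" "s b \<bullet> y"]
        strict_mono_less[OF Tmono[OF that], of "s b \<bullet> y" "s b \<bullet> x"] strict_mono_eq[OF Tmono[OF that]]
      by (auto simp: zero_le_mult_iff not_less)
    have "0 = (\<Phi> x - \<Phi> y) \<bullet> (x - y)" using eq by simp
    also have "\<dots> = (\<Sum>b\<in>B. \<beta> b * ((T b (s b \<bullet> x) - T b (s b \<bullet> y)) * (s b \<bullet> x - s b \<bullet> y)))"
      by (simp add: \<Phi>_def inner_sum_left sum_subtractf[symmetric] algebra_simps)
    finally have "\<forall>b\<in>B. \<beta> b * ((T b (s b \<bullet> x) - T b (s b \<bullet> y)) * (s b \<bullet> x - s b \<bullet> y)) = 0"
      using sum_nonneg_eq_0_iff[OF B, of "\<lambda>b. \<beta> b * ((T b (s b \<bullet> x) - T b (s b \<bullet> y)) * (s b \<bullet> x - s b \<bullet> y))"] nn \<beta>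
      by (simp add: less_imp_le)
    then have "s b \<bullet> x = s b \<bullet> y" if "b \<in> B" for b
      using z[OF that] \<beta>[OF that] that by fastforce
    then have "(\<Sum>b\<in>B. (s b \<bullet> (x - y))\<^sup>2) = 0" by (simp add: inner_diff_right)
    then show False using id[of "x - y"] \<open>x \<noteq> y\<close> by simp
  qed
  define G where "G z = exp (- (pi * (z \<bullet> z)))" for z :: "real^'k::_"
  have G: "0 \<le> G z" "integrable lborel G" "(\<integral>\<^sup>+z. ennreal (G z) \<partial>lborel) = 1" for z
    unfolding G_def using integral_gaussian_euclidean[where 'a="real^'k::_"]
    by (auto intro!: integrableI_nonneg)
  define p where "p y = (\<Prod>b\<in>B. f b (s b \<bullet> y) powr (s b \<bullet> s b))" for y
  have [measurable]: "f b \<in> borel_measurable borel" if "b \<in> B" for b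
    using f(1)[OF that] by (rule borel_measurable_continuous_onI)
  have pm [measurable]: "p \<in> borel_measurable borel" unfolding p_def by measurable
  have pt: "p y \<le> C * (\<bar>det (matrix (D y))\<bar> * G (\<Phi> y))" for y
  proof -
    have "p y = (\<Prod>b\<in>B. (I b / \<beta> b) powr (s b \<bullet> s b) * (exp (- (pi * (\<beta> b * T b (s b \<bullet> y))\<^sup>2)) * \<sigma> b y powr (s b \<bullet> s b)))"
      unfolding p_def
    proof (intro prod.cong refl)
      fix b assume b: "b \<in> B"
      have "f b (s b \<bullet> y) = (I b / \<beta> b) * exp (- (pi * (T b (s b \<bullet> y))\<^sup>2)) * \<sigma> b y"
      proof -
        have "f b (s b \<bullet> y) = I b * exp (- (pi * (T b (s b \<bullet> y))\<^sup>2)) * T' b (s b \<bullet> y)"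
          using TT[OF b] unfolding I_def by blast
        then show ?thesis using \<beta>[OF b] by (simp add: \<sigma>_def)
      qed
      then have "f b (s b \<bullet> y) powr (s b \<bullet> s b) = (I b / \<beta> b) powr (s b \<bullet> s b) * exp (- (pi * (T b (s b \<bullet> y))\<^sup>2)) powr (s b \<bullet> s b) * \<sigma> b y powr (s b \<bullet> s b)"
      proof -
        have "(x * e * z) powr a = x powr a * e powr a * z powr a" if "0 \<le> x" "0 \<le> e" "0 \<le> z" for x e z a :: real
          using that by (simp add: powr_mult)
        from this[of "I b / \<beta> b" "exp (- (pi * (T b (s b \<bullet> y))\<^sup>2))" "\<sigma> b y"]
        show ?thesis using I[OF b] \<beta>[OF b] \<sigma>[OF b, of y]
          unfolding \<open>f b (s b \<bullet> y) = _\<close> by (simp add: less_imp_le)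
      qed
      moreover have "exp (- (pi * (T b (s b \<bullet> y))\<^sup>2)) powr (s b \<bullet> s b) = exp (- (pi * (\<beta> b * T b (s b \<bullet> y))\<^sup>2))"
        by (simp add: powr_def ss power_mult_distrib)
      ultimately show "f b (s b \<bullet> y) powr (s b \<bullet> s b) = (I b / \<beta> b) powr (s b \<bullet> s b) * (exp (- (pi * (\<beta> b * T b (s b \<bullet> y))\<^sup>2)) * \<sigma> b y powr (s b \<bullet> s b))"
        by simp
    qed
    also have "\<dots> = C * ((\<Prod>b\<in>B. \<sigma> b y powr (s b \<bullet> s b)) * exp (- (pi * (\<Sum>b\<in>B. (\<beta> b * T b (s b \<bullet> y))\<^sup>2))))"
      by (simp add: C_def prod.distrib exp_sum[OF B] sum_distrib_left sum_negf[symmetric])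
    also have "\<dots> \<le> C * (\<bar>det (matrix (D y))\<bar> * G (\<Phi> y))"
    proof (intro mult_left_mono mult_mono)
      show "(\<Prod>b\<in>B. \<sigma> b y powr (s b \<bullet> s b)) \<le> \<bar>det (matrix (D y))\<bar>"
        using det_weighted_rank_one_sum_ge[OF B id, of "\<lambda>b. \<sigma> b y"] \<sigma> unfolding D_def by fastforce
      show "exp (- (pi * (\<Sum>b\<in>B. (\<beta> b * T b (s b \<bullet> y))\<^sup>2))) \<le> G (\<Phi> y)"
        using frame_combination_norm_le[OF id, of "\<lambda>b. \<beta> b * T b (s b \<bullet> y)"] unfolding G_def \<Phi>_def by simp
      show "0 \<le> C" unfolding C_def by (intro prod_nonneg) auto
    qed auto
    finally show ?thesis .
  qed
  have C: "C \<ge> 0" unfolding C_def by (intro prod_nonneg) auto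
  have "(\<integral>\<^sup>+y. ennreal (p y) \<partial>lborel) \<le> (\<integral>\<^sup>+z. ennreal (C * G z) \<partial>lborel)"
    by (rule nn_integral_jacobian_le[OF der inj]) (use G C pt pm in \<open>auto simp: mult_ac\<close>)
  also have "\<dots> = ennreal C * (\<integral>\<^sup>+z. ennreal (G z) \<partial>lborel)"
    using C G(1) by (subst nn_integral_cmult[symmetric]) (auto simp: ennreal_mult G_def)
  finally show ?thesis unfolding G p_def C_def I_def \<beta>_def by simp
qed

text \<open>
  The geometric, rank-one case: writing \<open>s b\<close> as \<open>sqrt \<lambda>\<close> times a unit vector, the frame condition is a
  decomposition of the identity with weights \<open>\<lambda>\<close>, and the exponents are these weights. Zeros of the \<open>f b\<close>
  are removed by adding a small multiple of a Gaussian.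
\<close>

theorem Brascamp_Lieb:
  fixes s :: "'b \<Rightarrow> real^'k::{finite,wellorder}" and f :: "'b \<Rightarrow> real \<Rightarrow> real"
  assumes B: "finite B" and id: "\<And>y. (\<Sum>b\<in>B. (s b \<bullet> y)\<^sup>2) = y \<bullet> y" and s: "\<And>b. b \<in> B \<Longrightarrow> s b \<noteq> 0"
    and f: "\<And>b. b \<in> B \<Longrightarrow> continuous_on UNIV (f b)" "\<And>b t. b \<in> B \<Longrightarrow> 0 \<le> f b t"
      "\<And>b. b \<in> B \<Longrightarrow> integrable lborel (f b)"
  shows "(\<integral>\<^sup>+y. ennreal (\<Prod>b\<in>B. f b (s b \<bullet> y) powr (s b \<bullet> s b)) \<partial>lborel)
    \<le> ennreal (\<Prod>b\<in>B. ((\<integral>t. f b t \<partial>lborel) / norm (s b)) powr (s b \<bullet> s b))"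
proof (rule tendsto_lowerbound)
  define I where "I b = (\<integral>t. f b t \<partial>lborel)" for b
  have I: "I b \<ge> 0" if "b \<in> B" for b
    unfolding I_def using f(2)[OF that] by (intro integral_nonneg_AE) auto
  show "((\<lambda>\<eta>. ennreal (\<Prod>b\<in>B. ((I b + \<eta>) / norm (s b)) powr (s b \<bullet> s b))) \<longlongrightarrow>
     ennreal (\<Prod>b\<in>B. ((\<integral>t. f b t \<partial>lborel) / norm (s b)) powr (s b \<bullet> s b))) (at_right 0)"
    unfolding I_def[symmetric]
  proof (intro tendsto_ennrealI tendsto_prod tendsto_powr2)
    fix b assume b: "b \<in> B"
    have "((\<lambda>\<eta>. (I b + \<eta>) / norm (s b)) \<longlongrightarrow> (I b + 0) / norm (s b)) (at_right 0)"
      using s[OF b] by (intro tendsto_intros) auto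
    then show "((\<lambda>\<eta>. (I b + \<eta>) / norm (s b)) \<longlongrightarrow> I b / norm (s b)) (at_right 0)" by simp
    show "\<forall>\<^sub>F \<eta> in at_right 0. 0 \<le> (I b + \<eta>) / norm (s b)"
      using eventually_at_right_less[of 0] by eventually_elim (use I[OF b] in auto)
  qed (use s in auto)
  show "\<forall>\<^sub>F \<eta> in at_right 0. (\<integral>\<^sup>+y. ennreal (\<Prod>b\<in>B. f b (s b \<bullet> y) powr (s b \<bullet> s b)) \<partial>lborel)
    \<le> ennreal (\<Prod>b\<in>B. ((I b + \<eta>) / norm (s b)) powr (s b \<bullet> s b))"
    using eventually_at_right_less[of 0]
  proof eventually_elim
    case (elim \<eta>)
    define h where "h b t = f b t + \<eta> * exp (- (pi * t\<^sup>2))" for b t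
    have "(\<integral>\<^sup>+y. ennreal (\<Prod>b\<in>B. f b (s b \<bullet> y) powr (s b \<bullet> s b)) \<partial>lborel)
      \<le> (\<integral>\<^sup>+y. ennreal (\<Prod>b\<in>B. h b (s b \<bullet> y) powr (s b \<bullet> s b)) \<partial>lborel)"
      using f(2) elim by (intro nn_integral_mono ennreal_leI prod_mono conjI powr_mono2) (auto simp: h_def)
    also have "\<dots> \<le> ennreal (\<Prod>b\<in>B. ((\<integral>t. h b t \<partial>lborel) / norm (s b)) powr (s b \<bullet> s b))"
      unfolding h_def using f elim integrable_gaussian_kernel
      by (intro Brascamp_Lieb_positive B id s continuous_intros add_nonneg_pos) auto
    also have "(\<Prod>b\<in>B. ((\<integral>t. h b t \<partial>lborel) / norm (s b)) powr (s b \<bullet> s b)) = (\<Prod>b\<in>B. ((I b + \<eta>) / norm (s b)) powr (s b \<bullet> s b))"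
      using f(3) integrable_gaussian_kernel integral_gaussian_kernel by (intro prod.cong) (auto simp: h_def I_def)
    finally show ?case .
  qed
qed simp

section \<open>Fourier transforms of Gaussians and of smoothed intervals\<close>

text \<open>
  The characteristic function of the normal distribution, rescaled.
\<close>

lemma gaussian_fourier:
  fixes r x :: real
  assumes r: "0 < r"
  shows "integrable lborel (\<lambda>t. exp (- (t / r)\<^sup>2 / 2))"
    and "(CLINT t|lborel. complex_of_real (exp (- (t / r)\<^sup>2 / 2)) * iexp (x * t))
      = complex_of_real (r * sqrt (2 * pi) * exp (- (r * x)\<^sup>2 / 2))"
proof -
  have "(\<lambda>t. exp (- (t / r)\<^sup>2 / 2)) = (\<lambda>t. r * sqrt (2 * pi) * normal_density 0 r t)"
    using r by (simp add: normal_density_def fun_eq_iff real_sqrt_mult power_divide)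
  then show "integrable lborel (\<lambda>t. exp (- (t / r)\<^sup>2 / 2))"
    using r by simp
  have "(CLINT t|lborel. complex_of_real (exp (- (t / r)\<^sup>2 / 2)) * iexp (x * t))
     = \<bar>r\<bar> *\<^sub>R (CLINT t|lborel. complex_of_real (exp (- ((0 + r * t) / r)\<^sup>2 / 2)) * iexp (x * (0 + r * t)))"
    using r by (intro lborel_integral_real_affine) auto
  also have "(CLINT t|lborel. complex_of_real (exp (- ((0 + r * t) / r)\<^sup>2 / 2)) * iexp (x * (0 + r * t)))
     = sqrt (2 * pi) * (CLINT t|lborel. std_normal_density t *\<^sub>R iexp (r * x * t))"
    using r unfolding integral_mult_right_zero[symmetric]
    by (intro Bochner_Integration.integral_cong) (auto simp: std_normal_density_def scaleR_conv_of_real mult_ac)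
  also have "(CLINT t|lborel. std_normal_density t *\<^sub>R iexp (r * x * t)) = char std_normal_distribution (r * x)"
    unfolding char_def by (subst integral_density) (auto simp: mult_ac)
  finally show "(CLINT t|lborel. complex_of_real (exp (- (t / r)\<^sup>2 / 2)) * iexp (x * t))
      = complex_of_real (r * sqrt (2 * pi) * exp (- (r * x)\<^sup>2 / 2))"
    using r by (simp add: char_std_normal_distribution scaleR_conv_of_real)
qed

text \<open>
  The indicator of \<open>\<bar>x\<bar> \<le> A\<close> convolved with the centred normal density of standard deviation \<open>\<sigma>\<close>: the
  probability that \<open>x + \<sigma> * Z\<close> lies in the interval, for a standard normal \<open>Z\<close>.
\<close>

definition slab_prob :: "real \<Rightarrow> real \<Rightarrow> real \<Rightarrow> real" where
  "slab_prob \<sigma> A x = measure std_normal_distribution {(x - A) / \<sigma>..(x + A) / \<sigma>}"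

definition slab_fourier :: "real \<Rightarrow> real \<Rightarrow> real \<Rightarrow> real" where
  "slab_fourier \<sigma> A t = A / pi * sinc (A * t) * exp (- (\<sigma> * t)\<^sup>2 / 2)"

lemma abs_sinc_le_1: "\<bar>sinc t\<bar> \<le> 1"
  using abs_sin_x_le_abs_x[of t] by (simp add: divide_le_eq)

lemma slab_prob_nonneg: "0 \<le> slab_prob \<sigma> A x"
  by (simp add: slab_prob_def)

lemma slab_prob_eq_integral:
  assumes "0 < \<sigma>"
  shows "slab_prob \<sigma> A x = (\<integral>s. indicator {x - A..x + A} s * (1 / (\<sigma> * sqrt (2 * pi)) * exp (- (s / \<sigma>)\<^sup>2 / 2)) \<partial>lborel)"
proof -
  have "slab_prob \<sigma> A x = (\<integral>s. std_normal_density s * indicator {(x - A) / \<sigma>..(x + A) / \<sigma>} s \<partial>lborel)"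
    unfolding slab_prob_def measure_def
    by (subst integral_eq_nn_integral)
      (auto simp: emeasure_density intro!: arg_cong[where f=enn2real] nn_integral_cong split: split_indicator)
  also have "\<dots> = (1 / \<sigma>) * (\<integral>s. std_normal_density (s / \<sigma>) * indicator {x - A..x + A} s \<partial>lborel)"
  proof (subst lborel_integral_real_affine[where c="1 / \<sigma>" and t=0])
    have "indicator {(x - A) / \<sigma>..(x + A) / \<sigma>} (s / \<sigma>) = (indicator {x - A..x + A} s :: real)" for s
      using assms by (auto simp: divide_le_cancel split: split_indicator)
    then show "\<bar>1 / \<sigma>\<bar> *\<^sub>R (\<integral>s. std_normal_density (0 + 1 / \<sigma> * s) * indicator {(x - A) / \<sigma>..(x + A) / \<sigma>} (0 + 1 / \<sigma> * s) \<partial>lborel)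
      = (1 / \<sigma>) * (\<integral>s. std_normal_density (s / \<sigma>) * indicator {x - A..x + A} s \<partial>lborel)"
      using assms by simp
  qed (use assms in auto)
  also have "\<dots> = (\<integral>s. indicator {x - A..x + A} s * (1 / (\<sigma> * sqrt (2 * pi)) * exp (- (s / \<sigma>)\<^sup>2 / 2)) \<partial>lborel)"
    unfolding integral_mult_right_zero[symmetric]
    by (intro Bochner_Integration.integral_cong) (auto simp: std_normal_density_def)
  finally show ?thesis .
qed

lemma integral_iexp_slab:
  assumes A: "0 < A"
  shows "(CLINT s|lborel. indicator {x - A..x + A} s *\<^sub>R iexp (s * t)) = complex_of_real (2 * A * sinc (A * t)) * iexp (t * x)"
proof (cases "t = 0")
  case True
  then show ?thesis using A by (simp add: scaleR_conv_of_real)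
next
  case False
  have "((\<lambda>s. iexp (s * t)) has_integral (iexp ((x + A) * t) / (\<i> * t) - iexp ((x - A) * t) / (\<i> * t))) {x - A..x + A}"
  proof (rule fundamental_theorem_of_calculus)
    fix s assume "s \<in> {x - A..x + A}"
    have "((\<lambda>s. exp (\<i> * complex_of_real (s * t)) / (\<i> * t)) has_vector_derivative exp (\<i> * complex_of_real (s * t))) (at s within {x - A..x + A})"
      using False by (auto intro!: derivative_eq_intros has_vector_derivative_real_field simp: field_simps)
    then show "((\<lambda>s. iexp (s * t) / (\<i> * t)) has_vector_derivative iexp (s * t)) (at s within {x - A..x + A})" .
  qed (use A in auto)
  moreover have "iexp ((x + A) * t) / (\<i> * t) - iexp ((x - A) * t) / (\<i> * t) = complex_of_real (2 * A * sinc (A * t)) * iexp (t * x)"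
  proof -
    have "iexp ((x + A) * t) = iexp (t * x) * iexp (A * t)" "iexp ((x - A) * t) = iexp (t * x) * iexp (- (A * t))"
      by (simp_all add: algebra_simps flip: exp_add)
    moreover have "iexp (A * t) - iexp (- (A * t)) = 2 * \<i> * complex_of_real (sin (A * t))"
      by (simp add: complex_eq_iff Re_exp Im_exp)
    ultimately have "iexp ((x + A) * t) - iexp ((x - A) * t) = iexp (t * x) * (2 * \<i> * complex_of_real (sin (A * t)))"
      by (metis right_diff_distrib)
    then have "iexp ((x + A) * t) / (\<i> * t) - iexp ((x - A) * t) / (\<i> * t)
        = iexp (t * x) * (2 * \<i> * complex_of_real (sin (A * t))) / (\<i> * t)"
      by (simp flip: diff_divide_distrib)
    then show ?thesis using False A by simp
  qed
  moreover have "set_integrable lborel {x - A..x + A} (\<lambda>s. iexp (s * t))"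
    by (intro borel_integrable_atLeastAtMost' continuous_intros)
  ultimately show ?thesis
    using set_borel_integral_eq_integral(2)[of "{x - A..x + A}" "\<lambda>s. iexp (s * t)"]
    unfolding set_lebesgue_integral_def by (simp add: integral_unique)
qed

lemma slab_fourier_integrable:
  assumes "0 < \<sigma>" "0 < A"
  shows "integrable lborel (slab_fourier \<sigma> A)"
proof (rule Bochner_Integration.integrable_bound)
  show "integrable lborel (\<lambda>t. A / pi * exp (- (t / (1 / \<sigma>))\<^sup>2 / 2))"
    using assms by (intro integrable_mult_right gaussian_fourier(1)) auto
  show "slab_fourier \<sigma> A \<in> borel_measurable lborel"
    unfolding slab_fourier_def by measurable
  show "AE t in lborel. norm (slab_fourier \<sigma> A t) \<le> norm (A / pi * exp (- (t / (1 / \<sigma>))\<^sup>2 / 2))"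
  proof (rule AE_I2)
    fix t
    have "A / pi * \<bar>sinc (A * t)\<bar> * exp (- (\<sigma> * t)\<^sup>2 / 2) \<le> A / pi * 1 * exp (- (\<sigma> * t)\<^sup>2 / 2)"
      by (intro mult_right_mono mult_left_mono abs_sinc_le_1) (use assms in auto)
    then show "norm (slab_fourier \<sigma> A t) \<le> norm (A / pi * exp (- (t / (1 / \<sigma>))\<^sup>2 / 2))"
      using assms unfolding slab_fourier_def real_norm_def abs_mult by (simp add: mult_ac)
  qed
qed

text \<open>
  The Gaussian factor of \<open>slab_prob\<close> is itself a Fourier integral; exchanging the order of integration
  leaves the Fourier transform of an interval, which is a dilated \<open>sinc\<close>.
\<close>

lemma slab_prob_fourier:
  assumes \<sigma>: "0 < \<sigma>" and A: "0 < A"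
  shows "(CLINT t|lborel. complex_of_real (slab_fourier \<sigma> A t) * iexp (t * x)) = complex_of_real (slab_prob \<sigma> A x)"
proof -
  define e where "e t = complex_of_real (exp (- (t / (1 / \<sigma>))\<^sup>2 / 2))" for t
  let ?ind = "indicator {x - A..x + A} :: real \<Rightarrow> real"
  have [measurable]: "e \<in> borel_measurable borel" unfolding e_def by measurable
  have int: "integrable (lborel \<Otimes>\<^sub>M lborel) (\<lambda>(s, t). ?ind s *\<^sub>R (e t * iexp (s * t)))"
  proof (rule lborel_pair.Fubini_integrable)
    have eq: "(\<lambda>s. LINT t|lborel. norm (?ind s *\<^sub>R (e t * iexp (s * t)))) = (\<lambda>s. ?ind s * (LINT t|lborel. exp (- (t / (1 / \<sigma>))\<^sup>2 / 2)))"
      by (simp add: e_def norm_mult)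
    show "integrable lborel (\<lambda>s. LINT t|lborel. norm (case (s, t) of (s, t) \<Rightarrow> ?ind s *\<^sub>R (e t * iexp (s * t))))"
      unfolding prod.case eq by (intro integrable_mult_left integrable_real_indicator) (use A in simp_all)
    show "AE s in lborel. integrable lborel (\<lambda>t. case (s, t) of (s, t) \<Rightarrow> ?ind s *\<^sub>R (e t * iexp (s * t)))"
    proof (rule AE_I2)
      fix s :: real
      have "integrable lborel e" unfolding e_def using \<sigma> by (intro integrable_of_real gaussian_fourier(1)) auto
      then have "integrable lborel (\<lambda>t. e t * iexp (s * t))"
        by (rule Bochner_Integration.integrable_bound) (auto simp: norm_mult)
      then show "integrable lborel (\<lambda>t. case (s, t) of (s, t) \<Rightarrow> ?ind s *\<^sub>R (e t * iexp (s * t)))" by simp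
    qed
  qed (simp add: e_def split_beta')
  have dens: "complex_of_real (1 / (\<sigma> * sqrt (2 * pi)) * exp (- (s / \<sigma>)\<^sup>2 / 2)) = (1 / (2 * pi)) *\<^sub>R (CLINT t|lborel. e t * iexp (s * t))" for s
  proof -
    have 1: "(CLINT t|lborel. e t * iexp (s * t)) = complex_of_real (1 / \<sigma> * sqrt (2 * pi) * exp (- (1 / \<sigma> * s)\<^sup>2 / 2))"
      unfolding e_def using \<sigma> by (intro gaussian_fourier(2)) simp
    have "1 / (\<sigma> * q) * E = 1 / (q * q) * (1 / \<sigma> * q * E)" if "q > 0" for q E :: real
      using that by simp
    from this[of "sqrt (2 * pi)" "exp (- (s / \<sigma>)\<^sup>2 / 2)"]
    have "1 / (\<sigma> * sqrt (2 * pi)) * exp (- (s / \<sigma>)\<^sup>2 / 2) = (1 / (2 * pi)) * (1 / \<sigma> * sqrt (2 * pi) * exp (- (s / \<sigma>)\<^sup>2 / 2))"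
      by simp
    moreover have "1 / \<sigma> * s = s / \<sigma>" by simp
    ultimately show ?thesis unfolding 1 by (metis scaleR_conv_of_real of_real_mult)
  qed
  have "complex_of_real (slab_prob \<sigma> A x) = (CLINT s|lborel. complex_of_real (?ind s * (1 / (\<sigma> * sqrt (2 * pi)) * exp (- (s / \<sigma>)\<^sup>2 / 2))))"
    unfolding slab_prob_eq_integral[OF \<sigma>]
  proof (rule integral_of_real[symmetric])
    have "integrable lborel (\<lambda>s. 1 / (\<sigma> * sqrt (2 * pi)) * exp (- (s / \<sigma>)\<^sup>2 / 2))"
      by (intro integrable_mult_right gaussian_fourier(1) \<sigma>)
    from integrable_mult_indicator[OF _ this, of "{x - A..x + A}"]
    show "integrable lborel (\<lambda>s. ?ind s * (1 / (\<sigma> * sqrt (2 * pi)) * exp (- (s / \<sigma>)\<^sup>2 / 2)))"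
      by simp
  qed
  also have "\<dots> = (CLINT s|lborel. (1 / (2 * pi)) *\<^sub>R (CLINT t|lborel. ?ind s *\<^sub>R (e t * iexp (s * t))))"
  proof (intro Bochner_Integration.integral_cong refl)
    fix s
    show "complex_of_real (?ind s * (1 / (\<sigma> * sqrt (2 * pi)) * exp (- (s / \<sigma>)\<^sup>2 / 2))) = (1 / (2 * pi)) *\<^sub>R (CLINT t|lborel. ?ind s *\<^sub>R (e t * iexp (s * t)))"
      unfolding of_real_mult[of "?ind s"] dens integral_scaleR_right by (simp add: scaleR_conv_of_real)
  qed
  also have "\<dots> = (1 / (2 * pi)) *\<^sub>R (CLINT s|lborel. (CLINT t|lborel. ?ind s *\<^sub>R (e t * iexp (s * t))))"
    by (rule integral_scaleR_right)
  also have "(CLINT s|lborel. (CLINT t|lborel. ?ind s *\<^sub>R (e t * iexp (s * t)))) = (CLINT t|lborel. (CLINT s|lborel. ?ind s *\<^sub>R (e t * iexp (s * t))))"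
    using lborel_pair.Fubini_integral[OF int] by simp
  also have "\<dots> = (CLINT t|lborel. e t * (CLINT s|lborel. ?ind s *\<^sub>R iexp (s * t)))"
    unfolding integral_mult_right_zero[symmetric] by (intro Bochner_Integration.integral_cong) (auto simp: scaleR_conv_of_real mult_ac)
  also have "\<dots> = (CLINT t|lborel. e t * (complex_of_real (2 * A * sinc (A * t)) * iexp (t * x)))"
    unfolding integral_iexp_slab[OF A] ..
  also have "(1 / (2 * pi)) *\<^sub>R \<dots> = (CLINT t|lborel. complex_of_real (slab_fourier \<sigma> A t) * iexp (t * x))"
    unfolding integral_scaleR_right[symmetric]
    by (intro Bochner_Integration.integral_cong) (auto simp: e_def slab_fourier_def scaleR_conv_of_real mult_ac)
  finally show ?thesis by simp
qed

lemma lborel_integral_prod_Basis: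
  fixes f :: "'a::euclidean_space \<Rightarrow> real \<Rightarrow> 'c::{real_normed_field,banach,second_countable_topology}"
  assumes "\<And>b. b \<in> Basis \<Longrightarrow> integrable lborel (f b)"
  shows "integrable lborel (\<lambda>x. \<Prod>b\<in>Basis. f b (x \<bullet> b))"
    and "(\<integral>x. (\<Prod>b\<in>Basis. f b (x \<bullet> b)) \<partial>lborel) = (\<Prod>b\<in>Basis. (\<integral>x. f b x \<partial>lborel))"
proof -
  interpret product_sigma_finite "\<lambda>_::'a. lborel :: real measure" by standard
  have [measurable]: "f b \<in> borel_measurable borel" if "b \<in> Basis" for b
    using assms[OF that] by auto
  show "integrable lborel (\<lambda>x. \<Prod>b\<in>Basis. f b (x \<bullet> b))"
    unfolding lborel_def[where 'a='a] lborel_eq_real[symmetric]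
    by (subst integrable_distr_eq) (auto intro!: product_integrable_prod assms)
  show "(\<integral>x. (\<Prod>b\<in>Basis. f b (x \<bullet> b)) \<partial>lborel) = (\<Prod>b\<in>Basis. (\<integral>x. f b x \<partial>lborel))"
    unfolding lborel_def[where 'a='a] lborel_eq_real[symmetric]
    by (subst integral_distr) (auto intro!: product_integral_prod assms)
qed

definition gauss_weight :: "real \<Rightarrow> 'a::euclidean_space \<Rightarrow> real" where
  "gauss_weight r x = exp (- (x \<bullet> x) / (2 * r\<^sup>2))"

lemma gauss_weight_eq_prod:
  "gauss_weight r x = (\<Prod>b\<in>Basis. exp (- ((x \<bullet> b) / r)\<^sup>2 / 2))"
proof -
  have "- (x \<bullet> x) / (2 * r\<^sup>2) = (\<Sum>b\<in>Basis. - ((x \<bullet> b) / r)\<^sup>2 / 2)"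
    by (subst euclidean_inner) (simp add: sum_divide_distrib sum_negf power_divide power2_eq_square mult_ac)
  then show ?thesis unfolding gauss_weight_def by (simp add: exp_sum)
qed

lemma gauss_weight_fourier:
  fixes \<xi> :: "'a::euclidean_space"
  assumes r: "0 < r"
  shows "integrable lborel (gauss_weight r :: 'a \<Rightarrow> real)"
    and "(CLINT x|lborel. complex_of_real (gauss_weight r x) * iexp (\<xi> \<bullet> x))
      = complex_of_real ((r * sqrt (2 * pi)) ^ DIM('a) * gauss_weight (1 / r) \<xi>)"
proof -
  show "integrable lborel (gauss_weight r :: 'a \<Rightarrow> real)"
    unfolding gauss_weight_eq_prod[abs_def]
    by (intro lborel_integral_prod_Basis(1) gaussian_fourier(1) r)
  let ?f = "\<lambda>b t. complex_of_real (exp (- (t / r)\<^sup>2 / 2)) * iexp ((\<xi> \<bullet> b) * t)"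
  have "complex_of_real (gauss_weight r x) * iexp (\<xi> \<bullet> x) = (\<Prod>b\<in>Basis. ?f b (x \<bullet> b))" for x
  proof -
    have "iexp (\<xi> \<bullet> x) = (\<Prod>b\<in>Basis. iexp ((\<xi> \<bullet> b) * (x \<bullet> b)))"
      by (subst euclidean_inner) (simp add: sum_distrib_left exp_sum)
    then show ?thesis unfolding gauss_weight_eq_prod prod.distrib by simp
  qed
  then have "(CLINT x|lborel. complex_of_real (gauss_weight r x) * iexp (\<xi> \<bullet> x))
     = (CLINT x|lborel. (\<Prod>b\<in>Basis. ?f b (x \<bullet> b)))" by simp
  also have "\<dots> = (\<Prod>b\<in>Basis. (CLINT t|lborel. ?f b t))"
  proof (intro lborel_integral_prod_Basis(2))
    fix b :: 'a
    have "integrable lborel (\<lambda>t. complex_of_real (exp (- (t / r)\<^sup>2 / 2)))"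
      by (intro integrable_of_real gaussian_fourier(1) r)
    then show "integrable lborel (?f b)"
      by (rule Bochner_Integration.integrable_bound) (auto simp: norm_mult)
  qed
  also have "\<dots> = (\<Prod>b\<in>(Basis :: 'a set). complex_of_real (r * sqrt (2 * pi) * exp (- ((\<xi> \<bullet> b) / (1 / r))\<^sup>2 / 2)))"
    by (intro prod.cong refl, subst gaussian_fourier(2)[OF r]) (simp add: mult.commute)
  also have "\<dots> = complex_of_real ((r * sqrt (2 * pi)) ^ DIM('a) * gauss_weight (1 / r) \<xi>)"
    unfolding gauss_weight_eq_prod by (simp add: prod.distrib)
  finally show "(CLINT x|lborel. complex_of_real (gauss_weight r x) * iexp (\<xi> \<bullet> x))
      = complex_of_real ((r * sqrt (2 * pi)) ^ DIM('a) * gauss_weight (1 / r) \<xi>)" .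
qed

lemma nn_integral_gauss_weight_fourier:
  assumes r: "0 < r"
  shows "(\<integral>\<^sup>+\<xi>. ennreal ((r * sqrt (2 * pi)) ^ DIM('a) * gauss_weight (1 / r) \<xi>) \<partial>(lborel :: 'a::euclidean_space measure))
    = ennreal ((2 * pi) ^ DIM('a))"
proof -
  have nn: "0 \<le> gauss_weight (1 / r) x" for x :: 'a by (simp add: gauss_weight_def)
  have i: "integrable lborel (gauss_weight (1 / r) :: 'a \<Rightarrow> real)"
    using r by (intro gauss_weight_fourier(1)) auto
  have "complex_of_real (\<integral>x. gauss_weight (1 / r) x \<partial>(lborel :: 'a measure)) = (CLINT x|(lborel :: 'a measure). complex_of_real (gauss_weight (1 / r) x) * iexp (0 \<bullet> x))"
    by simp
  also have "\<dots> = complex_of_real ((1 / r * sqrt (2 * pi)) ^ DIM('a))"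
    using r by (subst gauss_weight_fourier(2)) (auto simp: gauss_weight_def)
  finally have "(\<integral>x. gauss_weight (1 / r) x \<partial>(lborel :: 'a measure)) = (1 / r * sqrt (2 * pi)) ^ DIM('a)"
    using of_real_eq_iff by blast
  then have "(\<integral>x. (r * sqrt (2 * pi)) ^ DIM('a) * gauss_weight (1 / r) x \<partial>(lborel :: 'a measure)) = (2 * pi) ^ DIM('a)"
  proof -
    have "(r * sqrt (2 * pi)) * (1 / r * sqrt (2 * pi)) = 2 * pi" using r by simp
    then have "(r * sqrt (2 * pi)) ^ DIM('a) * (1 / r * sqrt (2 * pi)) ^ DIM('a) = (2 * pi) ^ DIM('a)"
      by (simp only: power_mult_distrib[symmetric])
    then show ?thesis
      unfolding integral_mult_right_zero \<open>(\<integral>x. gauss_weight (1 / r) x \<partial>lborel) = _\<close> .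
  qed
  moreover have "(\<integral>\<^sup>+\<xi>. ennreal ((r * sqrt (2 * pi)) ^ DIM('a) * gauss_weight (1 / r) \<xi>) \<partial>(lborel :: 'a measure))
    = ennreal (\<integral>x. (r * sqrt (2 * pi)) ^ DIM('a) * gauss_weight (1 / r) x \<partial>(lborel :: 'a measure))"
  proof (rule nn_integral_eq_integral)
    show "integrable lborel (\<lambda>x :: 'a. (r * sqrt (2 * pi)) ^ DIM('a) * gauss_weight (1 / r) x)"
      by (rule integrable_mult_right) (rule i)
    show "AE x :: 'a in lborel. 0 \<le> (r * sqrt (2 * pi)) ^ DIM('a) * gauss_weight (1 / r) x"
      using r by (intro AE_I2 mult_nonneg_nonneg nn) simp
  qed
  ultimately show ?thesis by (simp only:)
qed


section \<open>Sections of a box and their orthogonal complements\<close>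

text \<open>
  Read \<open>T (x, 0)\<close> as the point \<open>x\<close> of \<open>E\<close> and \<open>T (0, y)\<close> as the point \<open>y\<close> of its orthogonal complement.
  Replacing each \<open>F b\<close> by its Fourier integral turns the left-hand side into the integral of
  \<open>\<Prod>b. \<phi> b (z \<bullet> b)\<close> against the Fourier transform of the weight at the \<open>E\<close>-component \<open>u\<close> of
  \<open>z = T (u, y)\<close>. That transform is a nonnegative function of total mass \<open>(2 * pi) ^ DIM('a)\<close>, however
  wide the weight is, so a bound for the integral over \<open>y\<close> that is uniform in \<open>u\<close> suffices.
\<close>

lemma fourier_section_inequality:
  fixes T :: "'a::euclidean_space \<times> 'b::euclidean_space \<Rightarrow> 'a \<times> 'b"
    and \<phi> F :: "'a \<times> 'b \<Rightarrow> real \<Rightarrow> real"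
  assumes T: "orthogonal_transformation T" and r: "0 < r"
    and int: "\<And>b. b \<in> Basis \<Longrightarrow> integrable lborel (\<phi> b)"
    and F: "\<And>b x. b \<in> Basis \<Longrightarrow> (CLINT t|lborel. complex_of_real (\<phi> b t) * iexp (t * x)) = complex_of_real (F b x)"
    and Fnn: "\<And>b x. b \<in> Basis \<Longrightarrow> 0 \<le> F b x"
    and M: "\<And>u. (\<integral>\<^sup>+y. ennreal (\<Prod>b\<in>Basis. \<bar>\<phi> b (T (u, y) \<bullet> b)\<bar>) \<partial>lborel) \<le> M"
  shows "(\<integral>\<^sup>+x. ennreal (gauss_weight r x * (\<Prod>b\<in>Basis. F b (T (x, 0) \<bullet> b))) \<partial>lborel) \<le> ennreal ((2 * pi) ^ DIM('a)) * M"
proof -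
  define P where "P z = (\<Prod>b\<in>Basis. \<phi> b (z \<bullet> b))" for z :: "'a \<times> 'b"
  define h where "h x = gauss_weight r x * (\<Prod>b\<in>Basis. F b (T (x, 0) \<bullet> b))" for x
  define G where "G x z = complex_of_real (gauss_weight r x) * (complex_of_real (P z) * iexp (z \<bullet> T (x, 0)))" for x z
  have linT: "linear T" using T by (rule orthogonal_transformation_linear)
  have T_cont: "continuous_on UNIV T" using linT by (simp add: linear_continuous_on linear_conv_bounded_linear)
  have T_meas [measurable]: "T \<in> borel_measurable borel"
    using T_cont by (rule borel_measurable_continuous_onI)
  have [measurable]: "(\<lambda>x. T (x, 0)) \<in> borel_measurable borel"
    by (intro borel_measurable_continuous_onI continuous_on_compose2[OF T_cont] continuous_intros) auto
  have [measurable]: "\<phi> b \<in> borel_measurable borel" if "b \<in> Basis" for b using int[OF that] by auto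
  have Pm [measurable]: "P \<in> borel_measurable borel" unfolding P_def by measurable
  have gm [measurable]: "gauss_weight r \<in> borel_measurable borel" for r :: real unfolding gauss_weight_def[abs_def] by measurable
  have Pint: "integrable lborel P" unfolding P_def[abs_def] by (intro lborel_integral_prod_Basis int)
  have F_rep: "complex_of_real (\<Prod>b\<in>Basis. F b (y \<bullet> b)) = (CLINT z|lborel. complex_of_real (P z) * iexp (z \<bullet> y))" for y
  proof -
    have "complex_of_real (\<Prod>b\<in>Basis. F b (y \<bullet> b)) = (\<Prod>b\<in>Basis. (CLINT t|lborel. complex_of_real (\<phi> b t) * iexp (t * (y \<bullet> b))))"
      using F by simp
    also have "\<dots> = (CLINT z|lborel. (\<Prod>b\<in>Basis. complex_of_real (\<phi> b (z \<bullet> b)) * iexp ((z \<bullet> b) * (y \<bullet> b))))"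
    proof (intro lborel_integral_prod_Basis(2)[symmetric])
      fix b :: "'a \<times> 'b" assume b: "b \<in> Basis"
      have [measurable]: "\<phi> b \<in> borel_measurable borel" using int[OF b] by auto
      have "integrable lborel (\<lambda>t. complex_of_real (\<phi> b t))" using int[OF b] by (intro integrable_of_real)
      then show "integrable lborel (\<lambda>t. complex_of_real (\<phi> b t) * iexp (t * (y \<bullet> b)))"
        by (rule Bochner_Integration.integrable_bound) (auto simp: norm_mult)
    qed
    also have "\<dots> = (CLINT z|lborel. complex_of_real (P z) * iexp (z \<bullet> y))"
    proof (intro Bochner_Integration.integral_cong refl)
      fix z
      have "iexp (z \<bullet> y) = (\<Prod>b\<in>Basis. iexp ((z \<bullet> b) * (y \<bullet> b)))"
        by (subst euclidean_inner) (simp add: sum_distrib_left exp_sum)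
      then show "(\<Prod>b\<in>Basis. complex_of_real (\<phi> b (z \<bullet> b)) * iexp ((z \<bullet> b) * (y \<bullet> b))) = complex_of_real (P z) * iexp (z \<bullet> y)"
        unfolding prod.distrib P_def by simp
    qed
    finally show ?thesis .
  qed
  have Gint: "integrable (lborel \<Otimes>\<^sub>M lborel) (\<lambda>(x, z). G x z)"
  proof (rule lborel_pair.Fubini_integrable)
    have eq: "(\<lambda>x. LINT z|lborel. norm (G x z)) = (\<lambda>x. gauss_weight r x * (LINT z|lborel. \<bar>P z\<bar>))"
      by (simp add: G_def norm_mult gauss_weight_def)
    show "integrable lborel (\<lambda>x. LINT z|lborel. norm (case (x, z) of (x, z) \<Rightarrow> G x z))"
      unfolding prod.case eq by (intro integrable_mult_left gauss_weight_fourier(1) r)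
    show "AE x in lborel. integrable lborel (\<lambda>z. case (x, z) of (x, z) \<Rightarrow> G x z)"
    proof (rule AE_I2)
      fix x :: 'a
      have "integrable lborel (\<lambda>z. gauss_weight r x * P z)" by (intro integrable_mult_right Pint)
      then show "integrable lborel (\<lambda>z. case (x, z) of (x, z) \<Rightarrow> G x z)"
        by (rule Bochner_Integration.integrable_bound) (auto simp: G_def norm_mult abs_mult gauss_weight_def)
    qed
  qed (simp add: G_def split_beta')
  have hG: "complex_of_real (h x) = (CLINT z|lborel. G x z)" for x
    unfolding h_def G_def of_real_mult F_rep by simp
  have hint: "integrable lborel h"
  proof -
    have "integrable lborel (\<lambda>x. complex_of_real (h x))"
      unfolding hG using lborel_pair.integrable_fst'[OF Gint] by simp
    then have "integrable lborel (\<lambda>x. Re (complex_of_real (h x)))" by (rule integrable_Re)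
    then show ?thesis by simp
  qed
  have hnn: "0 \<le> h x" for x unfolding h_def gauss_weight_def by (intro mult_nonneg_nonneg prod_nonneg Fnn) auto
  define W where "W u = (r * sqrt (2 * pi)) ^ DIM('a) * gauss_weight (1 / r) u" for u :: 'a
  have Wnn: "0 \<le> W u" for u using r by (auto simp: W_def gauss_weight_def)
  have inner: "(CLINT x|lborel. G x (T q)) = complex_of_real (P (T q) * W (fst q))" for q
  proof -
    have "T q \<bullet> T (x, 0) = fst q \<bullet> x" for x
    proof -
      have "T q \<bullet> T (x, 0) = q \<bullet> (x, 0)" using T unfolding orthogonal_transformation_def by blast
      then show ?thesis by (simp add: inner_prod_def)
    qed
    then have "(CLINT x|lborel. G x (T q)) = (CLINT x|lborel. complex_of_real (P (T q)) * (complex_of_real (gauss_weight r x) * iexp (fst q \<bullet> x)))"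
      by (simp add: G_def mult_ac)
    then show ?thesis unfolding integral_mult_right_zero gauss_weight_fourier(2)[OF r] W_def by simp
  qed
  have "(\<integral>\<^sup>+x. ennreal (h x) \<partial>lborel) = ennreal (\<integral>x. h x \<partial>lborel)"
    using hint hnn by (intro nn_integral_eq_integral) auto
  also have "\<dots> = ennreal (norm (CLINT x|lborel. complex_of_real (h x)))"
    using hnn by (simp add: integral_nonneg_AE)
  also have "(CLINT x|lborel. complex_of_real (h x)) = (CLINT z|lborel. (CLINT x|lborel. G x z))"
    unfolding hG using lborel_pair.Fubini_integral[OF Gint] by simp
  also have "ennreal (norm \<dots>) \<le> (\<integral>\<^sup>+z. ennreal (norm (CLINT x|lborel. G x z)) \<partial>lborel)"
    using lborel_pair.integrable_snd[OF Gint] by (intro integral_norm_bound_ennreal) simp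
  also have "\<dots> = (\<integral>\<^sup>+z. ennreal (norm (CLINT x|lborel. G x z)) \<partial>distr lborel borel T)"
    unfolding lborel_distr_orthogonal[OF T] ..
  also have "\<dots> = (\<integral>\<^sup>+q. ennreal (norm (CLINT x|lborel. G x (T q))) \<partial>lborel)"
  proof (rule nn_integral_distr)
    show "(\<lambda>z. ennreal (norm (CLINT x|lborel. G x z))) \<in> borel_measurable (distr lborel borel T)"
      using borel_measurable_integrable[OF lborel_pair.integrable_snd[OF Gint]] by simp
  qed simp
  also have "\<dots> = (\<integral>\<^sup>+q. ennreal (\<bar>P (T q)\<bar> * W (fst q)) \<partial>(lborel \<Otimes>\<^sub>M lborel))"
    unfolding inner lborel_prod using Wnn by (simp add: abs_mult norm_mult)
  also have "\<dots> = (\<integral>\<^sup>+u. (\<integral>\<^sup>+y. ennreal (\<bar>P (T (u, y))\<bar> * W u) \<partial>lborel) \<partial>lborel)"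
  proof -
    have "(\<lambda>q. ennreal (\<bar>P (T q)\<bar> * W (fst q))) \<in> borel_measurable (borel \<Otimes>\<^sub>M borel)"
    proof -
      have "fst \<in> borel_measurable (borel :: ('a \<times> 'b) measure)"
        by (intro borel_measurable_continuous_onI continuous_intros)
      moreover have "W \<in> borel_measurable borel" unfolding W_def by measurable
      ultimately have [measurable]: "(\<lambda>q :: 'a \<times> 'b. W (fst q)) \<in> borel_measurable borel"
        by (rule measurable_compose)
      show ?thesis unfolding borel_prod by measurable
    qed
    then show ?thesis by (subst lborel.nn_integral_fst[symmetric]) auto
  qed
  also have "\<dots> \<le> (\<integral>\<^sup>+u. ennreal (W u) * M \<partial>lborel)"
  proof (intro nn_integral_mono)
    fix u
    have "(\<integral>\<^sup>+y. ennreal (\<bar>P (T (u, y))\<bar> * W u) \<partial>lborel) = (\<integral>\<^sup>+y. ennreal (W u) * ennreal (\<bar>P (T (u, y))\<bar>) \<partial>lborel)"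
      using Wnn by (simp add: ennreal_mult mult.commute)
    also have "\<dots> = ennreal (W u) * (\<integral>\<^sup>+y. ennreal (\<bar>P (T (u, y))\<bar>) \<partial>lborel)"
    proof (intro nn_integral_cmult)
      have "(\<lambda>y. T (u, y)) \<in> borel_measurable borel"
        by (intro borel_measurable_continuous_onI continuous_on_compose2[OF T_cont] continuous_intros) auto
      then show "(\<lambda>y. ennreal \<bar>P (T (u, y))\<bar>) \<in> borel_measurable lborel" by measurable
    qed
    also have "\<dots> \<le> ennreal (W u) * M"
      using M[of u] by (intro mult_left_mono) (auto simp: P_def abs_prod)
    finally show "(\<integral>\<^sup>+y. ennreal (\<bar>P (T (u, y))\<bar> * W u) \<partial>lborel) \<le> ennreal (W u) * M" .
  qed
  also have "\<dots> = (\<integral>\<^sup>+u. ennreal (W u) \<partial>lborel) * M"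
    unfolding W_def by (intro nn_integral_multc) auto
  also have "(\<integral>\<^sup>+u. ennreal (W u) \<partial>lborel) = ennreal ((2 * pi) ^ DIM('a))"
    unfolding W_def by (rule nn_integral_gauss_weight_fourier[OF r])
  finally show ?thesis unfolding h_def .
qed

lemma frame_trace:
  fixes r :: "'j \<Rightarrow> 'a::euclidean_space"
  assumes id: "\<And>x. (\<Sum>j\<in>J. (r j \<bullet> x)\<^sup>2) = x \<bullet> x"
  shows "(\<Sum>j\<in>J. r j \<bullet> r j) = real DIM('a)"
proof -
  have "(\<Sum>j\<in>J. r j \<bullet> r j) = (\<Sum>j\<in>J. \<Sum>b\<in>Basis. (r j \<bullet> b)\<^sup>2)"
    by (intro sum.cong refl, subst euclidean_inner) (simp add: power2_eq_square)
  also have "\<dots> = (\<Sum>b\<in>Basis. b \<bullet> (b :: 'a))" by (subst sum.swap) (simp add: id)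
  finally show ?thesis by simp
qed

text \<open>
  Map the second factor isometrically onto the orthogonal complement of the range of \<open>R\<close>.
\<close>

lemma orthogonal_completion:
  fixes R :: "'a::euclidean_space \<Rightarrow> 'a \<times> 'b::euclidean_space"
  assumes R: "linear R" "\<And>x. norm (R x) = norm x"
  obtains T :: "'a \<times> 'b \<Rightarrow> 'a \<times> 'b" where "orthogonal_transformation T" "\<And>x. T (x, 0) = R x"
proof -
  define E where "E = {y \<in> UNIV. \<forall>x\<in>range R. orthogonal x y}"
  have injR: "inj R" using R by (metis linear_injective_0 norm_eq_zero)
  have sub: "subspace (range R)" using R(1) linear_subspace_image subspace_UNIV by blast
  have "dim (range R) = DIM('a)" using dim_image_eq[OF R(1), of UNIV] injR by simp
  then have "dim E = DIM('b)"
    using dim_subspace_orthogonal_to_vectors[OF sub subspace_UNIV] unfolding E_def by simp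
  moreover have "subspace E"
    unfolding E_def subspace_def by (auto simp: orthogonal_def inner_add_right)
  ultimately obtain S :: "'b \<Rightarrow> 'a \<times> 'b" where S: "linear S" "S \<in> UNIV \<rightarrow> E" "\<And>y. norm (S y) = norm y"
    using isometry_subset_subspace[of "UNIV :: 'b set" E] by auto
  define T where "T p = R (fst p) + S (snd p)" for p
  have orth: "R x \<bullet> S y = 0" "S y \<bullet> R x = 0" for x y
    using S(2) by (auto simp: E_def orthogonal_def Pi_def inner_commute[of "S y"])
  have "linear T"
    by (rule linearI) (simp_all add: T_def linear_add[OF R(1)] linear_add[OF S(1)] linear_scale[OF R(1)] linear_scale[OF S(1)] algebra_simps)
  moreover have "norm (T p) = norm p" for p
  proof -
    have "(norm (T p))\<^sup>2 = (norm (R (fst p)))\<^sup>2 + (norm (S (snd p)))\<^sup>2"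
      unfolding T_def power2_norm_eq_inner by (simp add: inner_add_left inner_add_right orth)
    also have "\<dots> = (norm p)\<^sup>2" unfolding R(2) S(3) by (simp add: norm_prod_def)
    finally show ?thesis by simp
  qed
  ultimately have "orthogonal_transformation T" by (simp add: orthogonal_transformation)
  moreover have "T (x, 0) = R x" for x by (simp add: T_def linear_0[OF S(1)])
  ultimately show ?thesis using that by blast
qed

text \<open>
  A copy of a finite index type with a well-order, which the change of variables formula on \<open>real^'i\<close>
  asks of \<open>'i\<close>. The complement of the section is parametrised by vectors indexed by this type.
\<close>

typedef ('k::finite) ordered_index = "{..<CARD('k)}"
  using lessThan_empty_iff by (metis bot_nat_0.not_eq_extremum equals0I lessThan_iff zero_less_card_finite)

instantiation ordered_index :: (finite) "{finite, wellorder}"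
begin
definition "less_eq_ordered_index (x::'a ordered_index) (y::'a ordered_index) \<longleftrightarrow> Rep_ordered_index x \<le> Rep_ordered_index y"
definition "less_ordered_index (x::'a ordered_index) (y::'a ordered_index) \<longleftrightarrow> Rep_ordered_index x < Rep_ordered_index y"
instance
proof
  show "finite (UNIV :: 'a ordered_index set)"
    using type_definition.Abs_image[OF type_definition_ordered_index]
    by (metis finite_imageI finite_lessThan)
next
  fix P :: "'a ordered_index \<Rightarrow> bool" and a
  assume *: "\<And>x. (\<And>y. y < x \<Longrightarrow> P y) \<Longrightarrow> P x"
  show "P a"
    by (induction a rule: measure_induct_rule[of Rep_ordered_index])
      (use * in \<open>auto simp: less_ordered_index_def\<close>)
qed (auto simp: less_eq_ordered_index_def less_ordered_index_def Rep_ordered_index_inject)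
end

lemma CARD_ordered_index: "CARD('k::finite ordered_index) = CARD('k)"
  using type_definition.card[OF type_definition_ordered_index] by (metis card_lessThan)

text \<open>
  The factor that a frame vector of norm \<open>\<beta>\<close> contributes to the Brascamp-Lieb bound: with
  \<open>p = 1 / \<beta>\<^sup>2\<close>, Ball's bound \<open>pi * sqrt (2 / p) = pi * sqrt 2 * \<beta>\<close> cancels the division by \<open>\<beta>\<close>.
\<close>

lemma sinc_factor_integral:
  fixes A \<beta> \<tau> :: real
  assumes A: "0 < A" and \<beta>: "0 < \<beta>" "\<beta>\<^sup>2 \<le> 1 / 2"
  defines "f \<equiv> \<lambda>t. (A / pi * \<bar>sinc (A * (\<tau> + t))\<bar>) powr (1 / \<beta>\<^sup>2)"
  shows "continuous_on UNIV f" "integrable lborel f"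
    and "((\<integral>t. f t \<partial>lborel) / \<beta>) powr \<beta>\<^sup>2 \<le> A / pi * (sqrt 2 * pi / A) powr \<beta>\<^sup>2"
proof -
  define p where "p = 1 / \<beta>\<^sup>2"
  have p: "p \<ge> 2" using \<beta> by (simp add: p_def field_simps)
  show cont: "continuous_on UNIV f"
    unfolding f_def
  proof (intro continuous_on_powr' continuous_intros)
    show "\<forall>t\<in>UNIV. 0 \<le> A / pi * \<bar>sinc (A * (\<tau> + t))\<bar> \<and> (A / pi * \<bar>sinc (A * (\<tau> + t))\<bar> = 0 \<longrightarrow> 0 < 1 / \<beta>\<^sup>2)"
      using A \<beta> by (intro ballI conjI mult_nonneg_nonneg) auto
  qed
  have [measurable]: "f \<in> borel_measurable borel" using cont by (rule borel_measurable_continuous_onI)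
  have fnn: "0 \<le> f t" for t unfolding f_def by (rule powr_ge_zero)
  define s where "s t = \<bar>sinc t\<bar> powr p" for t
  have s_meas [measurable]: "s \<in> borel_measurable borel" unfolding s_def by measurable
  have "(\<integral>\<^sup>+t. ennreal (s t) \<partial>lborel) = ennreal \<bar>A\<bar> * (\<integral>\<^sup>+t. ennreal (s (A * \<tau> + A * t)) \<partial>lborel)"
    using A by (intro nn_integral_real_affine) auto
  then have "ennreal A * (\<integral>\<^sup>+t. ennreal (s (A * \<tau> + A * t)) \<partial>lborel) \<le> ennreal (pi * sqrt (2 / p))"
    using Ball_integral_inequality[OF p] A unfolding s_def[symmetric] by simp
  then have "ennreal (1 / A) * (ennreal A * (\<integral>\<^sup>+t. ennreal (s (A * \<tau> + A * t)) \<partial>lborel)) \<le> ennreal (1 / A) * ennreal (pi * sqrt (2 / p))"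
    by (rule mult_left_mono) simp
  also have "ennreal (1 / A) * ennreal (pi * sqrt (2 / p)) = ennreal (pi * sqrt (2 / p) / A)"
    using A p by (subst ennreal_mult[symmetric]) auto
  also have "ennreal (1 / A) * (ennreal A * (\<integral>\<^sup>+t. ennreal (s (A * \<tau> + A * t)) \<partial>lborel)) = (\<integral>\<^sup>+t. ennreal (s (A * \<tau> + A * t)) \<partial>lborel)"
    using A unfolding mult.assoc[symmetric] by (subst ennreal_mult[symmetric]) auto
  finally have 1: "(\<integral>\<^sup>+t. ennreal (s (A * \<tau> + A * t)) \<partial>lborel) \<le> ennreal (pi * sqrt (2 / p) / A)" .
  have fs: "f t = (A / pi) powr p * s (A * \<tau> + A * t)" for t
    unfolding f_def p_def[symmetric] distrib_left s_def by (rule powr_mult)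
  have "(\<integral>\<^sup>+t. ennreal (f t) \<partial>lborel) = (\<integral>\<^sup>+t. ennreal ((A / pi) powr p) * ennreal (s (A * \<tau> + A * t)) \<partial>lborel)"
    unfolding fs by (intro nn_integral_cong ennreal_mult) (auto simp: s_def)
  also have "\<dots> = ennreal ((A / pi) powr p) * (\<integral>\<^sup>+t. ennreal (s (A * \<tau> + A * t)) \<partial>lborel)"
    by (intro nn_integral_cmult) measurable
  also have "\<dots> \<le> ennreal ((A / pi) powr p) * ennreal (pi * sqrt (2 / p) / A)"
    by (intro mult_left_mono 1) auto
  also have "\<dots> = ennreal ((A / pi) powr p * (pi * sqrt (2 / p) / A))"
    using A p by (subst ennreal_mult) auto
  finally have 2: "(\<integral>\<^sup>+t. ennreal (f t) \<partial>lborel) \<le> ennreal ((A / pi) powr p * (pi * sqrt (2 / p) / A))" .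
  show int: "integrable lborel f"
    using le_less_trans[OF 2] fnn by (intro integrableI_nonneg) auto
  have "ennreal (\<integral>t. f t \<partial>lborel) \<le> ennreal ((A / pi) powr p * (pi * sqrt (2 / p) / A))"
    using 2 nn_integral_eq_integral[OF int] fnn by simp
  then have 3: "(\<integral>t. f t \<partial>lborel) \<le> (A / pi) powr p * (pi * sqrt (2 / p) / A)"
    using A p by (subst (asm) ennreal_le_iff) auto
  have "sqrt (2 / p) = sqrt 2 * \<beta>" using \<beta> by (simp add: p_def real_sqrt_mult)
  then have "(\<integral>t. f t \<partial>lborel) / \<beta> \<le> (A / pi) powr p * (sqrt 2 * pi / A)"
    using 3 \<beta> by (simp add: field_simps)
  then have "((\<integral>t. f t \<partial>lborel) / \<beta>) powr \<beta>\<^sup>2 \<le> ((A / pi) powr p * (sqrt 2 * pi / A)) powr \<beta>\<^sup>2"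
    using \<beta> fnn by (intro powr_mono2) (auto intro!: integral_nonneg_AE divide_nonneg_pos)
  also have "\<dots> = ((A / pi) powr p) powr \<beta>\<^sup>2 * (sqrt 2 * pi / A) powr \<beta>\<^sup>2"
    by (rule powr_mult)
  also have "((A / pi) powr p) powr \<beta>\<^sup>2 = A / pi"
    using A \<beta> by (simp add: powr_powr p_def)
  finally show "((\<integral>t. f t \<partial>lborel) / \<beta>) powr \<beta>\<^sup>2 \<le> A / pi * (sqrt 2 * pi / A) powr \<beta>\<^sup>2" .
qed


text \<open>
  Ball's estimate for smoothed slabs and a Gaussian weight. The vectors \<open>r j\<close> are attached, through an
  injection \<open>\<iota>\<close>, to members of the standard basis of \<open>\<real>\<^sup>k \<times> \<real>\<^sup>k\<close>; the other basis vectors receive the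
  vector \<open>0\<close>, collected in \<open>rr\<close>. Then \<open>R x = (\<Sum>b. (rr b \<bullet> x) *\<^sub>R b)\<close> is the embedding onto \<open>E\<close>, \<open>T\<close>
  extends it to the whole space, and \<open>s b\<close> is the projection of \<open>b\<close> to the complement of \<open>E\<close>, so
  \<open>s b \<bullet> s b = 1 - rr b \<bullet> rr b\<close>. A padding coordinate must contribute the factor \<open>1\<close>: it is given the
  standard normal density, whose Fourier transform is \<open>1\<close> at \<open>0\<close> and whose mass is \<open>1\<close>.
\<close>

lemma gaussian_section_bound:
  fixes r :: "'j \<Rightarrow> real^'k" and A :: "'j \<Rightarrow> real"
  assumes J: "finite J" and id: "\<And>x. (\<Sum>j\<in>J. (r j \<bullet> x)\<^sup>2) = x \<bullet> x"
    and half: "\<And>j. j \<in> J \<Longrightarrow> 1 / 2 \<le> r j \<bullet> r j"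
    and A: "\<And>j. j \<in> J \<Longrightarrow> 0 < A j" and \<sigma>: "0 < \<sigma>" and \<rho>: "0 < \<rho>"
  shows "(\<integral>\<^sup>+x. ennreal (gauss_weight \<rho> x * (\<Prod>j\<in>J. slab_prob \<sigma> (A j) (r j \<bullet> x))) \<partial>lborel)
    \<le> ennreal (2 ^ CARD('k) * 2 powr ((real (card J) - real CARD('k)) / 2) * (\<Prod>j\<in>J. A j powr (r j \<bullet> r j)))"
proof -
  let ?B = "Basis :: ((real^'k) \<times> (real^'k ordered_index)) set"
  have trace: "(\<Sum>j\<in>J. r j \<bullet> r j) = real CARD('k)"
    using frame_trace[OF id] by simp
  \<comment> \<open>The one place where the lower bound on \<open>r j \<bullet> r j\<close> limits the number of vectors.\<close>
  have "real (card J) / 2 \<le> real CARD('k)"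
    using sum_mono[of J "\<lambda>_. 1 / 2" "\<lambda>j. r j \<bullet> r j"] half unfolding trace by simp
  then have "card J \<le> card ?B" by (simp add: CARD_ordered_index)
  then obtain \<iota> where \<iota>: "\<iota> ` J \<subseteq> ?B" "inj_on \<iota> J"
    using card_le_inj[OF J finite_Basis] by metis
  define \<kappa> where "\<kappa> = inv_into J \<iota>"
  have \<kappa>: "\<kappa> (\<iota> j) = j" if "j \<in> J" for j using \<iota>(2) that by (simp add: \<kappa>_def)
  have \<kappa>J: "\<kappa> b \<in> J" if "b \<in> \<iota> ` J" for b using \<kappa> that by auto
  define rr where "rr b = (if b \<in> \<iota> ` J then r (\<kappa> b) else 0)" for b
  have split: "(\<Prod>b\<in>?B. if b \<in> \<iota> ` J then g (\<kappa> b) else 1) = (\<Prod>j\<in>J. g j)" for g :: "'j \<Rightarrow> real"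
  proof -
    have "(\<Prod>b\<in>?B. if b \<in> \<iota> ` J then g (\<kappa> b) else 1) = (\<Prod>b\<in>\<iota> ` J. g (\<kappa> b))"
      using \<iota>(1) by (subst prod.mono_neutral_right[of ?B "\<iota> ` J"]) auto
    also have "\<dots> = (\<Prod>j\<in>J. g j)" using \<kappa> by (subst prod.reindex[OF \<iota>(2)]) simp
    finally show ?thesis .
  qed
  define R where "R x = (\<Sum>b\<in>?B. (rr b \<bullet> x) *\<^sub>R b)" for x
  have Rb: "R x \<bullet> b = rr b \<bullet> x" if "b \<in> ?B" for x b
    unfolding R_def using that by (simp add: inner_sum_left inner_Basis if_distrib cong: if_cong)
  have "linear R"
    unfolding R_def by (rule linearI) (simp_all add: inner_add_right algebra_simps sum.distrib scaleR_sum_right)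
  moreover have "norm (R x) = norm x" for x
  proof -
    have "R x \<bullet> R x = (\<Sum>b\<in>?B. (rr b \<bullet> x)\<^sup>2)"
      by (subst euclidean_inner) (simp add: Rb power2_eq_square)
    also have "\<dots> = (\<Sum>b\<in>\<iota> ` J. (r (\<kappa> b) \<bullet> x)\<^sup>2)"
      using \<iota>(1) by (intro sum.mono_neutral_cong_right) (auto simp: rr_def)
    also have "\<dots> = x \<bullet> x" using \<kappa> by (subst sum.reindex[OF \<iota>(2)]) (simp add: id)
    finally show ?thesis by (simp add: norm_eq_sqrt_inner)
  qed
  ultimately obtain T :: "(real^'k) \<times> (real^'k ordered_index) \<Rightarrow> (real^'k) \<times> (real^'k ordered_index)"
    where T: "orthogonal_transformation T" "\<And>x. T (x, 0) = R x"
    using orthogonal_completion[of R] by blast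
  define s where "s b = snd (inv T b)" for b
  have TT: "T (inv T b) = b" for b
    using orthogonal_transformation_surj[OF T(1)] by (simp add: surj_f_inv_f)
  have T_inner: "T p \<bullet> b = p \<bullet> inv T b" for p b
  proof -
    have "T p \<bullet> T (inv T b) = p \<bullet> inv T b" using T(1) unfolding orthogonal_transformation_def by blast
    then show ?thesis unfolding TT .
  qed
  have rr: "fst (inv T b) = rr b" if "b \<in> ?B" for b
  proof -
    have "x \<bullet> fst (inv T b) = x \<bullet> rr b" for x
      using T_inner[of "(x, 0)" b] T(2)[of x] Rb[OF that, of x] by (simp add: inner_prod_def inner_commute)
    then show ?thesis by (metis inner_commute vector_eq_rdot)
  qed
  have T_coord: "T (u, y) \<bullet> b = rr b \<bullet> u + s b \<bullet> y" if "b \<in> ?B" for u y b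
    using T_inner[of "(u, y)" b] rr[OF that] by (simp add: s_def inner_prod_def inner_commute)
  have ss: "s b \<bullet> s b = 1 - rr b \<bullet> rr b" if "b \<in> ?B" for b
    using T_inner[of "inv T b" b] that unfolding TT by (simp add: s_def rr[OF that, symmetric] inner_prod_def[of "inv T b"])
  have frame: "(\<Sum>b\<in>?B. (s b \<bullet> y)\<^sup>2) = y \<bullet> y" for y
  proof -
    have "(\<Sum>b\<in>?B. (s b \<bullet> y)\<^sup>2) = T (0, y) \<bullet> T (0, y)"
      by (subst euclidean_inner) (simp add: T_coord power2_eq_square)
    also have "\<dots> = (0 :: real^'k, y) \<bullet> (0, y)" using T(1) unfolding orthogonal_transformation_def by blast
    finally show ?thesis by (simp add: inner_prod_def)
  qed
  define \<phi> where "\<phi> b = (if b \<in> \<iota> ` J then slab_fourier \<sigma> (A (\<kappa> b)) else std_normal_density)" for b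
  define F where "F b = (if b \<in> \<iota> ` J then slab_prob \<sigma> (A (\<kappa> b)) else (\<lambda>x. exp (- x\<^sup>2 / 2)))" for b
  \<comment> \<open>\<open>g b\<close> majorises \<open>\<phi> b\<close>, uniformly in \<open>\<sigma>\<close>; \<open>K b\<close> is the share of \<open>b\<close> in the final bound.\<close>
  define g where "g b t = (if b \<in> \<iota> ` J then A (\<kappa> b) / pi * \<bar>sinc (A (\<kappa> b) * t)\<bar> else std_normal_density t)" for b t
  define K where "K b = (if b \<in> \<iota> ` J then A (\<kappa> b) / pi * (sqrt 2 * pi / A (\<kappa> b)) powr (s b \<bullet> s b) else 1)" for b
  have \<phi>g: "\<bar>\<phi> b t\<bar> \<le> g b t" for b t
  proof (cases "b \<in> \<iota> ` J")
    case True
    then have "A (\<kappa> b) > 0" using \<kappa>J A by blast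
    moreover have "exp (- (\<sigma> * t)\<^sup>2 / 2) \<le> 1" by simp
    ultimately have "A (\<kappa> b) / pi * \<bar>sinc (A (\<kappa> b) * t)\<bar> * exp (- (\<sigma> * t)\<^sup>2 / 2) \<le> A (\<kappa> b) / pi * \<bar>sinc (A (\<kappa> b) * t)\<bar> * 1"
      by (intro mult_left_mono mult_nonneg_nonneg) auto
    then show ?thesis
      using True \<open>A (\<kappa> b) > 0\<close> unfolding \<phi>_def g_def slab_fourier_def by (simp only: if_True abs_mult) simp
  qed (simp add: \<phi>_def g_def)
  have gnn: "0 \<le> g b t" for b t using \<phi>g[of b t] abs_ge_zero[of "\<phi> b t"] by linarith
  have Knn: "0 \<le> K b" for b using A[OF \<kappa>J] by (auto simp: K_def less_imp_le)
  have M: "(\<integral>\<^sup>+y. ennreal (\<Prod>b\<in>?B. \<bar>\<phi> b (T (u, y) \<bullet> b)\<bar>) \<partial>lborel) \<le> ennreal (\<Prod>b\<in>?B. K b)" for u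
  proof -
    \<comment> \<open>If \<open>s b = 0\<close>, the factor does not depend on \<open>y\<close> and is bounded by its supremum, outside of the
      Brascamp-Lieb inequality.\<close>
    define B0 where "B0 = {b \<in> ?B. s b \<noteq> 0}"
    define f where "f b t = g b (rr b \<bullet> u + t) powr (1 / (norm (s b))\<^sup>2)" for b t
    have norm_ss: "s b \<bullet> s b = (norm (s b))\<^sup>2" for b by (simp add: power2_norm_eq_inner)
    have frame0: "(\<Sum>b\<in>B0. (s b \<bullet> y)\<^sup>2) = y \<bullet> y" for y
      using frame[of y] by (subst (asm) sum.mono_neutral_right[of ?B B0]) (auto simp: B0_def)
    have f0: "continuous_on UNIV (f b) \<and> integrable lborel (f b) \<and> ((\<integral>t. f b t \<partial>lborel) / norm (s b)) powr (s b \<bullet> s b) \<le> K b"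
      if "b \<in> B0" for b
    proof (cases "b \<in> \<iota> ` J")
      case True
      have b: "b \<in> ?B" "0 < norm (s b)" using that by (auto simp: B0_def)
      have "(norm (s b))\<^sup>2 \<le> 1 / 2"
        using ss[OF b(1)] half[OF \<kappa>J[OF True]] True unfolding norm_ss rr_def by simp
      note * = sinc_factor_integral[OF A[OF \<kappa>J[OF True]] b(2) this, of "rr b \<bullet> u"]
      have "f b = (\<lambda>t. (A (\<kappa> b) / pi * \<bar>sinc (A (\<kappa> b) * (rr b \<bullet> u + t))\<bar>) powr (1 / (norm (s b))\<^sup>2))"
        using True by (simp add: fun_eq_iff f_def g_def)
      then show ?thesis using * True unfolding norm_ss K_def by simp
    next
      case False
      have "s b \<bullet> s b = 1" using ss[of b] that False by (simp add: B0_def rr_def)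
      then have ns: "norm (s b) = 1" by (simp add: norm_eq_1)
      have "f b = (\<lambda>t. std_normal_density (t + 0))"
        using False by (simp add: fun_eq_iff f_def g_def ns rr_def)
      then have fb: "f b = std_normal_density" by simp
      have "continuous_on UNIV (normal_density 0 1)" unfolding normal_density_def by (intro continuous_intros) auto
      then show ?thesis unfolding fb using False ns by (simp add: K_def norm_ss)
    qed
    have pt: "(\<Prod>b\<in>?B. \<bar>\<phi> b (T (u, y) \<bullet> b)\<bar>) \<le> (\<Prod>b\<in>?B - B0. K b) * (\<Prod>b\<in>B0. f b (s b \<bullet> y) powr (s b \<bullet> s b))" for y
    proof -
      have "(\<Prod>b\<in>?B. \<bar>\<phi> b (T (u, y) \<bullet> b)\<bar>) = (\<Prod>b\<in>?B - B0. \<bar>\<phi> b (T (u, y) \<bullet> b)\<bar>) * (\<Prod>b\<in>B0. \<bar>\<phi> b (T (u, y) \<bullet> b)\<bar>)"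
        by (intro prod.subset_diff) (auto simp: B0_def)
      also have "\<dots> \<le> (\<Prod>b\<in>?B - B0. K b) * (\<Prod>b\<in>B0. f b (s b \<bullet> y) powr (s b \<bullet> s b))"
      proof (intro mult_mono prod_mono conjI prod_nonneg)
        fix b assume b: "b \<in> ?B - B0"
        then have sb: "s b = 0" by (auto simp: B0_def)
        then have "rr b \<bullet> rr b = 1" using ss[of b] b by simp
        then have "b \<in> \<iota> ` J" by (auto simp: rr_def split: if_splits)
        have "\<bar>\<phi> b (T (u, y) \<bullet> b)\<bar> \<le> A (\<kappa> b) / pi * \<bar>sinc (A (\<kappa> b) * (T (u, y) \<bullet> b))\<bar>"
          using \<phi>g[of b "T (u, y) \<bullet> b"] \<open>b \<in> \<iota> ` J\<close> by (simp only: g_def if_True)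
        also have "\<dots> \<le> A (\<kappa> b) / pi * 1"
          using A[OF \<kappa>J[OF \<open>b \<in> \<iota> ` J\<close>]] by (intro mult_left_mono abs_sinc_le_1) auto
        also have "\<dots> = K b" using A[OF \<kappa>J[OF \<open>b \<in> \<iota> ` J\<close>]] \<open>b \<in> \<iota> ` J\<close> sb by (simp add: K_def)
        finally show "\<bar>\<phi> b (T (u, y) \<bullet> b)\<bar> \<le> K b" .
      next
        fix b assume b: "b \<in> B0"
        then have "\<bar>\<phi> b (T (u, y) \<bullet> b)\<bar> \<le> g b (rr b \<bullet> u + s b \<bullet> y)"
          using \<phi>g T_coord by (auto simp: B0_def)
        also have "\<dots> = f b (s b \<bullet> y) powr (s b \<bullet> s b)"
          using b gnn by (simp add: f_def powr_powr norm_ss B0_def)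
        finally show "\<bar>\<phi> b (T (u, y) \<bullet> b)\<bar> \<le> f b (s b \<bullet> y) powr (s b \<bullet> s b)" .
      qed (use Knn in auto)
      finally show ?thesis .
    qed
    have [measurable]: "f b \<in> borel_measurable borel" if "b \<in> B0" for b
      using f0[OF that] by (auto intro: borel_measurable_continuous_onI)
    have "(\<integral>\<^sup>+y. ennreal (\<Prod>b\<in>?B. \<bar>\<phi> b (T (u, y) \<bullet> b)\<bar>) \<partial>lborel)
      \<le> (\<integral>\<^sup>+y. ennreal (\<Prod>b\<in>?B - B0. K b) * ennreal (\<Prod>b\<in>B0. f b (s b \<bullet> y) powr (s b \<bullet> s b)) \<partial>lborel)"
      using pt Knn by (intro nn_integral_mono) (simp add: ennreal_mult[symmetric] prod_nonneg ennreal_leI)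
    also have "\<dots> = ennreal (\<Prod>b\<in>?B - B0. K b) * (\<integral>\<^sup>+y. ennreal (\<Prod>b\<in>B0. f b (s b \<bullet> y) powr (s b \<bullet> s b)) \<partial>lborel)"
      by (intro nn_integral_cmult) measurable
    also have "\<dots> \<le> ennreal (\<Prod>b\<in>?B - B0. K b) * ennreal (\<Prod>b\<in>B0. ((\<integral>t. f b t \<partial>lborel) / norm (s b)) powr (s b \<bullet> s b))"
    proof (rule mult_left_mono)
      have "finite B0" "\<And>b. b \<in> B0 \<Longrightarrow> s b \<noteq> 0" "\<And>b t. 0 \<le> f b t" by (auto simp: B0_def f_def)
      then show "(\<integral>\<^sup>+y. ennreal (\<Prod>b\<in>B0. f b (s b \<bullet> y) powr (s b \<bullet> s b)) \<partial>lborel)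
        \<le> ennreal (\<Prod>b\<in>B0. ((\<integral>t. f b t \<partial>lborel) / norm (s b)) powr (s b \<bullet> s b))"
        using f0 by (intro Brascamp_Lieb frame0) auto
    qed simp
    also have "\<dots> \<le> ennreal (\<Prod>b\<in>?B - B0. K b) * ennreal (\<Prod>b\<in>B0. K b)"
      using f0 by (intro mult_left_mono ennreal_leI prod_mono) auto
    also have "\<dots> = ennreal (\<Prod>b\<in>?B. K b)"
      using Knn prod.subset_diff[of B0 ?B K] by (simp add: ennreal_mult[symmetric] prod_nonneg B0_def)
    finally show ?thesis .
  qed
  have "(\<integral>\<^sup>+x. ennreal (gauss_weight \<rho> x * (\<Prod>b\<in>?B. F b (T (x, 0) \<bullet> b))) \<partial>lborel)
     \<le> ennreal ((2 * pi) ^ DIM(real^'k)) * ennreal (\<Prod>b\<in>?B. K b)"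
  proof (rule fourier_section_inequality[OF T(1) \<rho> _ _ _ M])
    fix b x
    show "integrable lborel (\<phi> b)"
      using slab_fourier_integrable[OF \<sigma> A[OF \<kappa>J]] by (simp add: \<phi>_def)
    show "0 \<le> F b x" by (simp add: F_def slab_prob_nonneg)
    show "(CLINT t|lborel. complex_of_real (\<phi> b t) * iexp (t * x)) = complex_of_real (F b x)"
    proof (cases "b \<in> \<iota> ` J")
      case True
      then show ?thesis using slab_prob_fourier[OF \<sigma> A[OF \<kappa>J[OF True]]] by (simp add: \<phi>_def F_def)
    next
      case False
      have "(CLINT t|lborel. complex_of_real (std_normal_density t) * iexp (t * x)) = char std_normal_distribution x"
        unfolding char_def by (subst integral_density) (auto simp: mult_ac scaleR_conv_of_real)
      then show ?thesis using False by (simp add: \<phi>_def F_def char_std_normal_distribution)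
    qed
  qed
  moreover have "(\<Prod>b\<in>?B. F b (T (x, 0) \<bullet> b)) = (\<Prod>j\<in>J. slab_prob \<sigma> (A j) (r j \<bullet> x))" for x
  proof -
    have "(\<Prod>b\<in>?B. F b (T (x, 0) \<bullet> b)) = (\<Prod>b\<in>?B. if b \<in> \<iota> ` J then slab_prob \<sigma> (A (\<kappa> b)) (r (\<kappa> b) \<bullet> x) else 1)"
      by (intro prod.cong refl) (simp add: F_def T_coord rr_def)
    then show ?thesis using split[of "\<lambda>j. slab_prob \<sigma> (A j) (r j \<bullet> x)"] by simp
  qed
  ultimately have "(\<integral>\<^sup>+x. ennreal (gauss_weight \<rho> x * (\<Prod>j\<in>J. slab_prob \<sigma> (A j) (r j \<bullet> x))) \<partial>lborel)
     \<le> ennreal ((2 * pi) ^ DIM(real^'k)) * ennreal (\<Prod>b\<in>?B. K b)" by (simp only:)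
  also have "ennreal ((2 * pi) ^ DIM(real^'k)) * ennreal (\<Prod>b\<in>?B. K b)
    = ennreal ((2 * pi) ^ CARD('k) * (\<Prod>j\<in>J. A j / pi * (sqrt 2 * pi / A j) powr (1 - r j \<bullet> r j)))"
  proof -
    have "(\<Prod>b\<in>?B. K b) = (\<Prod>b\<in>?B. if b \<in> \<iota> ` J then A (\<kappa> b) / pi * (sqrt 2 * pi / A (\<kappa> b)) powr (1 - r (\<kappa> b) \<bullet> r (\<kappa> b)) else 1)"
      by (intro prod.cong refl) (simp add: K_def ss rr_def)
    also have "\<dots> = (\<Prod>j\<in>J. A j / pi * (sqrt 2 * pi / A j) powr (1 - r j \<bullet> r j))" by (rule split)
    finally show ?thesis by (simp add: ennreal_mult')
  qed
  also have "(2 * pi) ^ CARD('k) * (\<Prod>j\<in>J. A j / pi * (sqrt 2 * pi / A j) powr (1 - r j \<bullet> r j))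
    = 2 ^ CARD('k) * 2 powr ((real (card J) - real CARD('k)) / 2) * (\<Prod>j\<in>J. A j powr (r j \<bullet> r j))"
  proof -
    have "A j / pi * (sqrt 2 * pi / A j) powr (1 - r j \<bullet> r j)
      = 2 powr ((1 - r j \<bullet> r j) / 2) * pi powr (- (r j \<bullet> r j)) * A j powr (r j \<bullet> r j)" if "j \<in> J" for j
    proof -
      define c where "c = r j \<bullet> r j"
      have "(sqrt 2 * pi / A j) powr (1 - c) = 2 powr ((1 - c) / 2) * (pi powr (1 - c) / A j powr (1 - c))"
        using A[OF that] by (simp add: powr_mult powr_divide powr_half_sqrt[symmetric] powr_powr)
      also have "pi powr (1 - c) / A j powr (1 - c) = pi / A j * (pi powr (- c) * A j powr c)"
        using A[OF that] by (simp add: powr_diff powr_minus field_simps)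
      finally show ?thesis unfolding c_def[symmetric] using A[OF that] by simp
    qed
    then have "(\<Prod>j\<in>J. A j / pi * (sqrt 2 * pi / A j) powr (1 - r j \<bullet> r j))
      = (\<Prod>j\<in>J. 2 powr ((1 - r j \<bullet> r j) / 2)) * (\<Prod>j\<in>J. pi powr (- (r j \<bullet> r j))) * (\<Prod>j\<in>J. A j powr (r j \<bullet> r j))"
      by (simp add: prod.distrib)
    also have "(\<Prod>j\<in>J. 2 powr ((1 - r j \<bullet> r j) / 2)) = (2 :: real) powr ((real (card J) - real CARD('k)) / 2)"
      by (subst powr_sum[symmetric]) (auto simp: J sum_divide_distrib[symmetric] sum_subtractf trace)
    also have "(\<Prod>j\<in>J. pi powr (- (r j \<bullet> r j))) = 1 / pi ^ CARD('k)"
      by (subst powr_sum[symmetric]) (auto simp: J sum_negf trace powr_minus powr_realpow field_simps)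
    finally show ?thesis by (simp add: power_mult_distrib)
  qed
  finally show ?thesis .
qed

text \<open>
  The limit \<open>\<sigma> \<rightarrow> 0\<close> of \<open>gaussian_section_bound\<close>. Enlarging the half sides to \<open>a j + sqrt \<sigma>\<close> makes each
  smoothed indicator at least \<open>\<nu> \<sigma>\<close> on the polytope \<open>Q\<close>, and the weight of width \<open>1 / \<sigma>\<close> is at
  least \<open>exp (- (c * \<sigma>\<^sup>2) / 2)\<close> there, since \<open>c\<close> bounds \<open>x \<bullet> x\<close> on \<open>Q\<close>. Both tend to \<open>1\<close>.
\<close>

lemma slab_section_volume:
  fixes r :: "'j \<Rightarrow> real^'k" and a :: "'j \<Rightarrow> real"
  assumes J: "finite J" and id: "\<And>x. (\<Sum>j\<in>J. (r j \<bullet> x)\<^sup>2) = x \<bullet> x"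
    and half: "\<And>j. j \<in> J \<Longrightarrow> 1 / 2 \<le> r j \<bullet> r j" and a: "\<And>j. j \<in> J \<Longrightarrow> 0 < a j"
  shows "{x. \<forall>j\<in>J. \<bar>r j \<bullet> x\<bar> \<le> a j} \<in> lmeasurable"
    and "measure lebesgue {x. \<forall>j\<in>J. \<bar>r j \<bullet> x\<bar> \<le> a j}
      \<le> 2 ^ CARD('k) * 2 powr ((real (card J) - real CARD('k)) / 2) * (\<Prod>j\<in>J. a j powr (r j \<bullet> r j))"
proof -
  define Q where "Q = {x. \<forall>j\<in>J. \<bar>r j \<bullet> x\<bar> \<le> a j}"
  define c where "c = (\<Sum>j\<in>J. (a j)\<^sup>2)"
  define C0 :: real where "C0 = 2 ^ CARD('k) * 2 powr ((real (card J) - real CARD('k)) / 2)"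
  have Qc: "x \<bullet> x \<le> c" if "x \<in> Q" for x
  proof -
    have "(r j \<bullet> x)\<^sup>2 \<le> (a j)\<^sup>2" if "j \<in> J" for j
      using \<open>x \<in> Q\<close> that by (auto simp: Q_def abs_le_square_iff[symmetric] intro: order_trans)
    then show ?thesis unfolding id[symmetric] c_def by (intro sum_mono)
  qed
  have "Q = (\<Inter>j\<in>J. {x. \<bar>r j \<bullet> x\<bar> \<le> a j})" by (auto simp: Q_def)
  moreover have "closed {x. \<bar>r j \<bullet> x\<bar> \<le> a j}" for j
    by (intro closed_Collect_le continuous_intros)
  ultimately have "closed Q" by (simp add: closed_INT)
  moreover have "bounded Q"
    unfolding bounded_iff using Qc by (intro exI[of _ "sqrt c"]) (auto simp: norm_eq_sqrt_inner)
  ultimately have comp: "compact Q" by (simp add: compact_eq_bounded_closed)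
  then show "{x. \<forall>j\<in>J. \<bar>r j \<bullet> x\<bar> \<le> a j} \<in> lmeasurable"
    unfolding Q_def[symmetric] by (rule lmeasurable_compact)
  have Qb: "Q \<in> sets borel" using comp by (simp add: borel_compact)
  define V where "V = measure lebesgue Q"
  have V: "emeasure lborel Q = ennreal V"
  proof -
    have "emeasure lborel Q \<noteq> \<top>" using emeasure_compact_finite[OF comp] by auto
    then show ?thesis using Qb unfolding V_def by (simp add: emeasure_eq_ennreal_measure measure_completion)
  qed
  interpret N: real_distribution std_normal_distribution by (rule real_dist_normal_dist)
  define \<nu> where "\<nu> \<sigma> = cdf std_normal_distribution (1 / sqrt \<sigma>) - cdf std_normal_distribution (- (1 / sqrt \<sigma>))" for \<sigma>
  have bound: "exp (- (c * \<sigma>\<^sup>2) / 2) * \<nu> \<sigma> ^ card J * V \<le> C0 * (\<Prod>j\<in>J. (a j + sqrt \<sigma>) powr (r j \<bullet> r j))"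
    if \<sigma>: "\<sigma> > 0" for \<sigma>
  proof -
    have \<nu>0: "0 \<le> \<nu> \<sigma>" unfolding \<nu>_def using \<sigma> N.cdf_nondecreasing[of "- (1 / sqrt \<sigma>)" "1 / sqrt \<sigma>"] by simp
    have slab: "\<nu> \<sigma> \<le> slab_prob \<sigma> (a j + sqrt \<sigma>) t" if "\<bar>t\<bar> \<le> a j" for j t
    proof -
      have q: "sqrt \<sigma> / \<sigma> = 1 / sqrt \<sigma>" using \<sigma> by (simp add: real_div_sqrt field_simps)
      have "(t - (a j + sqrt \<sigma>)) / \<sigma> \<le> - (sqrt \<sigma> / \<sigma>)" "sqrt \<sigma> / \<sigma> \<le> (t + (a j + sqrt \<sigma>)) / \<sigma>"
        using that \<sigma> by (auto simp: divide_le_cancel minus_divide_left simp del: minus_divide_left[symmetric])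
      then have "{- (1 / sqrt \<sigma>)<..1 / sqrt \<sigma>} \<subseteq> {(t - (a j + sqrt \<sigma>)) / \<sigma>..(t + (a j + sqrt \<sigma>)) / \<sigma>}"
        unfolding q by auto
      then have "measure std_normal_distribution {- (1 / sqrt \<sigma>)<..1 / sqrt \<sigma>} \<le> slab_prob \<sigma> (a j + sqrt \<sigma>) t"
        unfolding slab_prob_def by (intro N.finite_measure_mono) auto
      moreover have "\<nu> \<sigma> = measure std_normal_distribution {- (1 / sqrt \<sigma>)<..1 / sqrt \<sigma>}"
        unfolding \<nu>_def using \<sigma> by (intro N.cdf_diff_eq) simp
      ultimately show ?thesis by simp
    qed
    have pt: "exp (- (c * \<sigma>\<^sup>2) / 2) * \<nu> \<sigma> ^ card J \<le> gauss_weight (1 / \<sigma>) x * (\<Prod>j\<in>J. slab_prob \<sigma> (a j + sqrt \<sigma>) (r j \<bullet> x))"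
      if x: "x \<in> Q" for x
    proof (intro mult_mono)
      have "(x \<bullet> x) * \<sigma>\<^sup>2 \<le> c * \<sigma>\<^sup>2" using Qc[OF x] by (intro mult_right_mono) auto
      then show "exp (- (c * \<sigma>\<^sup>2) / 2) \<le> gauss_weight (1 / \<sigma>) x"
        using \<sigma> by (simp add: gauss_weight_def power_divide)
      have "(\<Prod>j\<in>J. \<nu> \<sigma>) \<le> (\<Prod>j\<in>J. slab_prob \<sigma> (a j + sqrt \<sigma>) (r j \<bullet> x))"
        using x by (intro prod_mono conjI \<nu>0 slab) (auto simp: Q_def)
      then show "\<nu> \<sigma> ^ card J \<le> (\<Prod>j\<in>J. slab_prob \<sigma> (a j + sqrt \<sigma>) (r j \<bullet> x))" by simp
    qed (auto simp: gauss_weight_def \<nu>0)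
    have "ennreal (exp (- (c * \<sigma>\<^sup>2) / 2) * \<nu> \<sigma> ^ card J * V) = ennreal (exp (- (c * \<sigma>\<^sup>2) / 2) * \<nu> \<sigma> ^ card J) * emeasure lborel Q"
      unfolding V using \<nu>0 by (intro ennreal_mult) (auto simp: V_def)
    also have "\<dots> = (\<integral>\<^sup>+x. ennreal (exp (- (c * \<sigma>\<^sup>2) / 2) * \<nu> \<sigma> ^ card J) * indicator Q x \<partial>lborel)"
      using Qb by (intro nn_integral_cmult_indicator[symmetric]) auto
    also have "\<dots> \<le> (\<integral>\<^sup>+x. ennreal (gauss_weight (1 / \<sigma>) x * (\<Prod>j\<in>J. slab_prob \<sigma> (a j + sqrt \<sigma>) (r j \<bullet> x))) \<partial>lborel)"
      using pt by (intro nn_integral_mono) (auto split: split_indicator intro!: ennreal_leI)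
    also have "\<dots> \<le> ennreal (C0 * (\<Prod>j\<in>J. (a j + sqrt \<sigma>) powr (r j \<bullet> r j)))"
      unfolding C0_def using a \<sigma> by (intro gaussian_section_bound J id half) (auto intro!: add_pos_pos)
    finally show ?thesis
      by (subst (asm) ennreal_le_iff) (auto simp: C0_def intro!: mult_nonneg_nonneg prod_nonneg)
  qed
  have inv_top: "filterlim (\<lambda>\<sigma>. 1 / sqrt \<sigma>) at_top (at_right 0)" by real_asymp
  have \<nu>_lim: "(\<nu> \<longlongrightarrow> 1 - 0) (at_right 0)"
    unfolding \<nu>_def
  proof (intro tendsto_diff)
    show "((\<lambda>\<sigma>. cdf std_normal_distribution (1 / sqrt \<sigma>)) \<longlongrightarrow> 1) (at_right 0)"
      by (rule filterlim_compose[OF N.cdf_lim_at_top_prob inv_top])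
    show "((\<lambda>\<sigma>. cdf std_normal_distribution (- (1 / sqrt \<sigma>))) \<longlongrightarrow> 0) (at_right 0)"
      by (rule filterlim_compose[OF N.cdf_lim_at_bot]) (use inv_top in \<open>simp add: filterlim_uminus_at_bot\<close>)
  qed
  have "((\<lambda>\<sigma>. exp (- (c * \<sigma>\<^sup>2) / 2) * \<nu> \<sigma> ^ card J * V) \<longlongrightarrow> exp (- (c * 0\<^sup>2) / 2) * (1 - 0) ^ card J * V) (at_right 0)"
    by (intro tendsto_intros \<nu>_lim) simp
  then have lim1: "((\<lambda>\<sigma>. exp (- (c * \<sigma>\<^sup>2) / 2) * \<nu> \<sigma> ^ card J * V) \<longlongrightarrow> V) (at_right 0)" by simp
  have "((\<lambda>\<sigma>. C0 * (\<Prod>j\<in>J. (a j + sqrt \<sigma>) powr (r j \<bullet> r j))) \<longlongrightarrow> C0 * (\<Prod>j\<in>J. (a j + sqrt 0) powr (r j \<bullet> r j))) (at_right 0)"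
  proof (intro tendsto_mult tendsto_prod tendsto_powr tendsto_add tendsto_real_sqrt tendsto_const)
    fix j assume "j \<in> J"
    then show "a j + sqrt 0 \<noteq> 0" using a by force
  qed (rule tendsto_ident_at)
  then have lim2: "((\<lambda>\<sigma>. C0 * (\<Prod>j\<in>J. (a j + sqrt \<sigma>) powr (r j \<bullet> r j))) \<longlongrightarrow> C0 * (\<Prod>j\<in>J. a j powr (r j \<bullet> r j))) (at_right 0)" by simp
  have "V \<le> C0 * (\<Prod>j\<in>J. a j powr (r j \<bullet> r j))"
  proof (rule tendsto_le[OF _ lim2 lim1])
    show "\<forall>\<^sub>F \<sigma> in at_right 0. exp (- (c * \<sigma>\<^sup>2) / 2) * \<nu> \<sigma> ^ card J * V \<le> C0 * (\<Prod>j\<in>J. (a j + sqrt \<sigma>) powr (r j \<bullet> r j))"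
      using eventually_at_right_less[of 0] by eventually_elim (rule bound)
  qed simp
  then show "measure lebesgue {x. \<forall>j\<in>J. \<bar>r j \<bullet> x\<bar> \<le> a j}
      \<le> 2 ^ CARD('k) * 2 powr ((real (card J) - real CARD('k)) / 2) * (\<Prod>j\<in>J. a j powr (r j \<bullet> r j))"
    unfolding V_def Q_def C0_def .
qed

section \<open>Sections of a body in John's position\<close>

text \<open>
  With \<open>u = 1 / c\<close>, which lies between \<open>1\<close> and \<open>2\<close>, the claim is \<open>2 powr (u - 1) \<le> u\<close>: an exponential
  lies below its chord.
\<close>

lemma two_powr_mult_self_powr_le_1:
  fixes c :: real
  assumes "1 / 2 \<le> c" "c \<le> 1"
  shows "2 powr (1 - c) * c powr c \<le> 1"
proof -
  have c: "c > 0" using assms by simp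
  define u where "u = 1 / c"
  have u: "1 \<le> u" "u \<le> 2" using assms c by (auto simp: u_def field_simps)
  have "2 powr (u - 1) * 1 powr (2 - u) \<le> (u - 1) * 2 + (2 - u) * 1"
    using u by (intro Youngs_inequality_0) auto
  then have "2 powr (u - 1) \<le> u" by simp
  then have "(2 powr (u - 1)) powr c \<le> u powr c" using c by (intro powr_mono2) auto
  moreover have "(2 powr (u - 1)) powr c = 2 powr (1 - c)"
  proof -
    have "(u - 1) * c = 1 - c" using c by (simp add: u_def left_diff_distrib)
    then show ?thesis by (simp add: powr_powr)
  qed
  moreover have "u powr c = 1 / c powr c" using c by (simp add: u_def powr_divide)
  ultimately show ?thesis using c by (simp add: field_simps)
qed

text \<open>
  A supporting hyperplane of \<open>K\<close> at \<open>v\<close> also supports the unit ball at its boundary point \<open>v\<close>, which leaves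
  only the tangent hyperplane of the ball.
\<close>

lemma contact_point_halfspace:
  fixes K :: "(real^'n) set"
  assumes K: "convex K" and ball: "cball 0 1 \<subseteq> K" and v: "v \<in> frontier K" "norm v = 1" and x: "x \<in> K"
  shows "x \<bullet> v \<le> 1"
proof -
  have "ball 0 1 \<subseteq> interior K"
    using ball by (metis ball_subset_cball interior_maximal open_ball order_trans)
  then have "interior K \<noteq> {}" using ball_eq_empty[of "0 :: real^'n" 1] by force
  then have "v \<notin> rel_interior K" "v \<in> closure K"
    using v(1) rel_interior_nonempty_interior[of K] by (auto simp: frontier_def)
  then obtain a where a: "a \<noteq> 0" "\<And>y. y \<in> closure K \<Longrightarrow> a \<bullet> v \<le> a \<bullet> y"
    using supporting_hyperplane_relative_frontier[OF K] by metis
  have "- ((1 / norm a) *\<^sub>R a) \<in> K" using a(1) by (intro subsetD[OF ball]) simp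
  then have "a \<bullet> v \<le> a \<bullet> (- ((1 / norm a) *\<^sub>R a))" using a(2) closure_subset[of K] by blast
  also have "\<dots> = - norm a" using a(1) by (simp add: dot_square_norm power2_eq_square)
  finally have av: "a \<bullet> v \<le> - norm a" .
  have "(a + norm a *\<^sub>R v) \<bullet> (a + norm a *\<^sub>R v) = 2 * norm a * (norm a + a \<bullet> v)"
  proof -
    have "v \<bullet> v = 1" using v(2) by (simp add: norm_eq_1)
    moreover have "a \<bullet> a = norm a * norm a" by (simp add: dot_square_norm power2_eq_square)
    ultimately show ?thesis
      by (simp add: inner_add_left inner_add_right inner_commute[of v a] algebra_simps)
  qed
  also have "\<dots> \<le> 0" using av by (intro mult_nonneg_nonpos) auto
  finally have "a + norm a *\<^sub>R v = 0" using inner_ge_zero[of "a + norm a *\<^sub>R v"] by (metis antisym inner_eq_zero_iff)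
  then have a_eq: "a = - (norm a *\<^sub>R v)" by (simp add: eq_neg_iff_add_eq_0)
  have "a \<bullet> v \<le> a \<bullet> x" using a(2) x closure_subset[of K] by blast
  moreover have "a \<bullet> v = - norm a" using v(2) by (subst a_eq) (simp add: dot_square_norm)
  moreover have "a \<bullet> x = - (norm a * (x \<bullet> v))" by (subst a_eq) (simp add: inner_commute)
  ultimately have "norm a * (x \<bullet> v) \<le> norm a * 1" by simp
  then show ?thesis by (rule mult_left_le_imp_le) (use a(1) in simp)
qed

lemma decomposition_of_identity_frame:
  assumes "decomposition_of_identity K m c v"
  shows "(\<Sum>j=1..m. c j * (v j \<bullet> z)\<^sup>2) = z \<bullet> z"
proof -
  have id: "mat 1 = (\<Sum>j=1..m. c j *\<^sub>R tensor (v j) (v j))"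
    using assms by (simp add: decomposition_of_identity_def)
  have "z \<bullet> z = z \<bullet> (mat 1 *v z)" by simp
  also have "mat 1 *v z = (\<Sum>j=1..m. (c j * (v j \<bullet> z)) *\<^sub>R v j)"
  proof -
    have "(mat 1 *v z) $ i = (\<Sum>j=1..m. (c j * (v j \<bullet> z)) *\<^sub>R v j) $ i" for i
    proof -
      have "(mat 1 *v z) $ i = (\<Sum>l\<in>UNIV. (\<Sum>j=1..m. c j * (v j $ i * v j $ l)) * z $ l)"
        unfolding id matrix_vector_mult_def by (simp add: tensor_def)
      also have "\<dots> = (\<Sum>j=1..m. \<Sum>l\<in>UNIV. c j * (v j $ i * v j $ l) * z $ l)"
        by (simp add: sum_distrib_right) (rule sum.swap)
      also have "\<dots> = (\<Sum>j=1..m. (c j * (v j \<bullet> z)) *\<^sub>R v j) $ i"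
        by (simp add: inner_vec_def sum_distrib_left sum_distrib_right mult_ac)
      finally show ?thesis .
    qed
    then show ?thesis by (simp add: vec_eq_iff)
  qed
  also have "z \<bullet> \<dots> = (\<Sum>j=1..m. c j * (v j \<bullet> z)\<^sup>2)"
    by (simp add: inner_sum_right power2_eq_square inner_commute mult_ac)
  finally show ?thesis by simp
qed

lemma orth_proj_isometry:
  assumes f: "isometry_onto f H" and H: "subspace H"
  shows "orth_proj H v = f (adjoint f v)" "norm (orth_proj H v) = norm (adjoint f v)"
proof -
  have lin: "linear f" and nf: "\<And>x. norm (f x) = norm x" and rg: "range f = H"
    using f by (auto simp: isometry_onto_def)
  have inner: "f x \<bullet> f y = x \<bullet> y" for x y
  proof -
    have "(norm (f x + f y))\<^sup>2 = (norm (x + y))\<^sup>2" using nf[of "x + y"] lin by (simp add: linear_add)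
    moreover have "(norm (f x))\<^sup>2 = (norm x)\<^sup>2" "(norm (f y))\<^sup>2 = (norm y)\<^sup>2" by (simp_all add: nf)
    ultimately show ?thesis
      by (simp add: power2_norm_eq_inner inner_add_left inner_add_right inner_commute)
  qed
  show *: "orth_proj H v = f (adjoint f v)"
  proof (rule orth_proj_eqI[OF H])
    show "f (adjoint f v) \<in> H" using rg by auto
    fix h assume "h \<in> H"
    then obtain y where "h = f y" using rg by auto
    moreover have "v \<bullet> f y = adjoint f v \<bullet> y" using adjoint_works[OF lin, of y v] by (simp add: inner_commute)
    ultimately show "orthogonal (v - f (adjoint f v)) h"
      by (simp add: orthogonal_def inner_diff_left inner)
  qed
  show "norm (orth_proj H v) = norm (adjoint f v)" unfolding * nf ..
qed


theorem proposition13: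
  fixes K H :: "(real^'n) set"
    and c :: "nat \<Rightarrow> real" and v :: "nat \<Rightarrow> real^'n"
    and m n k m0 :: nat and J :: "nat set"
  assumes "n = CARD('n)" and "k = CARD('k::finite)"
    and "convex_body K" and "centrally_symmetric K" and "john_position K"
    and "decomposition_of_identity K m c v"
    and "subspace H" and "dim H = k"
    and "J = {j \<in> {1..m}. orth_proj H (v j) \<noteq> 0}" and "m0 = card J"
    and "\<And>j. j \<in> J \<Longrightarrow> c j * (norm (orth_proj H (v j)))\<^sup>2 \<ge> 1 / 2"
  shows
    "subspace_volume TYPE('k) H (K \<inter> H)
       \<le> 2 powr ((real m0 - real k) / 2) * measure lebesgue (cbox (- 1) 1 :: (real^'k) set)
           * (\<Prod>j\<in>J. c j powr (c j * (norm (orth_proj H (v j)))\<^sup>2 / 2)) \<and>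
     2 powr ((real m0 - real k) / 2) * measure lebesgue (cbox (- 1) 1 :: (real^'k) set)
           * (\<Prod>j\<in>J. c j powr (c j * (norm (orth_proj H (v j)))\<^sup>2 / 2))
       \<le> (\<Prod>j\<in>J. (1 / norm (orth_proj H (v j))) powr (c j * (norm (orth_proj H (v j)))\<^sup>2))
           * measure lebesgue (cbox (- 1) 1 :: (real^'k) set) \<and>
     (\<Prod>j\<in>J. (1 / norm (orth_proj H (v j))) powr (c j * (norm (orth_proj H (v j)))\<^sup>2))
           * measure lebesgue (cbox (- 1) 1 :: (real^'k) set)
       \<le> (real n / real k) powr (real k / 2) * measure lebesgue (cbox (- 1) 1 :: (real^'k) set)"
proof -
  have k0: "0 < k" using assms(2) by simp
  have finJ: "finite J" and JM: "J \<subseteq> {1..m}" using assms(9) by auto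
  have dec: "c j \<in> {0<..1} \<and> v j \<in> frontier K \<inter> sphere 0 1" if "j \<in> {1..m}" for j
    using assms(6) that unfolding decomposition_of_identity_def by blast
  have cM: "0 \<le> c j" if "j \<in> {1..m}" for j using dec[OF that] by simp
  have c0: "0 < c j" if "j \<in> J" for j using dec[of j] JM that by auto
  have norm_v: "norm (v j) = 1" if "j \<in> {1..m}" for j using dec[OF that] by simp
  obtain f :: "real^'k \<Rightarrow> real^'n" where f: "isometry_onto f H"
    using isometry_onto_exists[where 'k='k, of H] assms(2,7,8) by auto
  then have linf: "linear f" and nf: "\<And>x. norm (f x) = norm x" and rg: "range f = H"
    by (auto simp: isometry_onto_def)
  \<comment> \<open>\<open>w j\<close> is the projection of \<open>v j\<close> onto \<open>H\<close>, read in \<open>\<real>\<^sup>k\<close> through the isometry \<open>f\<close>.\<close>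
  define w where "w j = adjoint f (v j)" for j
  define t where "t j = norm (orth_proj H (v j))" for j
  have fw: "v j \<bullet> f x = w j \<bullet> x" for j x
    using adjoint_works[OF linf, of x "v j"] by (simp add: w_def inner_commute)
  have nw: "norm (w j) = t j" for j by (simp add: t_def w_def orth_proj_isometry(2)[OF f assms(7)])
  have t0: "0 < t j" if "j \<in> J" for j using that assms(9) by (auto simp: t_def)
  define r where "r j = sqrt (c j) *\<^sub>R w j" for j
  define d where "d j = c j * (t j)\<^sup>2" for j
  have rr: "r j \<bullet> r j = d j" if "j \<in> J" for j
    using c0[OF that] by (simp add: r_def d_def nw[symmetric] power2_norm_eq_inner)
  have frame: "(\<Sum>j\<in>J. (r j \<bullet> x)\<^sup>2) = x \<bullet> x" for x
  proof -
    have "(\<Sum>j\<in>J. (r j \<bullet> x)\<^sup>2) = (\<Sum>j\<in>J. c j * (v j \<bullet> f x)\<^sup>2)"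
      using c0 by (intro sum.cong refl) (simp add: r_def power_mult_distrib fw less_imp_le)
    also have "\<dots> = (\<Sum>j=1..m. c j * (v j \<bullet> f x)\<^sup>2)"
    proof (rule sum.mono_neutral_left)
      show "\<forall>j\<in>{1..m} - J. c j * (v j \<bullet> f x)\<^sup>2 = 0"
      proof
        fix j assume "j \<in> {1..m} - J"
        then have "norm (w j) = 0" using assms(9) by (simp add: nw t_def)
        then show "c j * (v j \<bullet> f x)\<^sup>2 = 0" by (simp add: fw)
      qed
    qed (use JM in auto)
    also have "\<dots> = f x \<bullet> f x" by (rule decomposition_of_identity_frame[OF assms(6)])
    also have "\<dots> = x \<bullet> x" using nf[of x] by (simp add: norm_eq_sqrt_inner)
    finally show ?thesis .
  qed
  have trace: "(\<Sum>j\<in>J. d j) = real k"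
    using frame_trace[OF frame] rr assms(2) by simp
  have half: "1 / 2 \<le> d j" if "j \<in> J" for j using assms(11)[OF that] by (simp add: d_def t_def)
  \<comment> \<open>The frame identity at \<open>r j\<close> contains the term \<open>(d j)\<^sup>2\<close> and has the value \<open>d j\<close>.\<close>
  have d1: "d j \<le> 1" if "j \<in> J" for j
  proof -
    have "(r j \<bullet> r j)\<^sup>2 \<le> (\<Sum>i\<in>J. (r i \<bullet> r j)\<^sup>2)"
      using finJ that by (intro member_le_sum) auto
    then have "d j * d j \<le> d j * 1" unfolding frame rr[OF that] by (simp add: power2_eq_square)
    then show ?thesis by (rule mult_left_le_imp_le) (use half[OF that] in simp)
  qed
  have sq_powr: "((1 / t j)\<^sup>2) powr x = (1 / t j) powr (2 * x)" if "j \<in> J" for j x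
  proof -
    have "(1 / t j)\<^sup>2 = (1 / t j) powr 2" using t0[OF that] by simp
    then show ?thesis by (simp only: powr_powr)
  qed
  define V where "V = measure lebesgue (cbox (- 1) 1 :: (real^'k) set)"
  have V: "V = 2 ^ k"
  proof -
    have "0 \<in> cbox (- 1) (1 :: real^'k)" by (simp add: mem_box_cart)
    then have "cbox (- 1) (1 :: real^'k) \<noteq> {}" by blast
    then show ?thesis
      unfolding V_def by (simp add: measure_completion content_cbox_cart assms(2))
  qed
  have V0: "0 \<le> V" by (simp add: V)
  have sqrt_powr: "sqrt (c j) powr d j = c j powr (d j / 2)" if "j \<in> J" for j
    using c0[OF that] by (simp add: powr_half_sqrt[symmetric] powr_powr)
  have "subspace_volume TYPE('k) H (K \<inter> H) \<le> 2 powr ((real m0 - real k) / 2) * V * (\<Prod>j\<in>J. c j powr (d j / 2))"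
  proof -
    have K: "convex K" "compact K" using assms(3) by (auto simp: convex_body_def)
    have ballK: "cball 0 1 \<subseteq> K"
      using assms(5) by (simp add: john_position_def max_volume_ellipsoid_def)
    have K_slab: "\<bar>x \<bullet> v j\<bar> \<le> 1" if "x \<in> K" "j \<in> {1..m}" for x j
    proof -
      have "- x \<in> K" using assms(4) that(1) by (auto simp: centrally_symmetric_def)
      then show ?thesis
        using contact_point_halfspace[OF K(1) ballK, of "v j" x] contact_point_halfspace[OF K(1) ballK, of "v j" "- x"]
          dec[OF that(2)] that(1) by (simp add: abs_le_iff)
    qed
    have "f -` (K \<inter> H) \<subseteq> {x. \<forall>j\<in>J. \<bar>r j \<bullet> x\<bar> \<le> sqrt (c j)}"
    proof safe
      fix x j assume x: "f x \<in> K" and j: "j \<in> J"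
      have "\<bar>r j \<bullet> x\<bar> = sqrt (c j) * \<bar>f x \<bullet> v j\<bar>"
        using c0[OF j] by (simp add: r_def abs_mult fw[symmetric] inner_commute[of "f x" "v j"])
      also have "\<dots> \<le> sqrt (c j) * 1"
        using K_slab[OF x, of j] JM j c0[OF j] by (intro mult_left_mono) auto
      finally show "\<bar>r j \<bullet> x\<bar> \<le> sqrt (c j)" by simp
    qed
    moreover have KH: "K \<inter> H \<in> sets borel"
      using K(2) closed_subspace[OF assms(7)] by (auto simp: compact_imp_closed)
    moreover have "f -` (K \<inter> H) \<in> sets borel"
    proof -
      have "f \<in> borel_measurable borel"
        using linf by (intro borel_measurable_continuous_onI linear_continuous_on) (simp add: linear_conv_bounded_linear)
      from measurable_sets[OF this KH] show ?thesis by simp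
    qed
    moreover note slab = slab_section_volume[OF finJ frame, of "\<lambda>j. sqrt (c j)"]
    ultimately have "measure lebesgue (f -` (K \<inter> H)) \<le> measure lebesgue {x. \<forall>j\<in>J. \<bar>r j \<bullet> x\<bar> \<le> sqrt (c j)}"
      using rr half c0 by (intro measure_mono_fmeasurable) auto
    also have "\<dots> \<le> 2 ^ CARD('k) * 2 powr ((real (card J) - real CARD('k)) / 2) * (\<Prod>j\<in>J. sqrt (c j) powr (r j \<bullet> r j))"
      using rr half c0 by (intro slab(2)) auto
    also have "(\<Prod>j\<in>J. sqrt (c j) powr (r j \<bullet> r j)) = (\<Prod>j\<in>J. c j powr (d j / 2))"
      using rr sqrt_powr by (intro prod.cong) auto
    finally show ?thesis
      unfolding subspace_volume_eq[OF f KH] V using assms(2,10) by (simp add: mult_ac)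
  qed
  moreover have "2 powr ((real m0 - real k) / 2) * V * (\<Prod>j\<in>J. c j powr (d j / 2)) \<le> (\<Prod>j\<in>J. (1 / t j) powr d j) * V"
  proof -
    have "(2 :: real) powr ((real m0 - real k) / 2) = (\<Prod>j\<in>J. 2 powr ((1 - d j) / 2))"
      using finJ by (subst powr_sum[symmetric]) (auto simp: sum_divide_distrib[symmetric] sum_subtractf trace assms(10))
    then have "2 powr ((real m0 - real k) / 2) * (\<Prod>j\<in>J. c j powr (d j / 2)) = (\<Prod>j\<in>J. 2 powr ((1 - d j) / 2) * c j powr (d j / 2))"
      by (simp add: prod.distrib)
    also have "\<dots> \<le> (\<Prod>j\<in>J. (1 / t j) powr d j)"
    proof (intro prod_mono conjI)
      fix j assume j: "j \<in> J"
      have "c j = d j * (1 / t j)\<^sup>2" using t0[OF j] by (simp add: d_def power_divide)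
      then have "c j powr (d j / 2) = d j powr (d j / 2) * ((1 / t j)\<^sup>2) powr (d j / 2)"
        by (simp only: powr_mult)
      then have "c j powr (d j / 2) = d j powr (d j / 2) * (1 / t j) powr d j"
        by (simp add: sq_powr[OF j] del: one_divide_eq_0_iff)
      then have "2 powr ((1 - d j) / 2) * c j powr (d j / 2) = (2 powr (1 - d j) * d j powr d j) powr (1 / 2) * (1 / t j) powr d j"
        using half[OF j] by (simp add: powr_mult powr_powr)
      also have "\<dots> \<le> 1 powr (1 / 2) * (1 / t j) powr d j"
        using two_powr_mult_self_powr_le_1[OF half[OF j] d1[OF j]] by (intro mult_right_mono powr_mono2) auto
      finally show "2 powr ((1 - d j) / 2) * c j powr (d j / 2) \<le> (1 / t j) powr d j" by simp
    qed auto
    finally have "2 powr ((real m0 - real k) / 2) * (\<Prod>j\<in>J. c j powr (d j / 2)) * V \<le> (\<Prod>j\<in>J. (1 / t j) powr d j) * V"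
      by (rule mult_right_mono[OF _ V0])
    then show ?thesis by (simp only: mult_ac)
  qed
  moreover have "(\<Prod>j\<in>J. (1 / t j) powr d j) * V \<le> (real n / real k) powr (real k / 2) * V"
  proof (rule mult_right_mono[OF _ V0])
    have "(\<Prod>j\<in>J. ((1 / t j)\<^sup>2) powr (d j / real k)) \<le> (\<Sum>j\<in>J. d j / real k * (1 / t j)\<^sup>2)"
    proof (rule weighted_arith_geom_mean[OF finJ])
      show "0 \<le> d j / real k" if "j \<in> J" for j using half[OF that] by simp
      show "(\<Sum>j\<in>J. d j / real k) = 1" using trace k0 by (simp add: sum_divide_distrib[symmetric])
      show "0 < (1 / t j)\<^sup>2" if "j \<in> J" for j using t0[OF that] by simp
    qed
    also have "\<dots> = (\<Sum>j\<in>J. c j) / real k"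
      unfolding sum_divide_distrib using t0 by (intro sum.cong refl) (force simp: d_def power_divide)
    also have "\<dots> \<le> real n / real k"
    proof (intro divide_right_mono)
      have "(\<Sum>j=1..m. (sqrt (c j) *\<^sub>R v j) \<bullet> (sqrt (c j) *\<^sub>R v j)) = real DIM(real^'n)"
      proof (rule frame_trace)
        fix z
        show "(\<Sum>j=1..m. ((sqrt (c j) *\<^sub>R v j) \<bullet> z)\<^sup>2) = z \<bullet> z"
          unfolding decomposition_of_identity_frame[OF assms(6), of z, symmetric]
          using cM by (intro sum.cong refl) (simp add: power_mult_distrib)
      qed
      also have "(\<Sum>j=1..m. (sqrt (c j) *\<^sub>R v j) \<bullet> (sqrt (c j) *\<^sub>R v j)) = (\<Sum>j=1..m. c j)"
      proof (intro sum.cong refl)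
        fix j assume j: "j \<in> {1..m}"
        then have "v j \<bullet> v j = 1" using norm_v by (simp add: norm_eq_1)
        then show "(sqrt (c j) *\<^sub>R v j) \<bullet> (sqrt (c j) *\<^sub>R v j) = c j" using cM[OF j] by simp
      qed
      finally have "(\<Sum>j=1..m. c j) = real n" using assms(1) by simp
      moreover have "(\<Sum>j\<in>J. c j) \<le> (\<Sum>j=1..m. c j)"
        using JM cM by (intro sum_mono2) auto
      ultimately show "(\<Sum>j\<in>J. c j) \<le> real n" by simp
    qed simp
    finally have "(\<Prod>j\<in>J. ((1 / t j)\<^sup>2) powr (d j / real k)) powr (real k / 2) \<le> (real n / real k) powr (real k / 2)"
      by (intro powr_mono2) (auto intro: prod_nonneg)
    moreover have "(\<Prod>j\<in>J. ((1 / t j)\<^sup>2) powr (d j / real k)) powr (real k / 2) = (\<Prod>j\<in>J. (1 / t j) powr d j)"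
    proof -
      have "(\<Prod>j\<in>J. ((1 / t j)\<^sup>2) powr (d j / real k)) powr (real k / 2) = (\<Prod>j\<in>J. (((1 / t j)\<^sup>2) powr (d j / real k)) powr (real k / 2))"
        by (rule prod_powr_distrib)
      also have "\<dots> = (\<Prod>j\<in>J. (1 / t j) powr d j)"
      proof (intro prod.cong refl)
        fix j assume j: "j \<in> J"
        show "(((1 / t j)\<^sup>2) powr (d j / real k)) powr (real k / 2) = (1 / t j) powr d j"
          unfolding sq_powr[OF j] powr_powr using k0 by simp
      qed
      finally show ?thesis .
    qed
    ultimately show "(\<Prod>j\<in>J. (1 / t j) powr d j) \<le> (real n / real k) powr (real k / 2)" by simp
  qed
  ultimately show ?thesis unfolding V_def d_def t_def by (intro conjI)
qed

end
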